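(* For fixed constants $r,\ell$, Vertex $(r,\ell)$ Partization on perfect graphs (given a perfect graph $G$ and a positive integer $k$, decide whether there is $S\subseteq V(G)$ with $|S|\leq k$ such that $G-S$ is an $(r,\ell)$-graph; parameter $k$) admits a kernel of size $k^{\mathcal{O}(d)}$ and has an algorithm with running time $d^k n^{\mathcal{O}(d)}$, where $d=f(r,\ell)$.
   Context: A graph is an $(r,\ell)$-graph if its vertex set can be partitioned into $r$ independent sets and $\ell$ cliques. A graph is an $(r,\ell)$-split graph if its vertex set can be partitioned into $V_1,V_2$ with the largest clique in $G[V_1]$ of size at most $r$ and the largest independent set in $G[V_2]$ of size at most $\ell$. For fixed $r,\ell$ there is a finite set of forbidden induced subgraphs characterizing $(r,\ell)$-split graphs (Gyárfás), and $f(r,\ell)$ is a bound (depending only on $r,\ell$) on the number of vertices of the largest graph in this forbidden set. A graph is perfect if for every induced subgraph $H$, the chromatic number of $H$ equals the size of a maximum clique of $H$. $n=|V(G)|$. *)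

theory Defs
  imports "HOL-Library.Ramsey" "HOL-Library.Disjoint_Sets"
begin

section \<open>Graphs\<close>

text \<open>A graph is a pair of a vertex set and a set of two-element edges. The notions
  \<^const>\<open>clique\<close> and \<^const>\<open>indep\<close> (arguments: vertex set, edge set) are those of
  \<^theory>\<open>HOL-Library.Ramsey\<close>.\<close>

type_synonym 'a graph = "'a set \<times> 'a set set"

abbreviation verts :: "'a graph \<Rightarrow> 'a set" where "verts G \<equiv> fst G"
abbreviation edges :: "'a graph \<Rightarrow> 'a set set" where "edges G \<equiv> snd G"

definition fin_graph :: "'a graph \<Rightarrow> bool" where
  "fin_graph G \<longleftrightarrow> finite (verts G) \<and> edges G \<subseteq> nsets (verts G) 2"

definition induced :: "'a graph \<Rightarrow> 'a set \<Rightarrow> 'a graph" where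
  "induced G X = (verts G \<inter> X, {e \<in> edges G. e \<subseteq> X})"

definition delete :: "'a graph \<Rightarrow> 'a set \<Rightarrow> 'a graph" where
  "delete G S = induced G (verts G - S)"

definition clique_number :: "'a graph \<Rightarrow> nat" where
  "clique_number G = Max (card ` {K. K \<subseteq> verts G \<and> clique K (edges G)})"

definition independence_number :: "'a graph \<Rightarrow> nat" where
  "independence_number G = Max (card ` {K. K \<subseteq> verts G \<and> indep K (edges G)})"

definition colorable :: "'a graph \<Rightarrow> nat \<Rightarrow> bool" where
  "colorable G q \<longleftrightarrow>
     (\<exists>col :: 'a \<Rightarrow> nat. (\<forall>v\<in>verts G. col v < q) \<and>
        (\<forall>u\<in>verts G. \<forall>v\<in>verts G. {u, v} \<in> edges G \<longrightarrow> col u \<noteq> col v))"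

definition chromatic_number :: "'a graph \<Rightarrow> nat" where
  "chromatic_number G = (LEAST q. colorable G q)"

definition perfect :: "'a graph \<Rightarrow> bool" where
  "perfect G \<longleftrightarrow> (\<forall>X\<subseteq>verts G. chromatic_number (induced G X) = clique_number (induced G X))"

text \<open>As usual, the parts of the partitions below may be empty.\<close>

definition rl_graph :: "nat \<Rightarrow> nat \<Rightarrow> 'a graph \<Rightarrow> bool" where
  "rl_graph r l G \<longleftrightarrow>
     (\<exists>P :: nat \<Rightarrow> 'a set.
        (\<Union>i<r + l. P i) = verts G \<and> disjoint_family_on P {..<r + l} \<and>
        (\<forall>i<r. indep (P i) (edges G)) \<and>
        (\<forall>i\<in>{r..<r + l}. clique (P i) (edges G)))"

definition rl_split :: "nat \<Rightarrow> nat \<Rightarrow> 'a graph \<Rightarrow> bool" where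
  "rl_split r l G \<longleftrightarrow>
     (\<exists>V1 V2. V1 \<union> V2 = verts G \<and> V1 \<inter> V2 = {} \<and>
        clique_number (induced G V1) \<le> r \<and> independence_number (induced G V2) \<le> l)"

text \<open>The forbidden induced subgraphs for \<open>(r, l)\<close>-split graphs: the graphs that are not
  \<open>(r, l)\<close>-split while all their proper induced subgraphs are. Vertices are natural numbers;
  every finite graph is isomorphic to such a graph, so sizes are not affected.\<close>

definition forbidden_set :: "nat \<Rightarrow> nat \<Rightarrow> nat graph set" where
  "forbidden_set r l =
     {H. fin_graph H \<and> \<not> rl_split r l H \<and> (\<forall>X. X \<subset> verts H \<longrightarrow> rl_split r l (induced H X))}"


section \<open>Random access machines\<close>

text \<open>A unit-cost RAM whose only arithmetic is addition and truncated subtraction, presented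
  as a structured language. The memory is a family of unbounded arrays: \<open>s a i\<close> is cell \<open>i\<close>
  of array \<open>a\<close>. Array names are constants of the program and indices are computed, so a
  program uses finitely many arrays, which can be interleaved in a single memory; an array
  accessed only at a constant index serves as a register.\<close>

type_synonym state = "nat \<Rightarrow> nat \<Rightarrow> nat"

datatype expr = Const nat | Cell nat expr | Add expr expr | Sub expr expr

fun val :: "expr \<Rightarrow> state \<Rightarrow> nat" where
  "val (Const c) s = c"
| "val (Cell a e) s = s a (val e s)"
| "val (Add e1 e2) s = val e1 s + val e2 s"
| "val (Sub e1 e2) s = val e1 s - val e2 s"

fun cost :: "expr \<Rightarrow> nat" where
  "cost (Const c) = 1"
| "cost (Cell a e) = 1 + cost e"
| "cost (Add e1 e2) = 1 + cost e1 + cost e2"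
| "cost (Sub e1 e2) = 1 + cost e1 + cost e2"

text \<open>\<open>Store a e1 e2\<close> writes the value of \<open>e2\<close> to cell \<open>e1\<close> of array \<open>a\<close>; a condition is
  true iff its value is nonzero.\<close>

datatype prog = Skip | Store nat expr expr | Seq prog prog | If expr prog prog | While expr prog

text \<open>\<open>exec p s t s'\<close>: started in \<open>s\<close>, the program \<open>p\<close> halts in \<open>s'\<close> after \<open>t\<close> steps.\<close>

inductive exec :: "prog \<Rightarrow> state \<Rightarrow> nat \<Rightarrow> state \<Rightarrow> bool" where
  Skip: "exec Skip s 1 s"
| Store: "exec (Store a e1 e2) s (1 + cost e1 + cost e2) (s(a := (s a)(val e1 s := val e2 s)))"
| Seq: "exec p s t s' \<Longrightarrow> exec q s' t' s'' \<Longrightarrow> exec (Seq p q) s (t + t') s''"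
| If_true: "val e s \<noteq> 0 \<Longrightarrow> exec p s t s' \<Longrightarrow> exec (If e p q) s (1 + cost e + t) s'"
| If_false: "val e s = 0 \<Longrightarrow> exec q s t s' \<Longrightarrow> exec (If e p q) s (1 + cost e + t) s'"
| While_false: "val e s = 0 \<Longrightarrow> exec (While e p) s (1 + cost e) s"
| While_true: "val e s \<noteq> 0 \<Longrightarrow> exec p s t s' \<Longrightarrow> exec (While e p) s' t' s'' \<Longrightarrow>
    exec (While e p) s (1 + cost e + t + t') s''"

inductive_cases exec_SkipE: "exec Skip s t s'"
inductive_cases exec_StoreE: "exec (Store a e1 e2) s t s'"
inductive_cases exec_SeqE: "exec (Seq p q) s t s'"
inductive_cases exec_IfE: "exec (If e p q) s t s'"
inductive_cases exec_WhileE: "exec (While e p) s t s'"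

lemma exec_deterministic:
  "exec p s t s' \<Longrightarrow> exec p s u s'' \<Longrightarrow> u = t \<and> s'' = s'"
proof (induction arbitrary: u s'' rule: exec.induct)
  case Skip
  then show ?case by (rule exec_SkipE) simp
next
  case Store
  then show ?case by (rule exec_StoreE) simp
next
  case Seq
  from Seq.prems show ?case by (rule exec_SeqE) (metis Seq.IH)
next
  case If_true
  from If_true.prems show ?case by (rule exec_IfE) (use If_true.hyps(1) If_true.IH in auto)
next
  case If_false
  from If_false.prems show ?case by (rule exec_IfE) (use If_false.hyps(1) If_false.IH in auto)
next
  case While_false
  from While_false.prems show ?case by (rule exec_WhileE) (use While_false.hyps in auto)
next
  case While_true
  from While_true.prems show ?case
  proof (rule exec_WhileE, goal_cases)
    case 1
    then show ?case using While_true.hyps(1) by simp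
  next
    case 2
    then show ?case using While_true.IH by auto
  qed
qed


section \<open>Parameterized problems on graphs\<close>

text \<open>An instance is a graph on the vertices \<open>0, \<dots>, n - 1\<close> together with the parameter.\<close>

type_synonym inst = "nat graph \<times> nat"

definition instances :: "(nat graph \<Rightarrow> bool) \<Rightarrow> inst set" where
  "instances C =
     {(G, k). fin_graph G \<and> verts G = {..<card (verts G)} \<and> C G \<and> k > 0}"

text \<open>Number of entries of the adjacency matrix, plus the parameter.\<close>

definition inst_size :: "inst \<Rightarrow> nat" where
  "inst_size = (\<lambda>(G, k). card (verts G) * card (verts G) + k)"

text \<open>Array \<open>0\<close> holds \<open>n\<close> and \<open>k\<close>, array \<open>1\<close> the adjacency matrix row by row.\<close>

definition represents :: "state \<Rightarrow> inst \<Rightarrow> bool" where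
  "represents s = (\<lambda>(G, k). let n = card (verts G) in
     s 0 0 = n \<and> s 0 1 = k \<and>
     (\<forall>i<n. \<forall>j<n. s 1 (i * n + j) = (if {i, j} \<in> edges G then 1 else 0)))"

text \<open>The input state: apart from the representation of the instance, all cells are \<open>0\<close>.\<close>

definition input_state :: "inst \<Rightarrow> state" where
  "input_state = (\<lambda>(G, k) a i. let n = card (verts G) in
     if a = 0 \<and> i = 0 then n
     else if a = 0 \<and> i = 1 then k
     else if a = 1 \<and> i < n * n \<and> {i div n, i mod n} \<in> edges G then 1
     else 0)"

text \<open>A problem is given by its set of admissible instances \<open>I\<close> and the set \<open>Y\<close> of
  yes-instances. A kernelization runs in time polynomial in the instance size and outputs an
  equivalent admissible instance of size bounded by a function of the parameter.\<close>

definition has_kernel :: "inst set \<Rightarrow> inst set \<Rightarrow> (nat \<Rightarrow> nat) \<Rightarrow> bool" where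
  "has_kernel I Y g \<longleftrightarrow>
     (\<exists>p A B. \<forall>x\<in>I. \<exists>t s. exec p (input_state x) t s \<and> t \<le> A * inst_size x ^ B \<and>
        (\<exists>y\<in>I. represents s y \<and> (y \<in> Y \<longleftrightarrow> x \<in> Y) \<and> inst_size y \<le> g (snd x)))"

text \<open>Decision algorithms return their answer in cell \<open>0\<close> of array \<open>0\<close>; the time bound is a
  function of the number of vertices and the parameter.\<close>

definition has_algorithm :: "inst set \<Rightarrow> inst set \<Rightarrow> (nat \<Rightarrow> nat \<Rightarrow> nat) \<Rightarrow> bool" where
  "has_algorithm I Y T \<longleftrightarrow>
     (\<exists>p. \<forall>x\<in>I. \<exists>t s. exec p (input_state x) t s \<and> t \<le> T (card (verts (fst x))) (snd x) \<and>
        s 0 0 = (if x \<in> Y then 1 else 0))"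

definition vertex_partization :: "nat \<Rightarrow> nat \<Rightarrow> inst set" where
  "vertex_partization r l =
     {(G, k). \<exists>S\<subseteq>verts G. card S \<le> k \<and> rl_graph r l (delete G S)}"

lemma represents_input_state:
  assumes "x \<in> instances C"
  shows "represents (input_state x) x"
proof -
  have *: "i * n + j < n * n" if "i < n" "j < n" for i j n :: nat
  proof -
    have "i * n + j < Suc i * n" using that by simp
    also have "\<dots> \<le> n * n" using that by (intro mult_right_mono) auto
    finally show ?thesis .
  qed
  show ?thesis
    using * by (auto simp: represents_def input_state_def Let_def split: prod.splits)
qed

end

theory Submission
  imports Defs
begin

text \<open>In a perfect graph \<open>(r, l)\<close>-graphs and \<open>(r, l)\<close>-split graphs coincide, because both
  the graph and, by Lovasz's weak perfect graph theorem, its complement can be coloured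
  optimally. Hence the problem asks for a set of at most \<open>k\<close> vertices that hits every bad
  \<open>d\<close>-tuple, that is, every \<open>d\<close>-tuple of vertices that does not induce an
  \<open>(r, l)\<close>-split graph. The algorithm branches on the \<open>d\<close> entries of the first bad tuple
  that is not yet hit. The kernel keeps a bad tuple only if no partial tuple contained in it
  is already extended by so many kept tuples that every small hitting set must meet the
  partial tuple itself; the subgraph induced by the kept tuples is the result.\<close>

section \<open>Perfect graphs\<close>

text \<open>Badness of a tuple depends only on which of its entries coincide and which are adjacent.
  These are boundedly many bits for fixed \<open>d\<close>, so a program built for given
  \<open>r\<close>, \<open>l\<close> and \<open>d\<close> decides badness by a finite decision tree
  at constant cost. The machine has neither multiplication nor recursion. Row offsets are therefore
  kept by repeated addition, and the branching tree is walked by a counter with \<open>k\<close>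
  digits in base \<open>d\<close>: each value is a path from the root, replayed from scratch. For
  \<open>k \<ge> n\<close> the answer is yes at once, so that a replay costs a power of
  \<open>n\<close>, and \<open>d ^ k\<close> enters only as the number of replays. In the kernel, a
  partial tuple with \<open>m\<close> free positions has the limit \<open>(d * k + 1) ^ m\<close>.
  It comes from a recurrence: a set of at most \<open>k\<close> vertices gives at most
  \<open>d * k\<close> ways to fix one more position, so the limit must grow by more than the factor
  \<open>d * k\<close> per free position. The kernel may contain bad tuples that were not kept; they
  are bad in the input too, so the two instances stay equivalent.\<close>

lemma card_clique_inter_indep_le_1:
  assumes "clique K E" "indep S E"
  shows "card (K \<inter> S) \<le> 1"
proof (rule ccontr)
  assume "\<not> card (K \<inter> S) \<le> 1"
  then obtain u v where "u \<in> K \<inter> S" "v \<in> K \<inter> S" "u \<noteq> v"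
    by (metis One_nat_def card.empty card.infinite card_le_Suc0_iff_eq le_zero_eq nat_le_linear not_less_eq_eq)
  with assms show False by (auto simp: clique_def indep_def)
qed

lemma fin_graph_induced: "fin_graph G \<Longrightarrow> fin_graph (induced G X)"
  by (auto simp: fin_graph_def induced_def nsets_def)

lemma fin_graph_loopfree: "fin_graph G \<Longrightarrow> {v} \<notin> edges G"
  by (auto simp: fin_graph_def nsets_def)

lemma induced_induced: "induced (induced G X) Y = induced G (X \<inter> Y)"
  by (auto simp: induced_def)

lemma verts_induced: "verts (induced G X) = verts G \<inter> X"
  by (simp add: induced_def)

lemma perfect_induced: "perfect G \<Longrightarrow> perfect (induced G X)"
  unfolding perfect_def by (simp add: induced_induced verts_induced Int_absorb1)

lemma clique_induced: "K \<subseteq> X \<Longrightarrow> clique K (edges (induced G X)) \<longleftrightarrow> clique K (edges G)"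
  by (auto simp: clique_def induced_def)

lemma indep_induced: "K \<subseteq> X \<Longrightarrow> indep K (edges (induced G X)) \<longleftrightarrow> indep K (edges G)"
  by (auto simp: indep_def induced_def)

lemma clique_number_le_iff:
  assumes "finite (verts G)"
  shows "clique_number G \<le> m \<longleftrightarrow> (\<forall>K\<subseteq>verts G. clique K (edges G) \<longrightarrow> card K \<le> m)"
proof -
  have "finite {K. K \<subseteq> verts G \<and> clique K (edges G)}" using assms by simp
  moreover have "{} \<in> {K. K \<subseteq> verts G \<and> clique K (edges G)}" by (simp add: clique_def)
  ultimately show ?thesis unfolding clique_number_def
    by (subst Max_le_iff) auto
qed

lemma independence_number_le_iff:
  assumes "finite (verts G)"
  shows "independence_number G \<le> m \<longleftrightarrow> (\<forall>K\<subseteq>verts G. indep K (edges G) \<longrightarrow> card K \<le> m)"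
proof -
  have "finite {K. K \<subseteq> verts G \<and> indep K (edges G)}" using assms by simp
  moreover have "{} \<in> {K. K \<subseteq> verts G \<and> indep K (edges G)}" by (simp add: indep_def)
  ultimately show ?thesis unfolding independence_number_def
    by (subst Max_le_iff) auto
qed

text \<open>Later arguments about splits work with this form: bounds on all cliques and independent
  sets spare reasoning about \<open>Max\<close>.\<close>

lemma rl_split_iff:
  assumes "finite (verts G)"
  shows "rl_split r l G \<longleftrightarrow> (\<exists>V1\<subseteq>verts G.
     (\<forall>K\<subseteq>V1. clique K (edges G) \<longrightarrow> card K \<le> r) \<and>
     (\<forall>K\<subseteq>verts G - V1. indep K (edges G) \<longrightarrow> card K \<le> l))"
proof -
  have cl: "clique_number (induced G V) \<le> r \<longleftrightarrow> (\<forall>K\<subseteq>V. clique K (edges G) \<longrightarrow> card K \<le> r)"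
    if "V \<subseteq> verts G" for V
    using that assms by (subst clique_number_le_iff) (auto simp: verts_induced clique_induced)
  have ind: "independence_number (induced G V) \<le> l \<longleftrightarrow> (\<forall>K\<subseteq>V. indep K (edges G) \<longrightarrow> card K \<le> l)"
    if "V \<subseteq> verts G" for V
    using that assms by (subst independence_number_le_iff) (auto simp: verts_induced indep_induced)
  show ?thesis
  proof
    assume "rl_split r l G"
    then obtain V1 V2 where V: "V1 \<union> V2 = verts G" "V1 \<inter> V2 = {}"
      "clique_number (induced G V1) \<le> r" "independence_number (induced G V2) \<le> l"
      unfolding rl_split_def by blast
    have V2: "V2 = verts G - V1" "V1 \<subseteq> verts G" "V2 \<subseteq> verts G" using V by auto
    show "\<exists>V1\<subseteq>verts G. (\<forall>K\<subseteq>V1. clique K (edges G) \<longrightarrow> card K \<le> r) \<and>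
     (\<forall>K\<subseteq>verts G - V1. indep K (edges G) \<longrightarrow> card K \<le> l)"
      using V(3,4) cl[OF V2(2)] ind[OF V2(3)] V2 by (intro exI[of _ V1]) simp
  next
    assume "\<exists>V1\<subseteq>verts G. (\<forall>K\<subseteq>V1. clique K (edges G) \<longrightarrow> card K \<le> r) \<and>
     (\<forall>K\<subseteq>verts G - V1. indep K (edges G) \<longrightarrow> card K \<le> l)"
    then obtain V1 where V1: "V1 \<subseteq> verts G" "\<forall>K\<subseteq>V1. clique K (edges G) \<longrightarrow> card K \<le> r"
      "\<forall>K\<subseteq>verts G - V1. indep K (edges G) \<longrightarrow> card K \<le> l" by auto
    have "V1 \<union> (verts G - V1) = verts G" "V1 \<inter> (verts G - V1) = {}" using V1(1) by auto
    moreover have "clique_number (induced G V1) \<le> r" using V1(2) cl[OF V1(1)] by simp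
    moreover have "independence_number (induced G (verts G - V1)) \<le> l"
      using V1(3) ind[OF Diff_subset] by simp
    ultimately show "rl_split r l G" unfolding rl_split_def by metis
  qed
qed

section \<open>Colourings of perfect graphs\<close>

text \<open>An injective colouring shows that \<open>LEAST\<close> ranges over a nonempty set; it is
  proper because an edge has two distinct ends.\<close>

lemma colorable_chromatic_number:
  assumes "finite (verts G)" "edges G \<subseteq> nsets (verts G) 2"
  shows "colorable G (chromatic_number G)"
proof -
  obtain col :: "_ \<Rightarrow> nat" and n where "col ` verts G = {i. i < n}" "inj_on col (verts G)"
    using finite_imp_inj_to_nat_seg[OF assms(1)] by metis
  then have "colorable G n" unfolding colorable_def
    using assms(2) by (intro exI[of _ col]) (fastforce simp: inj_on_def nsets_def)
  then show ?thesis unfolding chromatic_number_def by (rule LeastI)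
qed

lemma colorable_mono: "colorable G p \<Longrightarrow> p \<le> q \<Longrightarrow> colorable G q"
  unfolding colorable_def
proof (elim exE conjE, intro exI conjI)
  fix col :: "'a \<Rightarrow> nat"
  assume "\<forall>v\<in>verts G. col v < p" "p \<le> q"
  then show "\<forall>v\<in>verts G. col v < q" by fastforce
qed assumption

text \<open>Stated for any bound \<open>m\<close> on the cliques inside \<open>X\<close>, so that a
  given budget of colours can be inserted without knowing the clique number.\<close>

lemma perfect_colorable:
  assumes "fin_graph G" "perfect G" "X \<subseteq> verts G"
    and "\<And>K. K \<subseteq> X \<Longrightarrow> clique K (edges G) \<Longrightarrow> card K \<le> m"
  obtains col :: "'a \<Rightarrow> nat" where "\<And>v. v \<in> X \<Longrightarrow> col v < m"
    "\<And>u v. u \<in> X \<Longrightarrow> v \<in> X \<Longrightarrow> {u, v} \<in> edges G \<Longrightarrow> col u \<noteq> col v"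
proof -
  have fin: "fin_graph (induced G X)" using assms(1) by (rule fin_graph_induced)
  have "clique_number (induced G X) \<le> m"
    using fin assms(3,4)
    by (subst clique_number_le_iff) (auto simp: fin_graph_def verts_induced clique_induced Int_absorb1)
  moreover have "chromatic_number (induced G X) = clique_number (induced G X)"
    using assms(2,3) by (simp add: perfect_def)
  moreover have "colorable (induced G X) (chromatic_number (induced G X))"
    using fin by (intro colorable_chromatic_number) (auto simp: fin_graph_def)
  ultimately have "colorable (induced G X) m" by (metis colorable_mono)
  then obtain col :: "'a \<Rightarrow> nat" where "\<forall>v\<in>X. col v < m"
    "\<forall>u\<in>X. \<forall>v\<in>X. {u, v} \<in> edges G \<longrightarrow> col u \<noteq> col v"
    using assms(3) unfolding colorable_def by (auto simp: verts_induced induced_def Int_absorb1)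
  then show ?thesis using that by blast
qed

text \<open>Lovasz's replication lemma without constructing the replicated graph: \<open>w x\<close> plays the
  role of the number of copies of \<open>x\<close>. To raise the weight of \<open>x\<close> from \<open>w x - 1\<close>, a colour
  class \<open>A\<close> containing \<open>x\<close> is removed from all its vertices except \<open>x\<close>; this lowers the weight
  of every clique of weight \<open>m\<close>, and \<open>A\<close> is then added as a new colour class.\<close>

lemma perfect_weighted_colouring:
  fixes w :: "'a \<Rightarrow> nat"
  assumes "fin_graph G" "perfect G"
    and "\<forall>K\<subseteq>verts G. clique K (edges G) \<longrightarrow> (\<Sum>x\<in>K. w x) \<le> m"
  shows "\<exists>c :: 'a \<Rightarrow> nat set. (\<forall>x\<in>verts G. c x \<subseteq> {..<m} \<and> card (c x) = w x) \<and>
    (\<forall>u\<in>verts G. \<forall>v\<in>verts G. {u, v} \<in> edges G \<longrightarrow> c u \<inter> c v = {})"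
  using assms(3)
proof (induction "\<Sum>x\<in>verts G. w x" arbitrary: w m rule: less_induct)
  case less
  have fin: "finite (verts G)" using assms(1) by (simp add: fin_graph_def)
  show ?case
  proof (cases "\<exists>x\<in>verts G. w x \<ge> 2")
    case False
    define X where "X = {x \<in> verts G. w x = 1}"
    have "card K \<le> m" if "K \<subseteq> X" "clique K (edges G)" for K
    proof -
      have "(\<Sum>x\<in>K. w x) = card K" using that(1) by (subst card_eq_sum) (rule sum.cong, auto simp: X_def)
      then show ?thesis using less.prems[rule_format, of K] that by (auto simp: X_def)
    qed
    then obtain col :: "'a \<Rightarrow> nat" where col: "\<And>v. v \<in> X \<Longrightarrow> col v < m"
      "\<And>u v. u \<in> X \<Longrightarrow> v \<in> X \<Longrightarrow> {u, v} \<in> edges G \<Longrightarrow> col u \<noteq> col v"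
      using perfect_colorable[OF assms(1,2), of X m] by (auto simp: X_def)
    have "w x = 0" if "x \<in> verts G" "x \<notin> X" for x
    proof -
      have "\<not> 2 \<le> w x" "w x \<noteq> 1" using False that by (auto simp: X_def)
      then show ?thesis by linarith
    qed
    then show ?thesis
      using col by (intro exI[of _ "\<lambda>x. if x \<in> X then {col x} else {}"]) (auto simp: X_def)
  next
    case True
    then obtain x where x: "x \<in> verts G" "w x \<ge> 2" by blast
    define w' where "w' = w(x := w x - 1)"
    have w'le: "w' y \<le> w y" for y by (simp add: w'_def)
    have less': "(\<Sum>x\<in>verts G. w' x) < (\<Sum>x\<in>verts G. w x)"
      using fin x by (intro sum_strict_mono_ex1) (auto simp: w'_def)
    have "(\<Sum>x\<in>K. w' x) \<le> m" if "K \<subseteq> verts G" "clique K (edges G)" for K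
      using less.prems[rule_format, OF that] sum_mono[of K w' w] w'le by (meson le_trans)
    then have "\<forall>K\<subseteq>verts G. clique K (edges G) \<longrightarrow> (\<Sum>x\<in>K. w' x) \<le> m" by blast
    from less.hyps[OF less' this] obtain c :: "'a \<Rightarrow> nat set" where
      "\<forall>y\<in>verts G. c y \<subseteq> {..<m} \<and> card (c y) = w' y"
      "\<forall>u\<in>verts G. \<forall>v\<in>verts G. {u, v} \<in> edges G \<longrightarrow> c u \<inter> c v = {}"
      by (elim exE conjE) (rule that)
    note c = this[rule_format]
    \<comment> \<open>\<open>w x \<ge> 2\<close> leaves \<open>x\<close> at least one colour under
      \<open>w'\<close>; this is why the weights \<open>0\<close> and \<open>1\<close> form the base
      case.\<close>
    have "card (c x) > 0" using c(1)[OF x(1)] x(2) by (simp add: w'_def)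
    then obtain a where a: "a \<in> c x" by fastforce
    define A where "A = {y \<in> verts G. a \<in> c y}"
    have xA: "x \<in> A" using x a by (simp add: A_def)
    define w'' where "w'' = (\<lambda>y. if y \<in> A \<and> y \<noteq> x then w' y - 1 else w' y)"
    have w''le: "w'' y \<le> w' y" for y by (simp add: w''_def)
    have posA: "w' y > 0" if "y \<in> A" for y
    proof -
      have "finite (c y)" "a \<in> c y" using that c(1)[of y] finite_subset by (auto simp: A_def)
      then have "card (c y) > 0" by (auto simp: card_gt_0_iff)
      then show ?thesis using c(1)[of y] that by (simp add: A_def)
    qed
    have m: "m > 0" using c(1)[OF x(1)] a by auto
    \<comment> \<open>The induction hypothesis is used a second time, now for \<open>w''\<close>
      with one colour fewer.\<close>
    have less'': "(\<Sum>x\<in>verts G. w'' x) < (\<Sum>x\<in>verts G. w x)"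
      using less' sum_mono[of "verts G" w'' w'] w''le by (meson le_less_trans)
    have "(\<Sum>x\<in>K. w'' x) \<le> m - 1" if K: "K \<subseteq> verts G" "clique K (edges G)" for K
    proof -
      have finK: "finite K" using K(1) fin finite_subset by blast
      have le: "(\<Sum>x\<in>K. w' x) \<le> m"
        using less.prems[rule_format, OF K] sum_mono[of K w' w] w'le by (meson le_trans)
      show ?thesis
      proof (cases "(\<Sum>x\<in>K. w' x) = m")
        case False
        then show ?thesis using le sum_mono[of K w'' w'] w''le
          by (metis Suc_pred' leD le_trans less_Suc_eq_le linorder_not_le m order_le_imp_less_or_eq)
      next
        case True
        \<comment> \<open>A clique through \<open>x\<close> lost one unit when \<open>w x\<close>
          was lowered, so it cannot weigh \<open>m\<close> under \<open>w'\<close>.\<close>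
        have "x \<notin> K"
        proof
          assume "x \<in> K"
          then have "(\<Sum>x\<in>K. w' x) < (\<Sum>x\<in>K. w x)"
            using finK x by (intro sum_strict_mono_ex1) (auto simp: w'_def)
          then show False using True less.prems[rule_format, OF K] by simp
        qed
        \<comment> \<open>A clique of weight \<open>m\<close> uses all \<open>m\<close> colours,
          among them \<open>a\<close>. So it contains a vertex of \<open>A\<close> other than
          \<open>x\<close>, and the weight of that vertex drops.\<close>
        have "card (\<Union>y\<in>K. c y) = (\<Sum>y\<in>K. card (c y))"
        proof (rule card_UN_disjoint)
          show "\<forall>y\<in>K. finite (c y)" using c(1) K(1) finite_subset by blast
          show "\<forall>i\<in>K. \<forall>j\<in>K. i \<noteq> j \<longrightarrow> c i \<inter> c j = {}"
            using K c(2) by (auto simp: clique_def) blast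
        qed (rule finK)
        also have "\<dots> = m" using True c(1) K(1) by (metis (no_types, lifting) subsetD sum.cong)
        finally have "card (\<Union>y\<in>K. c y) = card {..<m}" by simp
        moreover have "(\<Union>y\<in>K. c y) \<subseteq> {..<m}" using c(1) K(1) by blast
        ultimately have "(\<Union>y\<in>K. c y) = {..<m}" by (meson card_subset_eq finite_lessThan)
        moreover have "a < m" using c(1)[OF x(1)] a by auto
        ultimately obtain y where y: "y \<in> K" "a \<in> c y" by blast
        have yA: "y \<in> A" "y \<noteq> x" using y K \<open>x \<notin> K\<close> by (auto simp: A_def)
        have "w'' y < w' y" using posA[OF yA(1)] yA by (auto simp: w''_def)
        then have "(\<Sum>x\<in>K. w'' x) < (\<Sum>x\<in>K. w' x)"
          using finK y w''le by (intro sum_strict_mono_ex1) auto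
        then show ?thesis using True by linarith
      qed
    qed
    then have "\<forall>K\<subseteq>verts G. clique K (edges G) \<longrightarrow> (\<Sum>x\<in>K. w'' x) \<le> m - 1" by blast
    from less.hyps[OF less'' this] obtain c' :: "'a \<Rightarrow> nat set" where
      "\<forall>y\<in>verts G. c' y \<subseteq> {..<m - 1} \<and> card (c' y) = w'' y"
      "\<forall>u\<in>verts G. \<forall>v\<in>verts G. {u, v} \<in> edges G \<longrightarrow> c' u \<inter> c' v = {}"
      by (elim exE conjE) (rule that)
    note c' = this[rule_format]
    \<comment> \<open>The colour \<open>m - 1\<close> is free under \<open>c'\<close>. Giving it to
      all of \<open>A\<close> restores the weight of the vertices other than \<open>x\<close> and
      raises that of \<open>x\<close> from \<open>w x - 1\<close> to \<open>w x\<close>.\<close>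
    define e where "e = (\<lambda>y. if y \<in> A then insert (m - 1) (c' y) else c' y)"
    have "e y \<subseteq> {..<m} \<and> card (e y) = w y" if "y \<in> verts G" for y
    proof -
      have fc: "finite (c' y)" "m - 1 \<notin> c' y" using c'(1)[OF that] finite_subset by auto
      have "c' y \<subseteq> {..<m}" using c'(1)[OF that] by force
      moreover have "card (e y) = w y"
        using fc c'(1)[OF that] posA[of y] x xA unfolding e_def by (auto simp: w''_def w'_def)
      ultimately show ?thesis using m by (auto simp: e_def)
    qed
    moreover have "e u \<inter> e v = {}" if uv: "u \<in> verts G" "v \<in> verts G" "{u, v} \<in> edges G" for u v
    proof -
      have "\<not> (u \<in> A \<and> v \<in> A)" using c(2)[OF uv] by (auto simp: A_def)
      moreover have "m - 1 \<notin> c' u" "m - 1 \<notin> c' v" using c'(1) uv by auto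
      ultimately show ?thesis using c'(2)[OF uv] by (auto simp: e_def)
    qed
    ultimately show ?thesis by blast
  qed
qed

section \<open>Covering a perfect graph by cliques\<close>

lemma card_filter_eq_sum:
  "finite A \<Longrightarrow> card {x \<in> A. P x} = (\<Sum>x\<in>A. if P x then 1 else (0::nat))"
  by (simp only: card_eq_sum) (rule sum.inter_filter)

text \<open>Otherwise every clique \<open>K\<close> misses a maximum independent set \<open>S K\<close>. Weighting a vertex by the
  number of sets \<open>S K\<close> that contain it gives total weight \<open>l\<close> times the number of cliques, while
  every clique weighs less than the number of cliques.\<close>

lemma perfect_clique_meets_indep_sets:
  assumes G: "fin_graph G" "perfect G" and l: "l > 0"
    and ind: "\<And>S. S \<subseteq> verts G \<Longrightarrow> indep S (edges G) \<Longrightarrow> card S \<le> l"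
  shows "\<exists>K\<subseteq>verts G. clique K (edges G) \<and>
    (\<forall>S\<subseteq>verts G. indep S (edges G) \<longrightarrow> card S = l \<longrightarrow> K \<inter> S \<noteq> {})"
proof (rule ccontr)
  assume "\<not> ?thesis"
  then have "\<forall>K. \<exists>S. K \<subseteq> verts G \<and> clique K (edges G) \<longrightarrow>
      S \<subseteq> verts G \<and> indep S (edges G) \<and> card S = l \<and> K \<inter> S = {}"
    by blast
  then obtain S where S: "\<And>K. K \<subseteq> verts G \<Longrightarrow> clique K (edges G) \<Longrightarrow>
      S K \<subseteq> verts G \<and> indep (S K) (edges G) \<and> card (S K) = l \<and> K \<inter> S K = {}"
    by metis
  have fin: "finite (verts G)" using G(1) by (simp add: fin_graph_def)
  define C where "C = {K. K \<subseteq> verts G \<and> clique K (edges G)}"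
  have finC: "finite C" using fin by (simp add: C_def)
  \<comment> \<open>The empty clique makes \<open>card C\<close> positive; the final contradiction
    compares \<open>card C\<close> with \<open>card C - 1\<close>.\<close>
  have C: "{} \<in> C" by (simp add: C_def clique_def)
  define w where "w x = card {K \<in> C. x \<in> S K}" for x
  have sum_w: "(\<Sum>x\<in>Q. w x) = (\<Sum>K\<in>C. card (Q \<inter> S K))" if "Q \<subseteq> verts G" for Q
  proof -
    have finQ: "finite Q" using that fin finite_subset by blast
    have "(\<Sum>x\<in>Q. w x) = (\<Sum>x\<in>Q. \<Sum>K\<in>C. if x \<in> S K then 1 else 0)"
      unfolding w_def using finC by (simp only: card_filter_eq_sum)
    also have "\<dots> = (\<Sum>K\<in>C. \<Sum>x\<in>Q. if x \<in> S K then 1 else 0)" by (rule sum.swap)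
    also have "\<dots> = (\<Sum>K\<in>C. card (Q \<inter> S K))"
      unfolding Int_def using finQ by (simp only: card_filter_eq_sum)
    finally show ?thesis .
  qed
  have "(\<Sum>x\<in>Q. w x) \<le> card C - 1" if Q: "Q \<subseteq> verts G" "clique Q (edges G)" for Q
  proof -
    have QC: "Q \<in> C" using Q by (simp add: C_def)
    \<comment> \<open>\<open>Q\<close> misses its own set \<open>S Q\<close> and meets each of the
      others at most once.\<close>
    have "(\<Sum>K\<in>C. card (Q \<inter> S K)) = (\<Sum>K\<in>C - {Q}. card (Q \<inter> S K))"
      using S[OF Q] finC QC by (subst sum.remove[of C Q]) auto
    also have "\<dots> \<le> (\<Sum>K\<in>C - {Q}. 1)"
      using S Q by (intro sum_mono card_clique_inter_indep_le_1[where E = "edges G"]) (auto simp: C_def)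
    also have "\<dots> = card C - 1" using QC finC by simp
    finally show ?thesis using sum_w[OF Q(1)] by simp
  qed
  then have "\<forall>Q\<subseteq>verts G. clique Q (edges G) \<longrightarrow> (\<Sum>x\<in>Q. w x) \<le> card C - 1" by blast
  from perfect_weighted_colouring[OF G this] obtain c :: "_ \<Rightarrow> nat set" where
    "\<forall>x\<in>verts G. c x \<subseteq> {..<card C - 1} \<and> card (c x) = w x"
    "\<forall>u\<in>verts G. \<forall>v\<in>verts G. {u, v} \<in> edges G \<longrightarrow> c u \<inter> c v = {}"
    by (elim exE conjE) (rule that)
  note c = this[rule_format]
  have "card C * l = (\<Sum>K\<in>C. card (verts G \<inter> S K))"
    using S by (simp add: C_def Int_absorb1)
  also have "\<dots> = (\<Sum>x\<in>verts G. card (c x))" using sum_w[of "verts G"] c(1) by simp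
  also have "\<dots> = (\<Sum>x\<in>verts G. \<Sum>a<card C - 1. if a \<in> c x then 1 else 0)"
  proof (rule sum.cong)
    fix x assume "x \<in> verts G"
    then have "c x = {a \<in> {..<card C - 1}. a \<in> c x}" using c(1) by blast
    then show "card (c x) = (\<Sum>a<card C - 1. if a \<in> c x then 1 else 0)"
      using card_filter_eq_sum[of "{..<card C - 1}" "\<lambda>a. a \<in> c x"] by simp
  qed simp
  also have "\<dots> = (\<Sum>a<card C - 1. \<Sum>x\<in>verts G. if a \<in> c x then 1 else 0)" by (rule sum.swap)
  also have "\<dots> = (\<Sum>a<card C - 1. card {x \<in> verts G. a \<in> c x})"
    using fin by (simp only: card_filter_eq_sum)
  \<comment> \<open>Vertices sharing the colour \<open>a\<close> are pairwise non-adjacent, so there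
    are at most \<open>l\<close> of them.\<close>
  also have "\<dots> \<le> (\<Sum>a<card C - 1. l)"
    using c(2) by (intro sum_mono ind) (auto simp: indep_def)
  also have "\<dots> = (card C - 1) * l" by simp
  finally have "card C * l \<le> (card C - 1) * l" .
  moreover have "card C > 0" using C finC by (auto simp: card_gt_0_iff)
  ultimately show False using l by simp
qed

text \<open>This is the weak perfect graph theorem in the form used here. Removing a clique that
  meets every independent set of the largest admissible size lowers the bound by one, and the rest
  is again perfect.\<close>

lemma perfect_clique_cover:
  assumes "fin_graph G" "perfect G"
    and "\<And>S. S \<subseteq> verts G \<Longrightarrow> indep S (edges G) \<Longrightarrow> card S \<le> l"
  shows "\<exists>Q. (\<Union>i<l. Q i) = verts G \<and> disjoint_family_on Q {..<l} \<and> (\<forall>i<l. clique (Q i) (edges G))"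
  using assms
proof (induction l arbitrary: G)
  \<comment> \<open>Singletons are independent, so the bound \<open>0\<close> leaves no
    vertex.\<close>
  case 0
  have "v \<notin> verts G" for v
    using "0.prems"(3)[of "{v}"] "0.prems"(1) by (auto simp: indep_def fin_graph_loopfree)
  then show ?case by (auto simp: disjoint_family_on_def)
next
  case (Suc l)
  obtain K where K: "K \<subseteq> verts G" "clique K (edges G)"
    "\<And>S. S \<subseteq> verts G \<Longrightarrow> indep S (edges G) \<Longrightarrow> card S = Suc l \<Longrightarrow> K \<inter> S \<noteq> {}"
    using perfect_clique_meets_indep_sets[OF Suc.prems(1,2), of "Suc l"] Suc.prems(3) by auto
  define H where "H = induced G (verts G - K)"
  have vH: "verts H = verts G - K" by (auto simp: H_def verts_induced)
  have "card S \<le> l" if "S \<subseteq> verts H" "indep S (edges H)" for S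
  proof -
    have "indep S (edges G)" using that vH unfolding H_def by (metis indep_induced)
    then show ?thesis using that(1) vH K(3)[of S] Suc.prems(3)[of S] by (metis Diff_disjoint
          Diff_subset disjoint_iff le_SucE subset_iff)
  qed
  with Suc.IH[of H] Suc.prems(1,2) obtain Q where
    Q: "(\<Union>i<l. Q i) = verts H" "disjoint_family_on Q {..<l}" "\<forall>i<l. clique (Q i) (edges H)"
    unfolding H_def by (auto simp: fin_graph_induced perfect_induced)
  have "clique (Q i) (edges G)" if "i < l" for i
  proof -
    have "Q i \<subseteq> verts G - K" using Q(1) vH that by blast
    then show ?thesis using Q(3) that unfolding H_def by (metis clique_induced)
  qed
  moreover have "Q i \<inter> K = {}" if "i < l" for i using Q(1) vH that by blast
  moreover have "(\<Union>i<Suc l. (Q(l := K)) i) = verts G"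
    using Q(1) vH K(1) by (auto simp: lessThan_Suc)
  moreover have "Q i \<inter> Q j = {}" if "i < l" "j < l" "i \<noteq> j" for i j
    using Q(2) that by (simp add: disjoint_family_on_def)
  then have "disjoint_family_on (Q(l := K)) {..<Suc l}"
    using \<open>\<And>i. i < l \<Longrightarrow> Q i \<inter> K = {}\<close>
    by (simp add: disjoint_family_on_def lessThan_Suc Int_commute)
  ultimately show ?case
    using K(2) by (intro exI[of _ "Q(l := K)"] conjI) (assumption | simp add: less_Suc_eq)+
qed

text \<open>From left to right, a clique meets each of the \<open>r\<close> independent parts at
  most once, and dually for the \<open>l\<close> cliques. From right to left, the colour classes of
  \<open>V1\<close> become the parts below \<open>r\<close> and the cliques covering the rest become
  the parts from \<open>r\<close> on.\<close>

lemma perfect_rl_graph_iff_rl_split: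
  assumes G: "fin_graph G" "perfect G"
  shows "rl_graph r l G \<longleftrightarrow> rl_split r l G"
proof
  have fin: "finite (verts G)" using G(1) by (simp add: fin_graph_def)
  assume "rl_graph r l G"
  then obtain P where P: "(\<Union>i<r + l. P i) = verts G" "disjoint_family_on P {..<r + l}"
    "\<forall>i<r. indep (P i) (edges G)" "\<forall>i\<in>{r..<r + l}. clique (P i) (edges G)"
    unfolding rl_graph_def by blast
  have "card K \<le> r" if "K \<subseteq> (\<Union>i<r. P i)" "clique K (edges G)" for K
  proof -
    have "card K = card (\<Union>i<r. K \<inter> P i)" using that(1) by (intro arg_cong[of _ _ card]) blast
    also have "\<dots> \<le> (\<Sum>i<r. card (K \<inter> P i))" by (rule card_UN_le) simp
    also have "\<dots> \<le> (\<Sum>i<r. 1)"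
      using that(2) P(3) by (intro sum_mono card_clique_inter_indep_le_1) auto
    finally show ?thesis by simp
  qed
  moreover have "card K \<le> l" if K: "K \<subseteq> verts G - (\<Union>i<r. P i)" "indep K (edges G)" for K
  proof -
    have "K \<subseteq> (\<Union>i\<in>{r..<r+l}. P i)"
    proof
      fix x assume "x \<in> K"
      then obtain i where "i < r + l" "x \<in> P i" "x \<notin> (\<Union>i<r. P i)" using K(1) P(1) by blast
      then show "x \<in> (\<Union>i\<in>{r..<r+l}. P i)" by (intro UN_I[of i]) (auto simp: not_less[symmetric])
    qed
    then have "card K = card (\<Union>i\<in>{r..<r+l}. P i \<inter> K)" by (intro arg_cong[of _ _ card]) blast
    also have "\<dots> \<le> (\<Sum>i\<in>{r..<r+l}. card (P i \<inter> K))" by (rule card_UN_le) simp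
    also have "\<dots> \<le> (\<Sum>i\<in>{r..<r+l}. 1)"
      using K(2) P(4) by (intro sum_mono card_clique_inter_indep_le_1) auto
    finally show ?thesis by simp
  qed
  moreover have "(\<Union>i<r. P i) \<subseteq> verts G" using P(1) by force
  ultimately show "rl_split r l G" unfolding rl_split_iff[OF fin] by blast
next
  have fin: "finite (verts G)" using G(1) by (simp add: fin_graph_def)
  assume "rl_split r l G"
  then obtain V1 where V1: "V1 \<subseteq> verts G" "\<forall>K\<subseteq>V1. clique K (edges G) \<longrightarrow> card K \<le> r"
    "\<forall>K\<subseteq>verts G - V1. indep K (edges G) \<longrightarrow> card K \<le> l"
    unfolding rl_split_iff[OF fin] by blast
  obtain col where col: "\<And>v. v \<in> V1 \<Longrightarrow> col v < r"
    "\<And>u v. u \<in> V1 \<Longrightarrow> v \<in> V1 \<Longrightarrow> {u, v} \<in> edges G \<Longrightarrow> col u \<noteq> col v"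
    using perfect_colorable[OF G V1(1), of r] V1(2) by blast
  define H where "H = induced G (verts G - V1)"
  have vH: "verts H = verts G - V1" by (auto simp: H_def verts_induced)
  have "card S \<le> l" if "S \<subseteq> verts H" "indep S (edges H)" for S
  proof -
    have "indep S (edges G)" using that vH unfolding H_def by (metis indep_induced)
    then show ?thesis using that(1) vH V1(3) by blast
  qed
  then obtain Q where
    Q: "(\<Union>i<l. Q i) = verts H" "disjoint_family_on Q {..<l}" "\<forall>i<l. clique (Q i) (edges H)"
    using perfect_clique_cover[of H l] G unfolding H_def
    by (auto simp: fin_graph_induced perfect_induced)
  have Qsub: "Q i \<subseteq> verts G - V1" if "i < l" for i using Q(1) vH that by blast
  have Qc: "clique (Q i) (edges G)" if "i < l" for i
    using Q(3) that Qsub[OF that] unfolding H_def by (metis clique_induced)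
  define P where "P i = (if i < r then {v \<in> V1. col v = i} else Q (i - r))" for i
  have "(\<Union>i<r + l. P i) = verts G"
  proof (intro equalityI subsetI)
    fix x assume "x \<in> (\<Union>i<r + l. P i)"
    then obtain i where "i < r + l" "x \<in> P i" by blast
    moreover from this have "i < r \<or> i - r < l" by linarith
    ultimately show "x \<in> verts G" using V1(1) Qsub[of "i - r"] by (auto simp: P_def split: if_splits)
  next
    fix x assume x: "x \<in> verts G"
    show "x \<in> (\<Union>i<r + l. P i)"
    proof (cases "x \<in> V1")
      case True
      then show ?thesis using col(1)[of x] by (intro UN_I[of "col x"]) (auto simp: P_def)
    next
      case False
      then obtain i where "i < l" "x \<in> Q i" using x Q(1) vH by blast
      then show ?thesis by (intro UN_I[of "r + i"]) (auto simp: P_def)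
    qed
  qed
  moreover have "disjoint_family_on P {..<r + l}"
    unfolding disjoint_family_on_def
  proof (intro ballI impI)
    fix i j assume ij: "i \<in> {..<r + l}" "j \<in> {..<r + l}" "i \<noteq> j"
    have V: "P m \<subseteq> V1" if "m < r" for m using that by (auto simp: P_def)
    have W: "P m \<inter> V1 = {}" if "m < r + l" "\<not> m < r" for m
    proof -
      have "m - r < l" using that by linarith
      then show ?thesis using Qsub[of "m - r"] that by (auto simp: P_def)
    qed
    consider "i < r" "j < r" | "i < r" "\<not> j < r" | "\<not> i < r" "j < r" | "\<not> i < r" "\<not> j < r"
      by blast
    then show "P i \<inter> P j = {}"
    proof cases
      case 1
      then show ?thesis using ij by (auto simp: P_def)
    next
      case 2
      then show ?thesis using V[of i] W[of j] ij by auto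
    next
      case 3
      then show ?thesis using V[of j] W[of i] ij by auto
    next
      case 4
      then have "i - r < l" "j - r < l" "i - r \<noteq> j - r" using ij by auto
      then have "Q (i - r) \<inter> Q (j - r) = {}"
        using Q(2) by (simp add: disjoint_family_on_def)
      then show ?thesis using 4 by (simp add: P_def)
    qed
  qed
  moreover have "\<forall>i<r. indep (P i) (edges G)" using col(2) by (simp add: indep_def P_def) metis
  moreover have "\<forall>i\<in>{r..<r + l}. clique (P i) (edges G)" using Qc by (auto simp: P_def)
  ultimately show "rl_graph r l G" unfolding rl_graph_def by blast
qed

section \<open>Bad tuples and isomorphism\<close>

lemma rl_split_induced:
  assumes "finite (verts G)" "rl_split r l G"
  shows "rl_split r l (induced G X)"
proof -
  obtain V1 where V1: "V1 \<subseteq> verts G" "\<forall>K\<subseteq>V1. clique K (edges G) \<longrightarrow> card K \<le> r"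
    "\<forall>K\<subseteq>verts G - V1. indep K (edges G) \<longrightarrow> card K \<le> l"
    using assms rl_split_iff[OF assms(1)] by metis
  have "card K \<le> r" if "K \<subseteq> V1 \<inter> X" "clique K (edges (induced G X))" for K
    using that V1(2) clique_induced[of K X G] by simp
  moreover have "card K \<le> l" if "K \<subseteq> verts G \<inter> X - V1 \<inter> X" "indep K (edges (induced G X))" for K
  proof -
    have "K \<subseteq> X" "K \<subseteq> verts G - V1" using that(1) by auto
    then show ?thesis using that(2) V1(3) indep_induced[of K X G] by simp
  qed
  moreover have "V1 \<inter> X \<subseteq> verts G \<inter> X" using V1(1) by auto
  moreover have fin: "finite (verts (induced G X))" using assms(1) by (simp add: verts_induced)
  ultimately show ?thesis
    unfolding rl_split_iff[OF fin] by (intro exI[of _ "V1 \<inter> X"]) (simp add: verts_induced)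
qed

text \<open>Take a vertex set that is minimal under inclusion among those inducing a non-split
  subgraph.\<close>

lemma rl_split_forbidden:
  assumes "fin_graph G" "\<not> rl_split r l G"
  obtains X where "X \<subseteq> verts G" "induced G X \<in> forbidden_set r l"
proof -
  define \<X> where "\<X> = {X. X \<subseteq> verts G \<and> \<not> rl_split r l (induced G X)}"
  have fin: "finite (verts G)" using assms(1) by (simp add: fin_graph_def)
  have "induced G (verts G) = G" using assms(1) by (auto simp: induced_def fin_graph_def nsets_def prod_eq_iff)
  then have "verts G \<in> \<X>" using assms(2) by (simp add: \<X>_def)
  moreover have "finite \<X>" using fin by (simp add: \<X>_def)
  ultimately obtain X where X: "X \<in> \<X>" "\<And>Y. Y \<in> \<X> \<Longrightarrow> Y \<subseteq> X \<Longrightarrow> X = Y"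
    using finite_has_minimal[of \<X>] by blast
  have XV: "X \<subseteq> verts G" using X(1) by (simp add: \<X>_def)
  have "rl_split r l (induced (induced G X) Y)" if "Y \<subset> X" for Y
  proof -
    have "X \<inter> Y = Y" using that by auto
    moreover have "Y \<notin> \<X>" using X(2)[of Y] that by auto
    ultimately show ?thesis using that XV by (auto simp: induced_induced \<X>_def)
  qed
  then have "induced G X \<in> forbidden_set r l"
    using X(1) XV assms(1) by (auto simp: forbidden_set_def \<X>_def fin_graph_induced verts_induced Int_absorb1)
  then show ?thesis using XV that by blast
qed

text \<open>The graph consists of \<open>l + 1\<close> disjoint cliques with \<open>r + 1\<close>
  vertices each, the vertex \<open>v\<close> lying in clique number \<open>v div Suc r\<close>.
  \<open>V1\<close> cannot contain a whole clique, and one vertex left out of each clique gives an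
  independent set of size \<open>l + 1\<close> outside \<open>V1\<close>.\<close>

lemma disjoint_cliques_not_rl_split:
  "\<exists>H :: nat graph. fin_graph H \<and> \<not> rl_split r l H"
proof -
  define V where "V = {..<Suc r * Suc l}"
  define E :: "nat set set" where
    "E = {{u, v} |u v. u \<in> V \<and> v \<in> V \<and> u \<noteq> v \<and> u div Suc r = v div Suc r}"
  have E: "{u, v} \<in> E \<longleftrightarrow> u \<in> V \<and> v \<in> V \<and> u \<noteq> v \<and> u div Suc r = v div Suc r" for u v
    unfolding E_def by (auto simp: doubleton_eq_iff)
  have fin: "fin_graph (V, E)" by (auto simp: fin_graph_def V_def E_def nsets_def card_insert_if)
  have "\<not> rl_split r l (V, E)"
  proof
    assume "rl_split r l (V, E)"
    then obtain V1 where V1: "V1 \<subseteq> V" "\<forall>K\<subseteq>V1. clique K E \<longrightarrow> card K \<le> r"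
      "\<forall>K\<subseteq>V - V1. indep K E \<longrightarrow> card K \<le> l"
      using rl_split_iff[of "(V, E)" r l] by (auto simp: V_def)
    have "\<exists>v. v \<in> V - V1 \<and> v div Suc r = i" if "i < Suc l" for i
    proof -
      define B where "B = {i * Suc r..<i * Suc r + Suc r}"
      have B: "v div Suc r = i" if "v \<in> B" for v
      proof (rule div_nat_eqI)
        show "Suc r * i \<le> v" "v < Suc r * Suc i" using that by (auto simp: B_def algebra_simps)
      qed
      have "B \<subseteq> V"
      proof
        fix v assume "v \<in> B"
        then have "v < Suc i * Suc r" by (simp add: B_def algebra_simps)
        also have "\<dots> \<le> Suc l * Suc r" using that by (intro mult_le_mono1) simp
        finally show "v \<in> V" by (simp add: V_def algebra_simps)
      qed
      have "clique B E" using \<open>B \<subseteq> V\<close> B by (auto simp: clique_def E)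
      moreover have "card B = Suc r" by (simp add: B_def)
      ultimately have "\<not> B \<subseteq> V1" using V1(2) by (metis Suc_n_not_le_n)
      then show ?thesis using \<open>B \<subseteq> V\<close> B by blast
    qed
    then obtain g where g: "\<And>i. i < Suc l \<Longrightarrow> g i \<in> V - V1 \<and> g i div Suc r = i" by metis
    have inj: "inj_on g {..<Suc l}" by (rule inj_onI) (metis g lessThan_iff)
    have "indep (g ` {..<Suc l}) E" using g by (auto simp: indep_def E)
    moreover have "g ` {..<Suc l} \<subseteq> V - V1" using g by blast
    ultimately have "card (g ` {..<Suc l}) \<le> l" using V1(3) by blast
    then show False using inj by (simp add: card_image)
  qed
  with fin show ?thesis by blast
qed

text \<open>Some forbidden graph exists by the preceding example, and it has a vertex because the
  empty graph is split. Positivity gives every tuple an entry to branch on and justifies estimates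
  such as \<open>d + 1 \<le> 2 * d\<close>.\<close>

lemma forbidden_set_bound_pos:
  assumes "\<And>H. H \<in> forbidden_set r l \<Longrightarrow> card (verts H) \<le> d"
  shows "d > 0"
proof -
  obtain H :: "nat graph" where H: "fin_graph H" "\<not> rl_split r l H"
    using disjoint_cliques_not_rl_split by blast
  then obtain X where X: "X \<subseteq> verts H" "induced H X \<in> forbidden_set r l"
    by (rule rl_split_forbidden)
  have "rl_split r l (induced H {})"
    by (subst rl_split_iff) (auto simp: verts_induced)
  then have "X \<noteq> {}" using X(2) by (auto simp: forbidden_set_def)
  moreover have "finite X" using X(1) H(1) finite_subset by (auto simp: fin_graph_def)
  ultimately have "card X > 0" by (simp add: card_gt_0_iff)
  then show ?thesis using assms[OF X(2)] X(1) by (simp add: verts_induced Int_absorb1)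
qed

section \<open>Bad tuples and hitting sets\<close>

text \<open>Entries may repeat, so that tuples of one fixed length also capture forbidden graphs
  with fewer vertices.\<close>

definition bad :: "nat \<Rightarrow> nat \<Rightarrow> nat graph \<Rightarrow> nat list \<Rightarrow> bool" where
  "bad r l G v \<longleftrightarrow> \<not> rl_split r l (induced G (set v))"

lemma rl_split_iff_no_bad_tuple:
  assumes G: "fin_graph G"
    and d: "\<And>H. H \<in> forbidden_set r l \<Longrightarrow> card (verts H) \<le> d"
  shows "rl_split r l G \<longleftrightarrow> (\<forall>v. length v = d \<and> set v \<subseteq> verts G \<longrightarrow> \<not> bad r l G v)"
proof
  assume "rl_split r l G"
  then show "\<forall>v. length v = d \<and> set v \<subseteq> verts G \<longrightarrow> \<not> bad r l G v"
    using rl_split_induced[of G] G by (simp add: bad_def fin_graph_def)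
next
  assume *: "\<forall>v. length v = d \<and> set v \<subseteq> verts G \<longrightarrow> \<not> bad r l G v"
  show "rl_split r l G"
  proof (rule ccontr)
    assume "\<not> rl_split r l G"
    then obtain X where X: "X \<subseteq> verts G" "induced G X \<in> forbidden_set r l"
      using rl_split_forbidden[OF G] by metis
    have finX: "finite X" using X(1) G finite_subset by (auto simp: fin_graph_def)
    have cX: "card X \<le> d" using d[OF X(2)] X(1) by (simp add: verts_induced Int_absorb1)
    have "rl_split r l (induced G {})"
      by (subst rl_split_iff) (auto simp: verts_induced)
    then have "X \<noteq> {}" using X(2) by (auto simp: forbidden_set_def)
    then obtain x where x: "x \<in> X" by blast
    obtain xs where xs: "set xs = X" "length xs = card X"
      using finX distinct_card finite_distinct_list by metis
    \<comment> \<open>Padding with copies of one vertex leaves the vertex set unchanged; it takes a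
      nonempty \<open>X\<close>.\<close>
    define v where "v = xs @ replicate (d - card X) x"
    have "length v = d" "set v = X" using xs cX x by (auto simp: v_def)
    then show False using * X by (auto simp: bad_def forbidden_set_def)
  qed
qed

text \<open>Deleting \<open>S\<close> leaves a perfect graph, whose bad tuples are those of
  \<open>G\<close> that avoid \<open>S\<close>.\<close>

lemma vertex_partization_iff_hitting_set:
  assumes G: "fin_graph G" "perfect G"
    and d: "\<And>H. H \<in> forbidden_set r l \<Longrightarrow> card (verts H) \<le> d"
  shows "(G, k) \<in> vertex_partization r l \<longleftrightarrow> (\<exists>S\<subseteq>verts G. card S \<le> k \<and>
    (\<forall>v. length v = d \<and> set v \<subseteq> verts G \<and> bad r l G v \<longrightarrow> set v \<inter> S \<noteq> {}))"
proof -
  have "rl_graph r l (delete G S) \<longleftrightarrow>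
    (\<forall>v. length v = d \<and> set v \<subseteq> verts G \<and> bad r l G v \<longrightarrow> set v \<inter> S \<noteq> {})" for S
  proof -
    have GS: "fin_graph (delete G S)" "perfect (delete G S)"
      using G by (simp_all add: delete_def fin_graph_induced perfect_induced)
    have "bad r l (delete G S) v \<longleftrightarrow> bad r l G v" if "set v \<subseteq> verts G - S" for v
      using that by (simp add: bad_def delete_def induced_induced Int_absorb1)
    moreover have "verts (delete G S) = verts G - S" by (auto simp: delete_def verts_induced)
    moreover have "set v \<subseteq> verts G - S \<longleftrightarrow> set v \<subseteq> verts G \<and> set v \<inter> S = {}" for v by auto
    ultimately show ?thesis
      using perfect_rl_graph_iff_rl_split[OF GS] rl_split_iff_no_bad_tuple[OF GS(1) d]
      by (metis (no_types, lifting))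
  qed
  then show ?thesis by (simp add: vertex_partization_def)
qed

section \<open>Invariance under isomorphism\<close>

definition is_iso :: "('a \<Rightarrow> 'b) \<Rightarrow> 'a graph \<Rightarrow> 'b graph \<Rightarrow> bool" where
  "is_iso h G H \<longleftrightarrow> bij_betw h (verts G) (verts H) \<and>
     (\<forall>u\<in>verts G. \<forall>v\<in>verts G. {h u, h v} \<in> edges H \<longleftrightarrow> {u, v} \<in> edges G)"

lemma iso_inv:
  assumes "is_iso h G H"
  shows "is_iso (the_inv_into (verts G) h) H G"
proof -
  let ?g = "the_inv_into (verts G) h"
  have b: "bij_betw h (verts G) (verts H)" using assms by (simp add: is_iso_def)
  have g: "bij_betw ?g (verts H) (verts G)" by (rule bij_betw_the_inv_into[OF b])
  have "h (?g x) = x" "?g x \<in> verts G" if "x \<in> verts H" for x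
    using f_the_inv_into_f_bij_betw[OF b] that bij_betwE[OF g] by auto
  then show ?thesis using g assms unfolding is_iso_def by metis
qed

lemma iso_clique:
  "is_iso h G H \<Longrightarrow> K \<subseteq> verts G \<Longrightarrow> clique K (edges G) \<longleftrightarrow> clique (h ` K) (edges H)"
  unfolding is_iso_def clique_def bij_betw_def inj_on_def subset_iff by (simp, metis)

lemma iso_indep:
  "is_iso h G H \<Longrightarrow> K \<subseteq> verts G \<Longrightarrow> indep K (edges G) \<longleftrightarrow> indep (h ` K) (edges H)"
  unfolding is_iso_def indep_def bij_betw_def inj_on_def subset_iff by (simp, metis)

lemma iso_induced:
  assumes "is_iso h G H" "X \<subseteq> verts G"
  shows "is_iso h (induced G X) (induced H (h ` X))"
proof -
  have inj: "inj_on h (verts G)" and im: "h ` verts G = verts H"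
    using assms(1) by (auto simp: is_iso_def bij_betw_def)
  have "bij_betw h (verts (induced G X)) (verts (induced H (h ` X)))"
    using inj im assms(2) by (auto simp: verts_induced bij_betw_def inj_on_def)
  moreover have "{h u, h v} \<in> edges (induced H (h ` X)) \<longleftrightarrow> {u, v} \<in> edges (induced G X)"
    if "u \<in> X" "v \<in> X" for u v
    using that assms by (auto simp: is_iso_def induced_def)
  ultimately show ?thesis using assms(2) by (auto simp: is_iso_def verts_induced)
qed

lemma iso_rl_split:
  assumes h: "is_iso h G H" and fin: "finite (verts G)" and split: "rl_split r l H"
  shows "rl_split r l G"
proof -
  have inj: "inj_on h (verts G)" and im: "h ` verts G = verts H"
    using h by (auto simp: is_iso_def bij_betw_def)
  have finH: "finite (verts H)" using fin im by (metis finite_imageI)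
  obtain V1 where V1: "V1 \<subseteq> verts H" "\<forall>K\<subseteq>V1. clique K (edges H) \<longrightarrow> card K \<le> r"
    "\<forall>K\<subseteq>verts H - V1. indep K (edges H) \<longrightarrow> card K \<le> l"
    using split rl_split_iff[OF finH] by metis
  define U where "U = {u \<in> verts G. h u \<in> V1}"
  have "card K \<le> r" if "K \<subseteq> U" "clique K (edges G)" for K
  proof -
    have K: "K \<subseteq> verts G" "h ` K \<subseteq> V1" using that(1) by (auto simp: U_def)
    then have "card (h ` K) \<le> r" using that(2) V1(2) iso_clique[OF h K(1)] by blast
    then show ?thesis using card_image[OF inj_on_subset[OF inj K(1)]] by simp
  qed
  moreover have "card K \<le> l" if "K \<subseteq> verts G - U" "indep K (edges G)" for K
  proof -
    have K: "K \<subseteq> verts G" "h ` K \<subseteq> verts H - V1" using that(1) im by (auto simp: U_def)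
    then have "card (h ` K) \<le> l" using that(2) V1(3) iso_indep[OF h K(1)] by blast
    then show ?thesis using card_image[OF inj_on_subset[OF inj K(1)]] by simp
  qed
  moreover have "U \<subseteq> verts G" by (simp add: U_def)
  ultimately show ?thesis using rl_split_iff[OF fin] by metis
qed

lemma iso_colorable:
  assumes h: "is_iso h G H" and "colorable H q"
  shows "colorable G q"
proof -
  have im: "h u \<in> verts H" if "u \<in> verts G" for u
    using h that by (auto simp: is_iso_def bij_betw_def)
  obtain col :: "_ \<Rightarrow> nat" where "\<forall>v\<in>verts H. col v < q"
    "\<forall>u\<in>verts H. \<forall>v\<in>verts H. {u, v} \<in> edges H \<longrightarrow> col u \<noteq> col v"
    using assms(2) by (auto simp: colorable_def)
  then show ?thesis
    unfolding colorable_def using h im by (intro exI[of _ "col \<circ> h"]) (simp add: is_iso_def)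
qed

lemma iso_chromatic_number: "is_iso h G H \<Longrightarrow> chromatic_number G = chromatic_number H"
  unfolding chromatic_number_def by (metis iso_colorable iso_inv)

lemma iso_clique_number:
  assumes h: "is_iso h G H"
  shows "clique_number G = clique_number H"
proof -
  have inj: "inj_on h (verts G)" and im: "h ` verts G = verts H"
    using h by (auto simp: is_iso_def bij_betw_def)
  have "card ` {K. K \<subseteq> verts H \<and> clique K (edges H)} = card ` {K. K \<subseteq> verts G \<and> clique K (edges G)}"
  proof (intro equalityI subsetI)
    fix m assume "m \<in> card ` {K. K \<subseteq> verts H \<and> clique K (edges H)}"
    then obtain K where K: "K \<subseteq> verts H" "clique K (edges H)" "m = card K" by auto
    obtain L where L: "L \<subseteq> verts G" "K = h ` L" using K(1) im by (metis subset_imageE)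
    then have "clique L (edges G)" "card L = m"
      using K iso_clique[OF h L(1)] card_image[OF inj_on_subset[OF inj L(1)]] by simp_all
    then show "m \<in> card ` {K. K \<subseteq> verts G \<and> clique K (edges G)}" using L(1) by blast
  next
    fix m assume "m \<in> card ` {K. K \<subseteq> verts G \<and> clique K (edges G)}"
    then obtain L where L: "L \<subseteq> verts G" "clique L (edges G)" "m = card L" by auto
    then have "clique (h ` L) (edges H)" "card (h ` L) = m" "h ` L \<subseteq> verts H"
      using iso_clique[OF h L(1)] card_image[OF inj_on_subset[OF inj L(1)]] im by auto
    then show "m \<in> card ` {K. K \<subseteq> verts H \<and> clique K (edges H)}" by blast
  qed
  then show ?thesis by (simp add: clique_number_def)
qed

text \<open>Ensures that the renamed kernel is again an admissible instance.\<close>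

lemma iso_perfect:
  assumes h: "is_iso h G H" and "perfect G"
  shows "perfect H"
  unfolding perfect_def
proof (intro allI impI)
  fix Y assume Y: "Y \<subseteq> verts H"
  obtain X where X: "X \<subseteq> verts G" "Y = h ` X"
    using h Y by (metis is_iso_def bij_betw_def subset_imageE)
  have "is_iso h (induced G X) (induced H Y)" unfolding X(2) by (rule iso_induced[OF h X(1)])
  then show "chromatic_number (induced H Y) = clique_number (induced H Y)"
    using assms(2) X(1) by (simp add: perfect_def iso_chromatic_number[symmetric] iso_clique_number[symmetric])
qed

section \<open>Badness as a function of boundedly many bits\<close>

definition idx_pairs :: "nat \<Rightarrow> (nat \<times> nat) list" where
  "idx_pairs d = List.product [0..<d] [0..<d]"

text \<open>These \<open>2 * d * d\<close> bits determine the induced subgraph up to isomorphism,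
  and each of them can be tested by a single expression of the machine. The second half detects
  repeated entries.\<close>

definition obs :: "nat \<Rightarrow> nat graph \<Rightarrow> nat list \<Rightarrow> bool list" where
  "obs d G v = map (\<lambda>(i, j). {v ! i, v ! j} \<in> edges G) (idx_pairs d) @
     map (\<lambda>(i, j). v ! i \<noteq> v ! j) (idx_pairs d)"

text \<open>Sending the entry at position \<open>i\<close> of \<open>u\<close> to the one of
  \<open>v\<close> is an isomorphism of the induced subgraphs: the equality bits make it well
  defined and injective, the adjacency bits make it preserve edges.\<close>

lemma bad_obs_cong:
  assumes "fin_graph G" "fin_graph H" "set u \<subseteq> verts G" "set v \<subseteq> verts H"
    and len: "length u = d" "length v = d" and eq: "obs d G u = obs d H v" and "bad r l G u"
  shows "bad r l H v"
proof -
  have pairs: "set (idx_pairs d) = {..<d} \<times> {..<d}" by (auto simp: idx_pairs_def)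
  have adj: "{u ! i, u ! j} \<in> edges G \<longleftrightarrow> {v ! i, v ! j} \<in> edges H"
    and same: "u ! i = u ! j \<longleftrightarrow> v ! i = v ! j" if "i < d" "j < d" for i j
    using eq that unfolding obs_def by (auto simp: pairs dest!: bspec[of _ _ "(i, j)"])
  \<comment> \<open>Any position of \<open>x\<close> may be chosen, since all of them carry the same
    entry of \<open>v\<close>.\<close>
  define h where "h x = v ! (SOME i. i < d \<and> u ! i = x)" for x
  have h: "h (u ! i) = v ! i" if "i < d" for i
  proof -
    have "(SOME j. j < d \<and> u ! j = u ! i) < d \<and> u ! (SOME j. j < d \<and> u ! j = u ! i) = u ! i"
      using that by (intro someI[of "\<lambda>j. j < d \<and> u ! j = u ! i" i]) simp
    then show ?thesis using same that unfolding h_def by blast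
  qed
  have setu: "set u = (!) u ` {..<d}" and setv: "set v = (!) v ` {..<d}"
    using len by (auto simp: set_conv_nth)
  have "bij_betw h (set u) (set v)"
    unfolding bij_betw_def setu setv using h same by (auto simp: inj_on_def image_image)
  moreover have "{h x, h y} \<in> edges H \<longleftrightarrow> {x, y} \<in> edges G" if "x \<in> set u" "y \<in> set u" for x y
    using that h adj unfolding setu by auto
  ultimately have "is_iso h (induced G (set u)) (induced H (set v))"
    using assms(3,4) unfolding is_iso_def
    by (auto simp: verts_induced Int_absorb1) (auto simp: induced_def bij_betw_def)
  moreover have "finite (verts (induced G (set u)))" by (simp add: verts_induced)
  ultimately show ?thesis using iso_rl_split assms(8) unfolding bad_def by blast
qed

text \<open>The quantification over all graphs costs nothing at run time: the predicate is evaluated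
  on the finitely many bit patterns when the program is built, and only its values appear in the
  program.\<close>

definition bad_obs :: "nat \<Rightarrow> nat \<Rightarrow> nat \<Rightarrow> bool list \<Rightarrow> bool" where
  "bad_obs d r l bs \<longleftrightarrow> (\<exists>G v. fin_graph G \<and> set v \<subseteq> verts G \<and> length v = d \<and>
     obs d G v = bs \<and> bad r l G v)"

lemma bad_iff_bad_obs:
  "fin_graph G \<Longrightarrow> set v \<subseteq> verts G \<Longrightarrow> length v = d \<Longrightarrow> bad r l G v \<longleftrightarrow> bad_obs d r l (obs d G v)"
  unfolding bad_obs_def using bad_obs_cong by metis

section \<open>Reasoning about programs\<close>

fun sz :: "prog \<Rightarrow> nat" where
  "sz Skip = 1"
| "sz (Store a e1 e2) = 1 + cost e1 + cost e2"
| "sz (Seq p q) = sz p + sz q"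
| "sz (If e p q) = 1 + cost e + sz p + sz q"
| "sz (While e p) = 1 + cost e + sz p"

fun depth :: "prog \<Rightarrow> nat" where
  "depth Skip = 0"
| "depth (Store a e1 e2) = 0"
| "depth (Seq p q) = max (depth p) (depth q)"
| "depth (If e p q) = max (depth p) (depth q)"
| "depth (While e p) = Suc (depth p)"

fun writes :: "prog \<Rightarrow> nat set" where
  "writes Skip = {}"
| "writes (Store a e1 e2) = {a}"
| "writes (Seq p q) = writes p \<union> writes q"
| "writes (If e p q) = writes p \<union> writes q"
| "writes (While e p) = writes p"

lemma exec_frame: "exec p s t s' \<Longrightarrow> a \<notin> writes p \<Longrightarrow> s' a = s a"
  by (induction rule: exec.induct) auto

text \<open>If every loop of \<open>p\<close> makes at most \<open>M\<close> rounds each time it is entered, then \<open>p\<close> halts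
  within \<open>sz p * (M + 1) ^ depth p\<close> steps. Building this bound into the predicate
  transformer leaves only the number of rounds to be checked.\<close>

definition wp :: "nat \<Rightarrow> prog \<Rightarrow> (state \<Rightarrow> bool) \<Rightarrow> state \<Rightarrow> bool" where
  "wp M p Q s \<longleftrightarrow> (\<exists>t s'. exec p s t s' \<and> t \<le> sz p * (M + 1) ^ depth p \<and> Q s')"

text \<open>Specifications may stay silent about arrays that a program does not write; this rule
  supplies those facts when specifications are combined.\<close>

lemma wp_frame:
  assumes "wp M p Q s" "\<And>s'. Q s' \<Longrightarrow> (\<And>a. a \<notin> writes p \<Longrightarrow> s' a = s a) \<Longrightarrow> R s'"
  shows "wp M p R s"
  using assms exec_frame unfolding wp_def by metis

lemma wp_mono: "wp M p Q s \<Longrightarrow> (\<And>s'. Q s' \<Longrightarrow> R s') \<Longrightarrow> wp M p R s"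
  using wp_frame by metis

lemma wp_Skip: "Q s \<Longrightarrow> wp M Skip Q s"
  unfolding wp_def using exec.Skip by force

lemma wp_Store: "Q (s(a := (s a)(val e1 s := val e2 s))) \<Longrightarrow> wp M (Store a e1 e2) Q s"
  unfolding wp_def using exec.Store by fastforce

lemma wp_Seq:
  assumes "wp M p (wp M q Q) s"
  shows "wp M (Seq p q) Q s"
proof -
  obtain t s' where p: "exec p s t s'" "t \<le> sz p * (M + 1) ^ depth p" "wp M q Q s'"
    using assms unfolding wp_def[of M p] by blast
  obtain t' s'' where q: "exec q s' t' s''" "t' \<le> sz q * (M + 1) ^ depth q" "Q s''"
    using p(3) unfolding wp_def by blast
  have "sz p * (M + 1) ^ depth p \<le> sz p * (M + 1) ^ depth (Seq p q)"
    "sz q * (M + 1) ^ depth q \<le> sz q * (M + 1) ^ depth (Seq p q)"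
    by (intro mult_le_mono2 power_increasing; simp)+
  then have "t + t' \<le> sz (Seq p q) * (M + 1) ^ depth (Seq p q)"
    using p(2) q(2) by (simp only: sz.simps add_mult_distrib)
  then show ?thesis unfolding wp_def using exec.Seq[OF p(1) q(1)] q(3) by blast
qed

lemma If_time_le:
  assumes "t \<le> sz p * (M + 1) ^ depth p" "sz p \<le> S" "depth p \<le> D"
  shows "c + t \<le> (c + S) * (M + 1 :: nat) ^ D"
proof -
  have "t \<le> S * (M + 1) ^ D"
    using assms(1) by (rule le_trans) (intro mult_le_mono power_increasing; use assms in simp)
  moreover have "c * 1 \<le> c * (M + 1) ^ D" by (intro mult_le_mono2) simp
  ultimately show ?thesis unfolding add_mult_distrib by linarith
qed

lemma wp_If:
  assumes "val e s \<noteq> 0 \<Longrightarrow> wp M p Q s" "val e s = 0 \<Longrightarrow> wp M q Q s"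
  shows "wp M (If e p q) Q s"
proof (cases "val e s = 0")
  case False
  then obtain t s' where p: "exec p s t s'" "t \<le> sz p * (M + 1) ^ depth p" "Q s'"
    using assms(1) unfolding wp_def by blast
  have "1 + cost e + t \<le> sz (If e p q) * (M + 1) ^ depth (If e p q)"
    using If_time_le[OF p(2), of "sz p + sz q" "depth (If e p q)" "1 + cost e"] by (simp add: add.assoc)
  then show ?thesis unfolding wp_def using exec.If_true[OF False p(1)] p(3) by blast
next
  case True
  then obtain t s' where q: "exec q s t s'" "t \<le> sz q * (M + 1) ^ depth q" "Q s'"
    using assms(2) unfolding wp_def by blast
  have "1 + cost e + t \<le> sz (If e p q) * (M + 1) ^ depth (If e p q)"
    using If_time_le[OF q(2), of "sz p + sz q" "depth (If e p q)" "1 + cost e"] by (simp add: add.assoc)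
  then show ?thesis unfolding wp_def using exec.If_false[OF True q(1)] q(3) by blast
qed

text \<open>The number \<open>N\<close> of rounds stays explicit here. The outer loop of the
  branching algorithm makes \<open>d ^ k\<close> rounds, which must not enter the uniform loop bound
  of \<open>wp\<close>.\<close>

lemma exec_While_rounds:
  assumes "I 0 s"
    and "\<And>i s. i < N \<Longrightarrow> I i s \<Longrightarrow>
      val e s \<noteq> 0 \<and> (\<exists>t s'. exec p s t s' \<and> t \<le> T \<and> I (Suc i) s')"
    and "\<And>s. I N s \<Longrightarrow> val e s = 0"
  shows "\<exists>t s'. exec (While e p) s t s' \<and> t \<le> N * (1 + cost e + T) + 1 + cost e \<and> I N s'"
proof -
  have "\<exists>t s'. exec (While e p) s t s' \<and> t \<le> m * (1 + cost e + T) + 1 + cost e \<and> I N s'"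
    if "m + i = N" "I i s" for m i s
    using that
  proof (induction m arbitrary: i s)
    case 0
    then show ?case using assms(3)[of s] exec.While_false[of e s p] by auto
  next
    case (Suc m)
    then obtain t s' where 1: "val e s \<noteq> 0" "exec p s t s'" "t \<le> T" "I (Suc i) s'"
      using assms(2)[of i s] by auto
    obtain t' s'' where 2: "exec (While e p) s' t' s''" "t' \<le> m * (1 + cost e + T) + 1 + cost e" "I N s''"
      using Suc.IH[of "Suc i" s'] Suc.prems 1(4) by auto
    have "1 + cost e + t + t' \<le> Suc m * (1 + cost e + T) + 1 + cost e" using 1(3) 2(2) by simp
    then show ?case using exec.While_true[OF 1(1,2) 2(1)] 2(3) by blast
  qed
  from this[of N 0 s] show ?thesis using assms(1) by simp
qed

lemma wp_While:
  assumes "I 0 s" "N \<le> M"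
    and "\<And>i s. i < N \<Longrightarrow> I i s \<Longrightarrow> val e s \<noteq> 0 \<and> wp M p (I (Suc i)) s"
    and "\<And>s. I N s \<Longrightarrow> val e s = 0"
  shows "wp M (While e p) (I N) s"
proof -
  define T where "T = sz p * (M + 1) ^ depth p"
  obtain t s' where t: "exec (While e p) s t s'" "t \<le> N * (1 + cost e + T) + 1 + cost e" "I N s'"
    using exec_While_rounds[of I s N e p T] assms unfolding wp_def T_def by blast
  \<comment> \<open>The last, failing test of the condition is charged as one more round, hence the
    factor \<open>M + 1\<close>.\<close>
  have "N * (1 + cost e + T) + 1 + cost e \<le> M * (1 + cost e + T) + (1 + cost e + T)"
    using assms(2) mult_le_mono1 by (metis add.assoc add_le_mono le_add1)
  also have "\<dots> = (1 + cost e + T) * (M + 1)" by (simp add: algebra_simps)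
  also have "\<dots> \<le> ((1 + cost e + sz p) * (M + 1) ^ depth p) * (M + 1)"
    unfolding T_def by (intro mult_le_mono1 If_time_le) auto
  finally have "t \<le> sz (While e p) * (M + 1) ^ depth (While e p)" using t(2) by (simp add: algebra_simps)
  then show ?thesis unfolding wp_def using t by blast
qed

section \<open>Counting loops\<close>

text \<open>Truncated subtraction tests whether the counter is below \<open>b\<close>. As
  \<open>b\<close> is evaluated anew in every round, the rules below ask for its value to stay
  fixed.\<close>

definition For :: "nat \<Rightarrow> expr \<Rightarrow> prog \<Rightarrow> prog" where
  "For a b p = Seq (Store a (Const 0) (Const 0))
     (While (Sub b (Cell a (Const 0))) (Seq p (Store a (Const 0) (Add (Cell a (Const 0)) (Const 1)))))"

lemma depth_For [simp]: "depth (For a b p) = Suc (depth p)"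
  and writes_For [simp]: "writes (For a b p) = insert a (writes p)"
  by (auto simp: For_def)

text \<open>The body may write to the array of the counter if cell \<open>0\<close> is preserved:
  \<open>nest\<close> keeps the row offset in cell \<open>1\<close> of the same array. In each
  premise, arrays not written by the loop can be traced back to the start state
  \<open>s\<close>.\<close>

lemma wp_For':
  assumes N: "N \<le> M"
    and init: "I 0 (s(a := (s a)(0 := 0)))"
    and bound: "\<And>i s'. i \<le> N \<Longrightarrow> I i s' \<Longrightarrow> s' a 0 = i \<Longrightarrow>
      (\<And>x. x \<noteq> a \<Longrightarrow> x \<notin> writes p \<Longrightarrow> s' x = s x) \<Longrightarrow> val b s' = N"
    and step: "\<And>i s'. i < N \<Longrightarrow> I i s' \<Longrightarrow> s' a 0 = i \<Longrightarrow>
      (\<And>x. x \<noteq> a \<Longrightarrow> x \<notin> writes p \<Longrightarrow> s' x = s x) \<Longrightarrow>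
      wp M p (\<lambda>s''. s'' a 0 = i \<and> I (Suc i) (s''(a := (s'' a)(0 := Suc i)))) s'"
    and post: "\<And>s'. I N s' \<Longrightarrow> s' a 0 = N \<Longrightarrow>
      (\<And>x. x \<noteq> a \<Longrightarrow> x \<notin> writes p \<Longrightarrow> s' x = s x) \<Longrightarrow> Q s'"
  shows "wp M (For a b p) Q s"
proof -
  let ?J = "\<lambda>i s'. I i s' \<and> s' a 0 = i \<and> i \<le> N \<and> (\<forall>x. x \<noteq> a \<longrightarrow> x \<notin> writes p \<longrightarrow> s' x = s x)"
  show ?thesis unfolding For_def
  proof (intro wp_Seq wp_Store)
    have "wp M (While (Sub b (Cell a (Const 0)))
        (Seq p (Store a (Const 0) (Add (Cell a (Const 0)) (Const 1))))) (?J N) (s(a := (s a)(0 := 0)))"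
    proof (rule wp_While[where I = ?J, OF _ N], goal_cases)
      case 1
      then show ?case using init by simp
    next
      case (2 i s')
      then have J: "I i s'" "s' a 0 = i" "\<And>x. x \<noteq> a \<Longrightarrow> x \<notin> writes p \<Longrightarrow> s' x = s x" by auto
      have "val b s' = N" using bound[of i s'] J 2(1) by simp
      moreover have "wp M p (wp M (Store a (Const 0) (Add (Cell a (Const 0)) (Const 1))) (?J (Suc i))) s'"
      proof (rule wp_frame[OF step[OF 2(1) J]])
        fix s'' assume "s'' a 0 = i \<and> I (Suc i) (s''(a := (s'' a)(0 := Suc i)))"
          and fr: "\<And>x. x \<notin> writes p \<Longrightarrow> s'' x = s' x"
        then show "wp M (Store a (Const 0) (Add (Cell a (Const 0)) (Const 1))) (?J (Suc i)) s''"
          using J fr 2(1) by (intro wp_Store) (auto simp: fun_upd_def)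
      qed assumption+
      ultimately show ?case using J(2) 2(1) by (auto intro: wp_Seq)
    next
      case (3 s')
      then show ?case using bound[of N s'] by simp
    qed
    then show "wp M (While (Sub b (Cell a (Const 0)))
        (Seq p (Store a (Const 0) (Add (Cell a (Const 0)) (Const 1))))) Q
        (s(a := (s a)(val (Const 0) s := val (Const 0) s)))"
      by (simp only: val.simps) (erule wp_mono, use post in auto)
  qed
qed

lemma wp_For:
  assumes "N \<le> M" and a: "a \<notin> writes p"
    and "I 0 (s(a := (s a)(0 := 0)))"
    and "\<And>i s'. i \<le> N \<Longrightarrow> I i s' \<Longrightarrow> s' a 0 = i \<Longrightarrow>
      (\<And>x. x \<noteq> a \<Longrightarrow> x \<notin> writes p \<Longrightarrow> s' x = s x) \<Longrightarrow> val b s' = N"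
    and step: "\<And>i s'. i < N \<Longrightarrow> I i s' \<Longrightarrow> s' a 0 = i \<Longrightarrow>
      (\<And>x. x \<noteq> a \<Longrightarrow> x \<notin> writes p \<Longrightarrow> s' x = s x) \<Longrightarrow>
      wp M p (\<lambda>s''. I (Suc i) (s''(a := (s'' a)(0 := Suc i)))) s'"
    and "\<And>s'. I N s' \<Longrightarrow> s' a 0 = N \<Longrightarrow>
      (\<And>x. x \<noteq> a \<Longrightarrow> x \<notin> writes p \<Longrightarrow> s' x = s x) \<Longrightarrow> Q s'"
  shows "wp M (For a b p) Q s"
proof (rule wp_For'[where I = I and N = N])
  fix i s'
  assume "i < N" "I i s'" and i: "s' a 0 = i" "\<And>x. x \<noteq> a \<Longrightarrow> x \<notin> writes p \<Longrightarrow> s' x = s x"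
  then show "wp M p (\<lambda>s''. s'' a 0 = i \<and> I (Suc i) (s''(a := (s'' a)(0 := Suc i)))) s'"
    using a by (intro wp_frame[OF step]) auto
qed (fact assms)+

section \<open>Decision trees and loops over tuples\<close>

text \<open>The size of this complete binary tree is exponential in the number of tests, which here
  depends on \<open>d\<close> only and so counts as constant.\<close>

fun tree :: "expr list \<Rightarrow> (bool list \<Rightarrow> prog) \<Rightarrow> prog" where
  "tree [] F = F []"
| "tree (q # qs) F = If q (tree qs (\<lambda>bs. F (True # bs))) (tree qs (\<lambda>bs. F (False # bs)))"

lemma wp_tree: "wp M (F (map (\<lambda>q. val q s \<noteq> 0) qs)) Q s \<Longrightarrow> wp M (tree qs F) Q s"
  by (induction qs arbitrary: F) (auto intro!: wp_If)

lemma depth_tree: "(\<And>bs. depth (F bs) \<le> D) \<Longrightarrow> depth (tree qs F) \<le> D"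
  by (induction qs arbitrary: F) auto

lemma writes_tree: "(\<And>bs. writes (F bs) \<subseteq> W) \<Longrightarrow> writes (tree qs F) \<subseteq> W"
  by (induction qs arbitrary: F) auto

fun seqs :: "prog list \<Rightarrow> prog" where
  "seqs [] = Skip"
| "seqs (p # ps) = Seq p (seqs ps)"

lemma writes_seqs: "writes (seqs ps) = (\<Union>p\<in>set ps. writes p)"
  by (induction ps) auto

lemma depth_seqs: "(\<And>p. p \<in> set ps \<Longrightarrow> depth p \<le> D) \<Longrightarrow> depth (seqs ps) \<le> D"
  by (induction ps) auto

text \<open>Tuples of vertices are held in the registers \<open>20, 20 + 1, \<dots>\<close>; cell \<open>0\<close> of a register is
  the vertex \<open>v\<close> and cell \<open>1\<close> its row offset \<open>v * n\<close>.\<close>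

definition reg :: "nat \<Rightarrow> nat" where "reg j = 20 + j"

text \<open>The row offset grows by \<open>n\<close> in every round, since the machine cannot
  multiply.\<close>

fun nest :: "nat \<Rightarrow> prog \<Rightarrow> prog" where
  "nest 0 p = p"
| "nest (Suc j) p = Seq (Store (reg j) (Const 1) (Const 0))
     (For (reg j) (Cell 0 (Const 0))
       (Seq (nest j p) (Store (reg j) (Const 1) (Add (Cell (reg j) (Const 1)) (Cell 0 (Const 0))))))"

text \<open>The order is that of the nested loops, with the last entry varying slowest. It fixes
  which bad tuple is found first and in which order tuples are kept.\<close>

fun tups :: "nat \<Rightarrow> nat \<Rightarrow> nat list list" where
  "tups n 0 = [[]]"
| "tups n (Suc j) = concat (map (\<lambda>x. map (\<lambda>u. u @ [x]) (tups n j)) [0..<n])"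

lemma set_tups: "set (tups n j) = {v. length v = j \<and> set v \<subseteq> {..<n}}"
proof (induction j)
  case (Suc j)
  show ?case
  proof (intro equalityI subsetI)
    fix v assume "v \<in> {v. length v = Suc j \<and> set v \<subseteq> {..<n}}"
    then obtain u x where "v = u @ [x]" "length u = j" "set u \<subseteq> {..<n}" "x < n"
      by (cases v rule: rev_cases) auto
    then show "v \<in> set (tups n (Suc j))" using Suc by auto
  qed (use Suc in auto)
qed auto

text \<open>The shift \<open>j\<close> serves the induction in \<open>wp_nest\<close>, where the
  outer loops have fixed a suffix of the tuple in the registers from \<open>j\<close> on.\<close>

definition holds_tuple :: "nat \<Rightarrow> nat \<Rightarrow> nat list \<Rightarrow> state \<Rightarrow> bool" where
  "holds_tuple n j v s \<longleftrightarrow> (\<forall>i<length v. s (reg (j + i)) 0 = v ! i \<and> s (reg (j + i)) 1 = v ! i * n)"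

lemma writes_nest: "writes (nest j p) = reg ` {..<j} \<union> writes p"
  by (induction j) (auto simp: lessThan_Suc)

lemma depth_nest: "depth (nest j p) = j + depth p"
  by (induction j) auto

text \<open>The invariant is indexed by the list of tuples visited so far. The induction runs over
  the number \<open>j\<close> of inner loops, for an arbitrary suffix \<open>w\<close> fixed by the
  outer loops and an arbitrary list \<open>xs\<close> of tuples already visited.\<close>

lemma wp_nest:
  assumes n: "n \<le> M" and regs: "\<And>j. j < d \<Longrightarrow> reg j \<notin> writes p" and w0: "0 \<notin> writes p"
    and I_cong: "\<And>xs s s'. (\<And>a. a \<notin> reg ` {..<d} \<Longrightarrow> s' a = s a) \<Longrightarrow> I xs s \<Longrightarrow> I xs s'"
    and body: "\<And>xs v s. length v = d \<Longrightarrow> set v \<subseteq> {..<n} \<Longrightarrow> I xs s \<Longrightarrow> holds_tuple n 0 v s \<Longrightarrow>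
      s 0 0 = n \<Longrightarrow> wp M p (I (xs @ [v])) s"
    and "I [] s" "s 0 0 = n"
  shows "wp M (nest d p) (I (tups n d)) s"
proof -
  have "wp M (nest j p) (I (xs @ map (\<lambda>u. u @ w) (tups n j))) s"
    if "length w + j = d" "set w \<subseteq> {..<n}" "I xs s" "holds_tuple n j w s" "s 0 0 = n" for j w xs s
    using that
  proof (induction j arbitrary: w xs s)
    case 0
    then show ?case using body[of w xs s] by simp
  next
    case (Suc j)
    have jd: "j < d" and rj: "reg j \<noteq> 0" using Suc.prems(1) by (auto simp: reg_def)
    define J where "J x = (\<lambda>s'. I (xs @ concat (map (\<lambda>x. map (\<lambda>u. u @ x # w) (tups n j)) [0..<x])) s'
        \<and> s' (reg j) 1 = x * n)" for x
    have regj: "reg j \<notin> reg ` {..<j} \<union> writes p" using regs[OF jd] by (auto simp: reg_def)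
    have hw: "holds_tuple n (Suc j) w s'"
      if fr: "\<And>x. x \<noteq> reg j \<Longrightarrow> x \<notin> reg ` {..<j} \<union> writes p \<Longrightarrow> s' x = s x" for s'
      unfolding holds_tuple_def
    proof (intro allI impI)
      fix i assume i: "i < length w"
      have "reg (Suc j + i) \<notin> writes p" using i Suc.prems(1) by (intro regs) simp
      moreover have "reg (Suc j + i) \<noteq> reg j" "reg (Suc j + i) \<notin> reg ` {..<j}" by (auto simp: reg_def)
      ultimately have "s' (reg (Suc j + i)) = s (reg (Suc j + i))" by (intro fr) simp_all
      then show "s' (reg (Suc j + i)) 0 = w ! i \<and> s' (reg (Suc j + i)) 1 = w ! i * n"
        using Suc.prems(4) i by (simp add: holds_tuple_def)
    qed
    let ?body = "Seq (nest j p) (Store (reg j) (Const 1) (Add (Cell (reg j) (Const 1)) (Cell 0 (Const 0))))"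
    let ?s = "s(reg j := (s (reg j))(1 := 0))"
    have wbody: "writes ?body = insert (reg j) (reg ` {..<j} \<union> writes p)"
      by (auto simp: writes_nest)
    have cong: "I ys (s'(reg j := f))" if "I ys s'" for ys s' f
      by (rule I_cong[OF _ that]) (use jd in auto)
    have "wp M (For (reg j) (Cell 0 (Const 0)) ?body) (I (xs @ map (\<lambda>u. u @ w) (tups n (Suc j)))) ?s"
    proof (rule wp_For'[where I = J and N = n, OF n], goal_cases)
      case 1
      show ?case using cong[OF cong[OF Suc.prems(3)]] by (simp add: J_def)
    next
      case (2 i s')
      then have "s' 0 = ?s 0" using rj w0 by (intro 2(4)) (auto simp: reg_def writes_nest)
      then show ?case using Suc.prems(5) rj by simp
    next
      case (3 i s')
      have fr: "s' x = s x" if "x \<noteq> reg j" "x \<notin> reg ` {..<j} \<union> writes p" for x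
        using 3(4)[of x] that by (simp add: writes_nest)
      have I: "I (xs @ concat (map (\<lambda>x. map (\<lambda>u. u @ x # w) (tups n j)) [0..<i])) s'"
        and off: "s' (reg j) 1 = i * n" using 3(2) by (auto simp: J_def)
      have "holds_tuple n j (i # w) s'"
        using hw[OF fr] off 3(3) unfolding holds_tuple_def by (auto simp: nth_Cons split: nat.split)
      moreover have "0 \<notin> reg ` {..<j}" by (auto simp: reg_def)
      then have s00: "s' 0 0 = n" using fr[of 0] Suc.prems(5) rj w0 by simp
      ultimately have "wp M (nest j p) (I ((xs @ concat (map (\<lambda>x. map (\<lambda>u. u @ x # w) (tups n j)) [0..<i]))
          @ map (\<lambda>u. u @ i # w) (tups n j))) s'"
        using Suc.prems(1,2) 3(1) I by (intro Suc.IH) auto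
      then show ?case
      proof (intro wp_Seq, elim wp_frame, intro wp_Store)
        fix s'' assume I': "I ((xs @ concat (map (\<lambda>x. map (\<lambda>u. u @ x # w) (tups n j)) [0..<i]))
          @ map (\<lambda>u. u @ i # w) (tups n j)) s''"
          and fr': "\<And>a. a \<notin> writes (nest j p) \<Longrightarrow> s'' a = s' a"
        have "s'' (reg j) = s' (reg j)" using regj by (intro fr') (simp add: writes_nest)
        moreover have "s'' 0 = s' 0" using w0 by (intro fr') (auto simp: writes_nest reg_def)
        ultimately show "(s''(reg j := (s'' (reg j))(val (Const 1) s'' := val (Add (Cell (reg j) (Const 1)) (Cell 0 (Const 0))) s''))) (reg j) 0 = i \<and> J (Suc i)
         ((s''(reg j := (s'' (reg j))(val (Const 1) s'' := val (Add (Cell (reg j) (Const 1)) (Cell 0 (Const 0))) s'')))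
          (reg j := ((s''(reg j := (s'' (reg j))(val (Const 1) s'' := val (Add (Cell (reg j) (Const 1)) (Cell 0 (Const 0))) s''))) (reg j))(0 := Suc i)))"
          using cong[OF I'] off s00 rj 3(3) unfolding J_def by (simp add: add.commute)
      qed
    next
      case (4 s')
      then show ?case by (simp add: J_def map_concat comp_def)
    qed
    then show ?case by (auto intro!: wp_Seq wp_Store)
  qed
  from this[of "[]" d "[]" s] assms(6,7) show ?thesis by (simp add: holds_tuple_def)
qed

section \<open>The branching algorithm\<close>

abbreviation R :: "nat \<Rightarrow> expr" where "R a \<equiv> Cell a (Const 0)"

definition stores :: "nat \<Rightarrow> (nat \<Rightarrow> expr) \<Rightarrow> (nat \<Rightarrow> expr) \<Rightarrow> nat \<Rightarrow> prog" where
  "stores a ix e d = seqs (map (\<lambda>j. Store a (ix j) (e j)) [0..<d])"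

lemma writes_stores: "writes (stores a ix e d) \<subseteq> {a}"
  by (auto simp: stores_def writes_seqs)

lemma depth_stores: "depth (stores a ix e d) = 0"
proof -
  have "depth (stores a ix e d) \<le> 0" unfolding stores_def by (rule depth_seqs) auto
  then show ?thesis by simp
qed

text \<open>The stores run one after another but act as if simultaneous: indices and values do not
  depend on the array written, and coinciding indices receive equal values. Coincidences do occur in
  \<open>mark\<close>, where a tuple may repeat a vertex.\<close>

lemma wp_stores:
  assumes ix: "\<And>j s f. val (ix j) (s(a := f)) = val (ix j) s"
    and e: "\<And>j s f. val (e j) (s(a := f)) = val (e j) s"
    and same: "\<And>i j. i < d \<Longrightarrow> j < d \<Longrightarrow> val (ix i) s = val (ix j) s \<Longrightarrow> val (e i) s = val (e j) s"
    and Q: "\<And>s'. (\<And>j. j < d \<Longrightarrow> s' a (val (ix j) s) = val (e j) s) \<Longrightarrow>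
      (\<And>i. i \<notin> (\<lambda>j. val (ix j) s) ` {..<d} \<Longrightarrow> s' a i = s a i) \<Longrightarrow>
      (\<And>x. x \<noteq> a \<Longrightarrow> s' x = s x) \<Longrightarrow> Q s'"
  shows "wp M (stores a ix e d) Q s"
proof -
  have "wp M (seqs (map (\<lambda>j. Store a (ix j) (e j)) js))
     (\<lambda>s'. (\<forall>j\<in>set js. s' a (val (ix j) s) = val (e j) s) \<and>
       (\<forall>i. i \<notin> (\<lambda>j. val (ix j) s) ` set js \<longrightarrow> s' a i = s a i) \<and> (\<forall>x. x \<noteq> a \<longrightarrow> s' x = s x)) s"
    if "\<forall>i\<in>set js. \<forall>j\<in>set js. val (ix i) s = val (ix j) s \<longrightarrow> val (e i) s = val (e j) s" for js s
    using that
  proof (induction js arbitrary: s)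
    case Nil
    then show ?case by (auto intro: wp_Skip)
  next
    case (Cons j js)
    let ?s = "s(a := (s a)(val (ix j) s := val (e j) s))"
    have "wp M (seqs (map (\<lambda>j. Store a (ix j) (e j)) js))
     (\<lambda>s'. (\<forall>j\<in>set js. s' a (val (ix j) s) = val (e j) s) \<and>
       (\<forall>i. i \<notin> (\<lambda>j. val (ix j) s) ` set js \<longrightarrow> s' a i = ?s a i) \<and> (\<forall>x. x \<noteq> a \<longrightarrow> s' x = ?s x)) ?s"
      by (rule Cons.IH[of ?s, unfolded ix e]) (meson Cons.prems list.set_intros(2))
    then show ?case
    proof (simp only: list.map seqs.simps, intro wp_Seq wp_Store, elim wp_mono)
      fix s' assume *: "(\<forall>j\<in>set js. s' a (val (ix j) s) = val (e j) s) \<and>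
       (\<forall>i. i \<notin> (\<lambda>j. val (ix j) s) ` set js \<longrightarrow> s' a i = ?s a i) \<and> (\<forall>x. x \<noteq> a \<longrightarrow> s' x = ?s x)"
      have "s' a (val (ix j) s) = val (e j) s"
      proof (cases "val (ix j) s \<in> (\<lambda>j. val (ix j) s) ` set js")
        case True
        then obtain i where "i \<in> set js" "val (ix j) s = val (ix i) s" by auto
        then show ?thesis using * Cons.prems by (metis list.set_intros)
      next
        case False
        then show ?thesis using * by simp
      qed
      then show "(\<forall>j\<in>set (j # js). s' a (val (ix j) s) = val (e j) s) \<and>
       (\<forall>i. i \<notin> (\<lambda>j. val (ix j) s) ` set (j # js) \<longrightarrow> s' a i = s a i) \<and> (\<forall>x. x \<noteq> a \<longrightarrow> s' x = s x)"
        using * by auto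
    qed
  qed
  note spec = this
  show ?thesis unfolding stores_def
    by (rule wp_mono[OF spec], intro ballI impI, rule same, simp_all, rule Q) (auto simp: lessThan_atLeast0)
qed

section \<open>Programs of the branching algorithm\<close>

text \<open>The matrix is addressed through the stored row offset. The sum of the two truncated
  differences is the distance of two entries, nonzero iff they differ.\<close>

definition obs_exprs :: "nat \<Rightarrow> expr list" where
  "obs_exprs d =
     map (\<lambda>(i, j). Cell 1 (Add (Cell (reg i) (Const 1)) (R (reg j)))) (idx_pairs d) @
     map (\<lambda>(i, j). Add (Sub (R (reg i)) (R (reg j))) (Sub (R (reg j)) (R (reg i)))) (idx_pairs d)"

lemma represents_cong: "s' 0 = s 0 \<Longrightarrow> s' 1 = s 1 \<Longrightarrow> represents s x \<Longrightarrow> represents s' x"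
  by (simp add: represents_def split: prod.splits)

lemma find_snoc: "find P (xs @ [v]) = (case find P xs of None \<Rightarrow> if P v then Some v else None | Some u \<Rightarrow> Some u)"
  by (induction xs) auto

text \<open>Arrays used by the branching algorithm: \<open>2\<close> marks the deleted vertices, \<open>3\<close> holds the
  digits that select the branch, \<open>4\<close> tells whether the last search was successful and \<open>5\<close>
  holds the tuple it found, \<open>7\<close> is the carry of the digit counter, \<open>9\<close> the answer.\<close>

definition search_step :: "nat \<Rightarrow> nat \<Rightarrow> nat \<Rightarrow> prog" where
  "search_step d r l = If (R 4) Skip (tree (map (\<lambda>j. Cell 2 (R (reg j))) [0..<d] @ obs_exprs d)
     (\<lambda>bs. if True \<notin> set (take d bs) \<and> bad_obs d r l (drop d bs)
        then Seq (Store 4 (Const 0) (Const 1)) (stores 5 Const (\<lambda>j. R (reg j)) d) else Skip))"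

definition search :: "nat \<Rightarrow> nat \<Rightarrow> nat \<Rightarrow> prog" where
  "search d r l = Seq (Store 4 (Const 0) (Const 0)) (nest d (search_step d r l))"

definition clear :: prog where
  "clear = For 8 (R 0) (Store 2 (R 8) (Const 0))"

text \<open>There are \<open>k + 1\<close> searches: the first \<open>k\<close> may delete one
  vertex each, the last one reports in array \<open>4\<close> whether a bad tuple survives. A vertex
  flagged after the last search does no harm, because \<open>clear\<close> precedes the next
  path.\<close>

definition branch :: "nat \<Rightarrow> nat \<Rightarrow> nat \<Rightarrow> prog" where
  "branch d r l = For 6 (Add (Cell 0 (Const 1)) (Const 1))
     (Seq (search d r l) (If (R 4) (Store 2 (Cell 5 (Cell 3 (R 6))) (Const 1)) Skip))"

text \<open>Adds one to a number in base \<open>d\<close>, lowest digit first. A carry that is left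
  at the end signals that all paths have been tried and stops the outer loop.\<close>

definition increment :: "nat \<Rightarrow> prog" where
  "increment d = Seq (Store 7 (Const 0) (Const 1))
     (For 10 (Cell 0 (Const 1)) (If (R 7)
        (If (Sub (Const d) (Add (Cell 3 (R 10)) (Const 1)))
          (Seq (Store 3 (R 10) (Add (Cell 3 (R 10)) (Const 1))) (Store 7 (Const 0) (Const 0)))
          (Store 3 (R 10) (Const 0)))
        Skip))"

text \<open>One round replays one path of the branching tree from the root and then moves the
  counter on to the next path.\<close>

definition fpt_round :: "nat \<Rightarrow> nat \<Rightarrow> nat \<Rightarrow> prog" where
  "fpt_round d r l = Seq clear (Seq (branch d r l)
     (Seq (If (R 4) Skip (Store 9 (Const 0) (Const 1))) (increment d)))"

text \<open>The test \<open>k < n\<close> keeps the loops over the digits within \<open>n\<close>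
  rounds; otherwise all vertices may be deleted.\<close>

definition fpt_prog :: "nat \<Rightarrow> nat \<Rightarrow> nat \<Rightarrow> prog" where
  "fpt_prog d r l = If (Sub (R 0) (Cell 0 (Const 1)))
     (Seq (While (Sub (Const 1) (R 7)) (fpt_round d r l)) (Store 0 (Const 0) (R 9)))
     (Store 0 (Const 0) (Const 1))"

lemma writes_search_step: "writes (search_step d r l) \<subseteq> {4, 5}"
proof -
  have "writes (stores 5 Const (\<lambda>j. R (reg j)) d) \<subseteq> {4, 5}" using writes_stores by blast
  then show ?thesis by (simp add: search_step_def writes_tree)
qed

lemma depth_search_step: "depth (search_step d r l) = 0"
  unfolding search_step_def using depth_tree[of _ 0] by (simp add: depth_stores)

lemma writes_search: "writes (search d r l) \<subseteq> {4, 5} \<union> reg ` {..<d}"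
  unfolding search_def using writes_search_step by (auto simp: writes_nest)

lemma depth_fpt_round: "depth (fpt_round d r l) \<le> d + 1"
  by (simp add: fpt_round_def clear_def branch_def increment_def search_def depth_nest depth_search_step)

lemma notin_writes_search: "x < 20 \<Longrightarrow> x \<notin> {4, 5} \<Longrightarrow> x \<notin> writes (search d r l)"
  using writes_search[of d r l] by (auto simp: reg_def)

locale tuple_graph =
  fixes G :: "nat graph" and n r l d :: nat
  assumes fin: "fin_graph G" and verts: "verts G = {..<n}" and d_pos: "d > 0"
begin

lemma card_verts: "card (verts G) = n"
  by (simp add: verts)

lemma obs_exprs_eq_obs:
  assumes "represents s (G, k)" "holds_tuple n 0 v s" "length v = d" "set v \<subseteq> {..<n}"
  shows "map (\<lambda>q. val q s \<noteq> 0) (obs_exprs d) = obs d G v"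
proof -
  have "v ! i < n" if "i < d" for i using assms(3,4) that by (meson lessThan_iff nth_mem subsetD)
  then show ?thesis
    using assms unfolding obs_exprs_def obs_def
    by (auto simp: represents_def card_verts Let_def holds_tuple_def idx_pairs_def)
qed

definition pick :: "nat set \<Rightarrow> nat list option" where
  "pick S = find (\<lambda>v. bad r l G v \<and> set v \<inter> S = {}) (tups n d)"

lemma wp_search:
  assumes n: "n \<le> M" and rep: "represents s (G, k)"
    and flags: "\<And>x. x < n \<Longrightarrow> s 2 x \<noteq> 0 \<longleftrightarrow> x \<in> S"
  shows "wp M (search d r l) (\<lambda>s'. case pick S of None \<Rightarrow> s' 4 0 = 0
    | Some v \<Rightarrow> s' 4 0 = 1 \<and> (\<forall>j<d. s' 5 j = v ! j)) s"
proof -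
  define P where "P v \<longleftrightarrow> bad r l G v \<and> set v \<inter> S = {}" for v
  \<comment> \<open>Arrays \<open>4\<close> and \<open>5\<close> always hold the result of
    \<open>find\<close> on the tuples visited so far, so \<open>find_snoc\<close> describes one
    round.\<close>
  define I where "I xs s' \<longleftrightarrow> s' 0 = s 0 \<and> s' 1 = s 1 \<and> s' 2 = s 2 \<and>
    (case find P xs of None \<Rightarrow> s' 4 0 = 0 | Some v \<Rightarrow> s' 4 0 = 1 \<and> (\<forall>j<d. s' 5 j = v ! j))" for xs and s' :: state
  have s00: "s 0 0 = n" using rep by (simp add: represents_def card_verts Let_def)
  have "wp M (nest d (search_step d r l)) (I (tups n d)) (s(4 := (s 4)(0 := 0)))"
  proof (rule wp_nest[OF n], goal_cases)
    case (1 j)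
    then show ?case by (auto simp: reg_def dest!: subsetD[OF writes_search_step])
  next
    case 2
    then show ?case using writes_search_step by force
  next
    case (3 xs s' s'')
    have eq: "s'' a = s' a" if "a < 20" for a using that by (intro 3(1)) (auto simp: reg_def)
    show ?case using 3(2) eq[of 0] eq[of 1] eq[of 2] eq[of 4] eq[of 5]
      by (simp add: I_def split: option.splits)
  next
    case (4 xs v s')
    have rep': "represents s' (G, k)" using rep 4(3) represents_cong by (auto simp: I_def)
    have v: "v ! j < n" if "j < d" for j using 4(1,2) that by (meson lessThan_iff nth_mem subsetD)
    let ?qs = "map (\<lambda>j. Cell 2 (R (reg j))) [0..<d] @ obs_exprs d"
    let ?bs = "map (\<lambda>q. val q s' \<noteq> 0) ?qs"
    have "val (Cell 2 (R (reg j))) s' \<noteq> 0 \<longleftrightarrow> v ! j \<in> S" if "j < d" for j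
      using 4 v[OF that] that flags by (simp add: I_def holds_tuple_def)
    then have take: "take d ?bs = map (\<lambda>j. v ! j \<in> S) [0..<d]" by (simp add: comp_def)
    have "True \<notin> set (take d ?bs) \<longleftrightarrow> set v \<inter> S = {}"
    proof -
      have "True \<notin> set (map (\<lambda>j. v ! j \<in> S) [0..<d]) \<longleftrightarrow> (\<forall>j<d. v ! j \<notin> S)" by (auto simp: image_iff)
      also have "\<dots> \<longleftrightarrow> set v \<inter> S = {}" using 4(1) by (metis disjoint_iff in_set_conv_nth)
      finally show ?thesis unfolding take .
    qed
    moreover have drop: "drop d ?bs = obs d G v"
      using obs_exprs_eq_obs[OF rep' 4(4,1,2)] by simp
    have "bad_obs d r l (drop d ?bs) \<longleftrightarrow> bad r l G v"
      unfolding drop using bad_iff_bad_obs[OF fin _ 4(1)] 4(2) verts by simp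
    ultimately have P: "True \<notin> set (take d ?bs) \<and> bad_obs d r l (drop d ?bs) \<longleftrightarrow> P v"
      by (auto simp: P_def)
    show ?case unfolding search_step_def
    proof (rule wp_If)
      assume "val (R 4) s' \<noteq> 0"
      then show "wp M Skip (I (xs @ [v])) s'"
        using 4(3) by (intro wp_Skip) (auto simp: I_def find_snoc split: option.splits)
    next
      assume 0: "val (R 4) s' = 0"
      show "wp M (tree ?qs (\<lambda>bs. if True \<notin> set (take d bs) \<and> bad_obs d r l (drop d bs)
        then Seq (Store 4 (Const 0) (Const 1)) (stores 5 Const (\<lambda>j. R (reg j)) d) else Skip)) (I (xs @ [v])) s'"
      proof (rule wp_tree, unfold P, cases "P v")
        case True
        show "wp M (if P v then Seq (Store 4 (Const 0) (Const 1)) (stores 5 Const (\<lambda>j. R (reg j)) d) else Skip)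
           (I (xs @ [v])) s'"
          unfolding if_P[OF True]
        proof (intro wp_Seq wp_Store wp_stores, goal_cases)
          case (4 s'')
          then show ?case using 0 True \<open>I xs s'\<close> \<open>holds_tuple n 0 v s'\<close> \<open>length v = d\<close>
            by (auto simp: I_def find_snoc holds_tuple_def reg_def split: option.splits)
        qed (auto simp: reg_def)
      next
        case False
        then show "wp M (if P v then Seq (Store 4 (Const 0) (Const 1)) (stores 5 Const (\<lambda>j. R (reg j)) d) else Skip)
           (I (xs @ [v])) s'"
          using 4(3) 0 by (auto intro!: wp_Skip simp: I_def find_snoc split: option.splits)
      qed
    qed
  next
    case 5
    then show ?case by (simp add: I_def)
  next
    case 6
    then show ?case using s00 by simp
  qed
  then show ?thesis unfolding search_def
    by (intro wp_Seq wp_Store) (auto elim!: wp_mono simp: I_def pick_def P_def[abs_def] split: option.splits)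
qed

text \<open>The set of vertices deleted along the path \<open>b\<close>: at depth \<open>i\<close>
  the digit \<open>b i\<close> selects an entry of the first bad tuple not yet hit. Once everything
  is hit the set no longer changes.\<close>

fun sim :: "(nat \<Rightarrow> nat) \<Rightarrow> nat \<Rightarrow> nat set" where
  "sim b 0 = {}"
| "sim b (Suc i) = (case pick (sim b i) of None \<Rightarrow> sim b i | Some v \<Rightarrow> insert (v ! b i) (sim b i))"

lemma sim_cong: "(\<And>j. j < i \<Longrightarrow> b j = b' j) \<Longrightarrow> sim b i = sim b' i"
  by (induction i) (auto split: option.splits)

lemma pick_SomeD:
  assumes "pick S = Some v"
  shows "length v = d \<and> set v \<subseteq> {..<n} \<and> bad r l G v \<and> set v \<inter> S = {}"
proof -
  obtain i where "i < length (tups n d)" "v = tups n d ! i" "bad r l G v" "set v \<inter> S = {}"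
    using assms by (auto simp: pick_def find_Some_iff)
  moreover from this have "v \<in> set (tups n d)" by simp
  ultimately show ?thesis by (simp add: set_tups)
qed

lemma pick_None_iff:
  "pick S = None \<longleftrightarrow> (\<forall>v. length v = d \<and> set v \<subseteq> {..<n} \<and> bad r l G v \<longrightarrow> set v \<inter> S \<noteq> {})"
  unfolding pick_def find_None_iff set_tups by auto

text \<open>A path collects at most one vertex per step, which gives the hitting set. Conversely
  \<open>S\<close> guides the path: each unhit bad tuple has an entry in \<open>S\<close>, and that
  entry is new. After \<open>k\<close> steps either nothing remains to be hit or all of
  \<open>S\<close> has been collected.\<close>

lemma branching_iff_hitting_set:
  "(\<exists>b. (\<forall>i<k. b i < d) \<and> pick (sim b k) = None) \<longleftrightarrow> (\<exists>S\<subseteq>{..<n}. card S \<le> k \<and>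
    (\<forall>v. length v = d \<and> set v \<subseteq> {..<n} \<and> bad r l G v \<longrightarrow> set v \<inter> S \<noteq> {}))"
proof
  assume "\<exists>b. (\<forall>i<k. b i < d) \<and> pick (sim b k) = None"
  then obtain b where b: "\<forall>i<k. b i < d" "pick (sim b k) = None" by blast
  have "sim b i \<subseteq> {..<n} \<and> card (sim b i) \<le> i" if "i \<le> k" for i
    using that
  proof (induction i)
    case (Suc i)
    have "v ! b i < n" if "pick (sim b i) = Some v" for v
    proof -
      have "v ! b i \<in> set v" using pick_SomeD[OF that] b(1) Suc.prems by simp
      then show ?thesis using pick_SomeD[OF that] by auto
    qed
    moreover have "card (insert x (sim b i)) \<le> Suc i" for x
    proof -
      have "card (insert x (sim b i)) \<le> Suc (card (sim b i))"
        by (rule card_insert_le_m1) simp_all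
      then show ?thesis using Suc by simp
    qed
    ultimately show ?case using Suc by (auto split: option.splits)
  qed simp
  then show "\<exists>S\<subseteq>{..<n}. card S \<le> k \<and>
    (\<forall>v. length v = d \<and> set v \<subseteq> {..<n} \<and> bad r l G v \<longrightarrow> set v \<inter> S \<noteq> {})"
    using b(2) unfolding pick_None_iff by (intro exI[of _ "sim b k"]) simp
next
  assume "\<exists>S\<subseteq>{..<n}. card S \<le> k \<and>
    (\<forall>v. length v = d \<and> set v \<subseteq> {..<n} \<and> bad r l G v \<longrightarrow> set v \<inter> S \<noteq> {})"
  then obtain S where S: "S \<subseteq> {..<n}" "card S \<le> k"
    "\<And>v. length v = d \<Longrightarrow> set v \<subseteq> {..<n} \<Longrightarrow> bad r l G v \<Longrightarrow> set v \<inter> S \<noteq> {}" by blast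
  have finS: "finite S" using S(1) finite_subset by blast
  have "\<exists>b. (\<forall>j<i. b j < d) \<and> sim b i \<subseteq> S \<and> (pick (sim b i) = None \<or> card (sim b i) = i)" for i
  proof (induction i)
    case 0
    then show ?case by simp
  next
    case (Suc i)
    then obtain b where b: "\<forall>j<i. b j < d" "sim b i \<subseteq> S" "pick (sim b i) = None \<or> card (sim b i) = i"
      by blast
    have same: "sim (b(i := m)) i = sim b i" for m by (rule sim_cong) simp
    show ?case
    proof (cases "pick (sim b i)")
      case None
      \<comment> \<open>Any digit would do once nothing is left to hit; \<open>0\<close> is a legal
        one because \<open>d > 0\<close>.\<close>
      then have "sim (b(i := 0)) (Suc i) = sim b i" by (simp only: sim.simps same option.case)
      moreover have "\<forall>j<Suc i. (b(i := 0)) j < d" using b(1) d_pos by (simp add: less_Suc_eq)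
      ultimately show ?thesis using b(2) None by metis
    next
      case (Some v)
      then have v: "length v = d" "set v \<inter> S \<noteq> {}" "set v \<inter> sim b i = {}"
        using pick_SomeD[OF Some] S(3)[of v] by auto
      then obtain m where m: "m < d" "v ! m \<in> S" by (metis disjoint_iff in_set_conv_nth)
      then have "v ! m \<notin> sim b i" using v nth_mem by blast
      moreover have "finite (sim b i)" using b(2) finS finite_subset by blast
      moreover have step: "sim (b(i := m)) (Suc i) = insert (v ! m) (sim b i)"
        using Some by (simp only: sim.simps same option.case fun_upd_same)
      moreover have "\<forall>j<Suc i. (b(i := m)) j < d" using b(1) m(1) by (simp add: less_Suc_eq)
      moreover have "card (sim b i) = i" using b(3) Some by simp
      ultimately have "card (sim (b(i := m)) (Suc i)) = Suc i" "sim (b(i := m)) (Suc i) \<subseteq> S"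
        unfolding step using b(2) m(2) by simp_all
      then show ?thesis using \<open>\<forall>j<Suc i. (b(i := m)) j < d\<close> by blast
    qed
  qed
  then obtain b where b: "\<forall>j<k. b j < d" "sim b k \<subseteq> S" "pick (sim b k) = None \<or> card (sim b k) = k"
    by blast
  have "pick (sim b k) = None"
  proof (cases "card (sim b k) = k")
    case True
    then have "sim b k = S" using b(2) S(2) finS by (metis card_seteq)
    then show ?thesis using S(3) by (simp add: pick_None_iff)
  qed (use b in auto)
  then show "\<exists>b. (\<forall>i<k. b i < d) \<and> pick (sim b k) = None" using b(1) by blast
qed

end

section \<open>The counter in base \<open>d\<close>\<close>

lemma digit_sum_less: "(\<And>i. i < k \<Longrightarrow> b i < d) \<Longrightarrow> (\<Sum>i<k. b i * d ^ i) < (d :: nat) ^ k"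
proof (induction k)
  case (Suc k)
  have "Suc (b k) * d ^ k \<le> d * d ^ k" using Suc.prems[of k] by (intro mult_le_mono1) simp
  then show ?case using Suc by (simp add: less_Suc_eq)
qed simp

text \<open>The leading digit is the quotient by its place value. Uniqueness lets the counter value
  identify the path, so that each round adds one path to those examined.\<close>

lemma digits_unique:
  assumes "\<And>i. i < k \<Longrightarrow> b i < d" "\<And>i. i < k \<Longrightarrow> b' i < d"
    and "(\<Sum>i<k. b i * d ^ i) = (\<Sum>i<k. b' i * (d :: nat) ^ i)" "j < k"
  shows "b j = b' j"
  using assms
proof (induction k)
  case (Suc k)
  have less: "(\<Sum>i<k. b i * d ^ i) < d ^ k" "(\<Sum>i<k. b' i * d ^ i) < d ^ k"
    using Suc.prems by (auto intro!: digit_sum_less)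
  then have nz: "d ^ k \<noteq> 0" by linarith
  have "b k = ((\<Sum>i<k. b i * d ^ i) + b k * d ^ k) div d ^ k"
    using less unfolding div_mult_self1[OF nz] by simp
  also have "\<dots> = ((\<Sum>i<k. b' i * d ^ i) + b' k * d ^ k) div d ^ k" using Suc.prems(3) by simp
  also have "\<dots> = b' k" using less unfolding div_mult_self1[OF nz] by simp
  finally have "b k = b' k" .
  then show ?case using Suc by (cases "j = k") auto
qed simp

text \<open>The old term is added on the left, since a subtraction on the right would
  truncate.\<close>

lemma digit_sum_upd:
  "i < k \<Longrightarrow> (\<Sum>j<k. (f(i := x)) j * d ^ j) + f i * (d :: nat) ^ i = (\<Sum>j<k. f j * d ^ j) + x * d ^ i"
  by (simp add: sum.remove[of "{..<k}" i])

text \<open>Invariant: the digit value plus the carry times \<open>d ^ i\<close> is the initial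
  value plus one, where \<open>i\<close> is the place reached.\<close>

lemma wp_increment:
  assumes kM: "k \<le> M" and k: "s 0 1 = k" and dig: "\<And>j. j < k \<Longrightarrow> s 3 j < d"
  shows "wp M (increment d) (\<lambda>s'. (\<forall>j<k. s' 3 j < d) \<and> (\<forall>j\<ge>k. s' 3 j = s 3 j) \<and> s' 7 0 \<le> 1 \<and>
    (\<Sum>j<k. s' 3 j * d ^ j) + s' 7 0 * d ^ k = Suc (\<Sum>j<k. s 3 j * d ^ j)) s"
  unfolding increment_def
proof (intro wp_Seq wp_Store)
  define I where "I i s' \<longleftrightarrow> (\<forall>j<k. s' 3 j < d) \<and> (\<forall>j\<ge>k. s' 3 j = s 3 j) \<and> s' 7 0 \<le> 1 \<and>
    (\<Sum>j<k. s' 3 j * d ^ j) + s' 7 0 * d ^ i = Suc (\<Sum>j<k. s 3 j * d ^ j)" for i and s' :: state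
  let ?s = "s(7 := (s 7)(val (Const 0) s := val (Const 1) s))"
  show "wp M (For 10 (Cell 0 (Const 1)) (If (R 7)
        (If (Sub (Const d) (Add (Cell 3 (R 10)) (Const 1)))
          (Seq (Store 3 (R 10) (Add (Cell 3 (R 10)) (Const 1))) (Store 7 (Const 0) (Const 0)))
          (Store 3 (R 10) (Const 0)))
        Skip)) (\<lambda>s'. (\<forall>j<k. s' 3 j < d) \<and> (\<forall>j\<ge>k. s' 3 j = s 3 j) \<and> s' 7 0 \<le> 1 \<and>
    (\<Sum>j<k. s' 3 j * d ^ j) + s' 7 0 * d ^ k = Suc (\<Sum>j<k. s 3 j * d ^ j)) ?s"
  proof (rule wp_For[where I = I and N = k, OF kM], goal_cases)
    case 1
    show ?case by simp
  next
    case 2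
    show ?case using dig by (simp add: I_def)
  next
    case (3 i s')
    then show ?case using k by simp
  next
    case (4 i s')
    note I = \<open>I i s'\<close> and ri = \<open>s' 10 0 = i\<close> and ik = \<open>i < k\<close>
    have dk: "s' 3 i < d" using I ik by (simp add: I_def)
    show ?case
    proof (intro wp_If wp_Skip wp_Seq wp_Store)
      assume carry: "val (R 7) s' \<noteq> 0" and "val (Sub (Const d) (Add (Cell 3 (R 10)) (Const 1))) s' \<noteq> 0"
      then have less: "Suc (s' 3 i) < d" and c1: "s' 7 0 = 1" using ri I by (auto simp: I_def)
      show "I (Suc i) ((s'(3 := (s' 3)(val (R 10) s' := val (Add (Cell 3 (R 10)) (Const 1)) s'),
          7 := ((s'(3 := (s' 3)(val (R 10) s' := val (Add (Cell 3 (R 10)) (Const 1)) s'))) 7)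
            (val (Const 0) (s'(3 := (s' 3)(val (R 10) s' := val (Add (Cell 3 (R 10)) (Const 1)) s'))) :=
             val (Const 0) (s'(3 := (s' 3)(val (R 10) s' := val (Add (Cell 3 (R 10)) (Const 1)) s'))))))
          (10 := ((s'(3 := (s' 3)(val (R 10) s' := val (Add (Cell 3 (R 10)) (Const 1)) s'),
          7 := ((s'(3 := (s' 3)(val (R 10) s' := val (Add (Cell 3 (R 10)) (Const 1)) s'))) 7)
            (val (Const 0) (s'(3 := (s' 3)(val (R 10) s' := val (Add (Cell 3 (R 10)) (Const 1)) s'))) :=
             val (Const 0) (s'(3 := (s' 3)(val (R 10) s' := val (Add (Cell 3 (R 10)) (Const 1)) s'))))))
             10)(0 := Suc i)))"
        using I less c1 ik ri digit_sum_upd[OF ik, of "s' 3" "Suc (s' 3 i)" d]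
        unfolding I_def by (auto simp: fun_upd_def[of _ i])
    next
      assume carry: "val (R 7) s' \<noteq> 0" and "val (Sub (Const d) (Add (Cell 3 (R 10)) (Const 1))) s' = 0"
      then have eq: "d = Suc (s' 3 i)" and c1: "s' 7 0 = 1" using ri I dk by (auto simp: I_def)
      \<comment> \<open>The digit wraps from \<open>d - 1\<close> to \<open>0\<close>; what it
        loses, together with the old carry, is the carry at the next place.\<close>
      have "d ^ Suc i = d ^ i + s' 3 i * d ^ i" by (subst (1) power_Suc, subst (1) eq) simp
      then show "I (Suc i) ((s'(3 := (s' 3)(val (R 10) s' := val (Const 0) s')))
          (10 := ((s'(3 := (s' 3)(val (R 10) s' := val (Const 0) s'))) 10)(0 := Suc i)))"
        using I dk c1 ik ri digit_sum_upd[OF ik, of "s' 3" 0 d]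
        unfolding I_def by (auto simp: fun_upd_def[of _ i])
    next
      assume "val (R 7) s' = 0"
      then show "I (Suc i) (s'(10 := (s' 10)(0 := Suc i)))" using I by (simp add: I_def)
    qed
  next
    case (5 s')
    then show ?case by (simp add: I_def)
  qed
qed

lemma wp_clear:
  assumes "n \<le> M" "s 0 0 = n"
  shows "wp M clear (\<lambda>s'. \<forall>x<n. s' 2 x = 0) s"
  unfolding clear_def
proof (rule wp_For[where I = "\<lambda>i s'. \<forall>x<i. s' 2 x = 0" and N = n, OF assms(1)], goal_cases)
  case (4 i s')
  then show ?case by (intro wp_Store) (auto simp: less_Suc_eq)
qed (use assms in auto)

section \<open>Correctness and running time of the branching algorithm\<close>

context tuple_graph
begin

text \<open>\<open>sim (s 3) i\<close> is the set flagged before search number \<open>i\<close>,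
  while array \<open>4\<close> reports on the last search done. Hence the invariant speaks of
  \<open>i - 1\<close>, and a report on \<open>sim (s 3) k\<close> takes \<open>k + 1\<close>
  rounds, the last of which also reads the digit at place \<open>k\<close>.\<close>

lemma wp_branch:
  assumes n: "n \<le> M" and kM: "k + 1 \<le> M" and rep: "represents s (G, k)"
    and flags: "\<And>x. x < n \<Longrightarrow> s 2 x = 0" and dig: "\<And>i. i \<le> k \<Longrightarrow> s 3 i < d"
  shows "wp M (branch d r l) (\<lambda>s'. s' 4 0 = 0 \<longleftrightarrow> pick (sim (s 3) k) = None) s"
  unfolding branch_def
proof (rule wp_For[where N = "k + 1" and I = "\<lambda>i s'. (\<forall>x<n. s' 2 x \<noteq> 0 \<longleftrightarrow> x \<in> sim (s 3) i) \<and>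
    (i > 0 \<longrightarrow> (s' 4 0 = 0 \<longleftrightarrow> pick (sim (s 3) (i - 1)) = None))", OF kM], goal_cases)
  case 1
  show ?case using writes_search[of d r l] by (auto simp: reg_def)
next
  case 2
  show ?case using flags by simp
next
  case (3 i s')
  have "s' 0 = s 0" using notin_writes_search[of 0 d r l] by (intro 3(4)) auto
  then show ?case using rep by (simp add: represents_def Let_def)
next
  case (4 i s')
  have same: "s' x = s x" if "x \<in> {0, 1, 3}" for x
    using that writes_search[of d r l] by (intro 4(4)) (auto simp: reg_def)
  have rep': "represents s' (G, k)" using rep same by (intro represents_cong[OF _ _ rep]) auto
  show ?case
  proof (rule wp_Seq, rule wp_frame[OF wp_search[OF n rep', of "sim (s 3) i"]])
    fix x assume "x < n"
    then show "s' 2 x \<noteq> 0 \<longleftrightarrow> x \<in> sim (s 3) i" using 4(2) by simp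
  next
    fix s'' assume found: "case pick (sim (s 3) i) of None \<Rightarrow> s'' 4 0 = 0
      | Some v \<Rightarrow> s'' 4 0 = 1 \<and> (\<forall>j<d. s'' 5 j = v ! j)"
      and fr: "\<And>a. a \<notin> writes (search d r l) \<Longrightarrow> s'' a = s' a"
    have same': "s'' x = s' x" if "x \<in> {2, 3, 6}" for x
      using that writes_search[of d r l] by (intro fr) (auto simp: reg_def)
    have dig': "s 3 i < d" using 4(1) dig by simp
    show "wp M (If (R 4) (Store 2 (Cell 5 (Cell 3 (R 6))) (Const 1)) Skip)
      (\<lambda>s'. (\<forall>x<n. (s'(6 := (s' 6)(0 := Suc i))) 2 x \<noteq> 0 \<longleftrightarrow> x \<in> sim (s 3) (Suc i)) \<and>
        (Suc i > 0 \<longrightarrow> ((s'(6 := (s' 6)(0 := Suc i))) 4 0 = 0 \<longleftrightarrow> pick (sim (s 3) (Suc i - 1)) = None))) s''"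
    proof (intro wp_If wp_Store wp_Skip)
      assume "val (R 4) s'' \<noteq> 0"
      then obtain v where v: "pick (sim (s 3) i) = Some v" "\<forall>j<d. s'' 5 j = v ! j" "s'' 4 0 = 1"
        using found by (auto split: option.splits)
      have "val (Cell 5 (Cell 3 (R 6))) s'' = v ! s 3 i"
        using v(2) dig' same'[of 6] same'[of 3] same[of 3] 4(3) by simp
      then show "(\<forall>x<n. ((s''(2 := (s'' 2)(val (Cell 5 (Cell 3 (R 6))) s'' := val (Const 1) s'')))
          (6 := ((s''(2 := (s'' 2)(val (Cell 5 (Cell 3 (R 6))) s'' := val (Const 1) s''))) 6)(0 := Suc i))) 2 x \<noteq> 0
            \<longleftrightarrow> x \<in> sim (s 3) (Suc i)) \<and>
        (Suc i > 0 \<longrightarrow> (((s''(2 := (s'' 2)(val (Cell 5 (Cell 3 (R 6))) s'' := val (Const 1) s'')))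
          (6 := ((s''(2 := (s'' 2)(val (Cell 5 (Cell 3 (R 6))) s'' := val (Const 1) s''))) 6)(0 := Suc i))) 4 0 = 0
            \<longleftrightarrow> pick (sim (s 3) (Suc i - 1)) = None))"
        using 4(2) v same'[of 2] by (simp del: val.simps(2))
    next
      assume "val (R 4) s'' = 0"
      then have "pick (sim (s 3) i) = None" "s'' 4 0 = 0"
        using found by (auto split: option.splits)
      then show "(\<forall>x<n. (s''(6 := (s'' 6)(0 := Suc i))) 2 x \<noteq> 0 \<longleftrightarrow> x \<in> sim (s 3) (Suc i)) \<and>
        (Suc i > 0 \<longrightarrow> ((s''(6 := (s'' 6)(0 := Suc i))) 4 0 = 0 \<longleftrightarrow> pick (sim (s 3) (Suc i - 1)) = None))"
        using 4(2) same'[of 2] by simp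
    qed
  qed
next
  case (5 s')
  then show ?case by simp
qed

text \<open>\<open>c\<close> is both the number of finished rounds and the value of the counter
  including its carry. Paths are numbered by that value, and the answer so far covers the paths
  numbered below \<open>c\<close>.\<close>

definition fpt_inv :: "nat \<Rightarrow> nat \<Rightarrow> state \<Rightarrow> bool" where
  "fpt_inv k c s \<longleftrightarrow> represents s (G, k) \<and> (\<forall>j<k. s 3 j < d) \<and> (\<forall>j\<ge>k. s 3 j = 0) \<and> s 7 0 \<le> 1 \<and>
     (\<Sum>j<k. s 3 j * d ^ j) + s 7 0 * d ^ k = c \<and>
     s 9 0 = (if \<exists>b. (\<forall>i<k. b i < d) \<and> (\<Sum>j<k. b j * d ^ j) < c \<and> pick (sim b k) = None then 1 else 0)"

lemma wp_fpt_round: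
  assumes k: "k < n" and c: "c < d ^ k" and inv: "fpt_inv k c s"
  shows "s 7 0 = 0 \<and> wp n (fpt_round d r l) (fpt_inv k (Suc c)) s"
proof
  \<comment> \<open>A set carry alone would contribute \<open>d ^ k\<close>.\<close>
  show c0: "s 7 0 = 0" using inv c by (auto simp: fpt_inv_def le_Suc_eq)
  have rep: "represents s (G, k)" and dig: "\<forall>j<k. s 3 j < d" "\<forall>j\<ge>k. s 3 j = 0"
    using inv by (auto simp: fpt_inv_def)
  have sum: "(\<Sum>j<k. s 3 j * d ^ j) = c" using inv c0 by (simp add: fpt_inv_def)
  have s0: "s 0 0 = n" "s 0 1 = k" using rep by (auto simp: represents_def card_verts Let_def)
  have dig': "s 3 i < d" if "i \<le> k" for i using dig d_pos that by (cases "i < k") auto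
  have ans: "s 9 0 = (if \<exists>b. (\<forall>i<k. b i < d) \<and> (\<Sum>j<k. b j * d ^ j) < c \<and> pick (sim b k) = None then 1 else 0)"
    using inv by (simp add: fpt_inv_def)
  \<comment> \<open>The current digits are the only path numbered \<open>c\<close>, up to places
    from \<open>k\<close> on, which \<open>sim\<close> does not read.\<close>
  have new: "(\<exists>b. (\<forall>i<k. b i < d) \<and> (\<Sum>j<k. b j * d ^ j) < Suc c \<and> pick (sim b k) = None) \<longleftrightarrow>
    (\<exists>b. (\<forall>i<k. b i < d) \<and> (\<Sum>j<k. b j * d ^ j) < c \<and> pick (sim b k) = None) \<or> pick (sim (s 3) k) = None"
  proof -
    have "sim b k = sim (s 3) k" if "\<forall>i<k. b i < d" "(\<Sum>j<k. b j * d ^ j) = c" for b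
      by (rule sim_cong, rule digits_unique[of k b d "s 3"]) (use that dig sum in auto)
    note same = this
    show ?thesis
    proof
      assume "\<exists>b. (\<forall>i<k. b i < d) \<and> (\<Sum>j<k. b j * d ^ j) < Suc c \<and> pick (sim b k) = None"
      then obtain b where b: "\<forall>i<k. b i < d" "(\<Sum>j<k. b j * d ^ j) < Suc c" "pick (sim b k) = None"
        by auto
      show "(\<exists>b. (\<forall>i<k. b i < d) \<and> (\<Sum>j<k. b j * d ^ j) < c \<and> pick (sim b k) = None) \<or> pick (sim (s 3) k) = None"
      proof (cases "(\<Sum>j<k. b j * d ^ j) = c")
        case True
        then show ?thesis using b same[of b] by simp
      next
        case False
        then have "(\<Sum>j<k. b j * d ^ j) < c" using b(2) by linarith
        then show ?thesis using b by auto
      qed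
    next
      assume "(\<exists>b. (\<forall>i<k. b i < d) \<and> (\<Sum>j<k. b j * d ^ j) < c \<and> pick (sim b k) = None) \<or> pick (sim (s 3) k) = None"
      then show "\<exists>b. (\<forall>i<k. b i < d) \<and> (\<Sum>j<k. b j * d ^ j) < Suc c \<and> pick (sim b k) = None"
      proof
        assume "pick (sim (s 3) k) = None"
        then show ?thesis using dig(1) sum by (intro exI[of _ "s 3"]) simp
      qed (auto intro: less_SucI)
    qed
  qed
  have wcl: "writes clear = {2, 8}" by (auto simp: clear_def)
  have wbr: "x \<notin> writes (branch d r l)" if "x \<in> {0, 1, 3, 7, 9}" for x
    using that writes_search[of d r l] by (auto simp: branch_def reg_def)
  have winc: "writes (increment d) = {3, 7, 10}" by (auto simp: increment_def)
  show "wp n (fpt_round d r l) (fpt_inv k (Suc c)) s"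
    unfolding fpt_round_def
  proof (rule wp_Seq, rule wp_frame[OF wp_clear[where n = n and s = s, OF order_refl s0(1)]])
    fix s1 assume cl: "\<forall>x<n. s1 2 x = 0" and fr1: "\<And>a. a \<notin> writes clear \<Longrightarrow> s1 a = s a"
    have s1: "s1 x = s x" if "x \<in> {0, 1, 3, 7, 9}" for x using that by (intro fr1) (auto simp: wcl)
    have rep1: "represents s1 (G, k)" by (rule represents_cong[OF _ _ rep]) (simp_all add: s1)
    show "wp n (Seq (branch d r l) (Seq (If (R 4) Skip (Store 9 (Const 0) (Const 1))) (increment d)))
      (fpt_inv k (Suc c)) s1"
    proof (rule wp_Seq, rule wp_frame[OF wp_branch[OF order_refl _ rep1]])
      fix s2 assume br: "s2 4 0 = 0 \<longleftrightarrow> pick (sim (s1 3) k) = None"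
        and fr2: "\<And>a. a \<notin> writes (branch d r l) \<Longrightarrow> s2 a = s1 a"
      have s2: "s2 x = s x" if "x \<in> {0, 1, 3, 7, 9}" for x using that s1 wbr fr2 by simp
      let ?a = "if \<exists>b. (\<forall>i<k. b i < d) \<and> (\<Sum>j<k. b j * d ^ j) < Suc c \<and> pick (sim b k) = None then 1 else 0"
      have "wp n (If (R 4) Skip (Store 9 (Const 0) (Const 1))) (\<lambda>s3. s3 9 0 = ?a) s2"
        using br s1[of 3] s2[of 9] ans unfolding new by (intro wp_If wp_Skip wp_Store) auto
      then show "wp n (Seq (If (R 4) Skip (Store 9 (Const 0) (Const 1))) (increment d)) (fpt_inv k (Suc c)) s2"
      proof (intro wp_Seq, elim wp_frame)
        fix s3 assume a3: "s3 9 0 = ?a"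
          and fr3: "\<And>a. a \<notin> writes (If (R 4) Skip (Store 9 (Const 0) (Const 1))) \<Longrightarrow> s3 a = s2 a"
        have s3: "s3 x = s x" if "x \<in> {0, 1, 3, 7}" for x using that s2[of x] fr3[of x] by auto
        show "wp n (increment d) (fpt_inv k (Suc c)) s3"
        proof (rule wp_frame[OF wp_increment[of k]])
          fix s4 assume inc: "(\<forall>j<k. s4 3 j < d) \<and> (\<forall>j\<ge>k. s4 3 j = s3 3 j) \<and> s4 7 0 \<le> 1 \<and>
            (\<Sum>j<k. s4 3 j * d ^ j) + s4 7 0 * d ^ k = Suc (\<Sum>j<k. s3 3 j * d ^ j)"
            and fr4: "\<And>a. a \<notin> writes (increment d) \<Longrightarrow> s4 a = s3 a"
          have s4: "s4 x = s3 x" if "x \<in> {0, 1, 9}" for x using that by (intro fr4) (auto simp: winc)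
          have "represents s4 (G, k)" by (rule represents_cong[OF _ _ rep]) (simp_all add: s4 s3)
          then show "fpt_inv k (Suc c) s4"
            using inc a3 s4[of 9] s3[of 3] dig(2) sum by (simp add: fpt_inv_def)
        qed (use k s3[of 0] s3[of 3] s0 dig in auto)
      qed
    qed (use k cl s1[of 3] dig' in auto)
  qed
qed

text \<open>A round is analysed with loop bound \<open>n\<close>, which \<open>k < n\<close> permits
  since \<open>branch\<close> makes \<open>k + 1\<close> rounds. The \<open>d ^ k\<close> rounds of
  the outer loop are counted separately.\<close>

lemma exec_fpt_prog:
  assumes x: "(G, k) \<in> instances C"
  shows "\<exists>t s. exec (fpt_prog d r l) (input_state (G, k)) t s \<and>
    t \<le> (20 + sz (fpt_round d r l) * 2 ^ (2 * d)) * d ^ k * max 1 n ^ (2 * d) \<and>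
    s 0 0 = (if \<exists>S\<subseteq>{..<n}. card S \<le> k \<and>
      (\<forall>v. length v = d \<and> set v \<subseteq> {..<n} \<and> bad r l G v \<longrightarrow> set v \<inter> S \<noteq> {}) then 1 else 0)"
proof -
  define s where "s = input_state (G, k)"
  define T where "T = sz (fpt_round d r l) * (n + 1) ^ depth (fpt_round d r l)"
  \<comment> \<open>\<open>20 = 5 + 15\<close>: each round pays \<open>5\<close> steps for the loop
    condition, and \<open>15\<close> are spent once, on the outer condition, the last loop test and
    the final store. The factor \<open>2 ^ (2 * d)\<close> comes from
    \<open>n + 1 \<le> 2 * max 1 n\<close>.\<close>
  define A where "A = 20 + sz (fpt_round d r l) * 2 ^ (2 * d)"
  have rep: "represents s (G, k)" unfolding s_def using x by (rule represents_input_state)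
  then have s0: "s 0 0 = n" "s 0 1 = k" by (auto simp: represents_def card_verts Let_def)
  have zero: "s a i = 0" if "a > 1" for a i using that by (simp add: s_def input_state_def Let_def)
  have dk: "d ^ k \<ge> 1" using d_pos by simp
  have mn: "max 1 n ^ (2 * d) \<ge> 1" by simp
  have A20: "20 \<le> A * d ^ k * max 1 n ^ (2 * d)"
  proof -
    have "20 * 1 * 1 \<le> A * d ^ k * max 1 n ^ (2 * d)"
      by (intro mult_le_mono dk mn) (simp add: A_def)
    then show ?thesis by simp
  qed
  show ?thesis
  proof (cases "k < n")
    case False
    \<comment> \<open>Deleting all vertices is affordable, and it hits every tuple because tuples
      are nonempty.\<close>
    have "set v \<inter> {..<n} \<noteq> {}" if "length v = d" "set v \<subseteq> {..<n}" for v
      using that d_pos by (cases v) auto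
    then have "\<exists>S\<subseteq>{..<n}. card S \<le> k \<and>
      (\<forall>v. length v = d \<and> set v \<subseteq> {..<n} \<and> bad r l G v \<longrightarrow> set v \<inter> S \<noteq> {})"
      using False by (intro exI[of _ "{..<n}"]) simp
    moreover have "val (Sub (R 0) (Cell 0 (Const 1))) s = 0" using s0 False by simp
    from exec.If_false[OF this exec.Store]
    have "exec (fpt_prog d r l) s (1 + cost (Sub (R 0) (Cell 0 (Const 1))) + (1 + cost (Const 0) + cost (Const 1)))
      (s(0 := (s 0)(val (Const 0) s := val (Const 1) s)))"
      unfolding fpt_prog_def by blast
    ultimately show ?thesis unfolding s_def[symmetric] A_def[symmetric] using A20
      by (intro exI conjI) (assumption, simp_all)
  next
    case True
    have init: "fpt_inv k 0 s" using rep zero d_pos by (simp add: fpt_inv_def)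
    have "\<exists>t s'. exec (While (Sub (Const 1) (R 7)) (fpt_round d r l)) s t s' \<and>
      t \<le> d ^ k * (1 + cost (Sub (Const 1) (R 7)) + T) + 1 + cost (Sub (Const 1) (R 7)) \<and> fpt_inv k (d ^ k) s'"
    proof (rule exec_While_rounds[where I = "fpt_inv k", OF init])
      fix i s' assume "i < d ^ k" "fpt_inv k i s'"
      from wp_fpt_round[OF True this] show "val (Sub (Const 1) (R 7)) s' \<noteq> 0 \<and>
        (\<exists>t s''. exec (fpt_round d r l) s' t s'' \<and> t \<le> T \<and> fpt_inv k (Suc i) s'')"
        by (simp add: wp_def T_def)
    next
      fix s' assume inv: "fpt_inv k (d ^ k) s'"
      \<comment> \<open>The digits alone stay below \<open>d ^ k\<close>, so this counter value
        forces the carry that stops the loop.\<close>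
      then have "(\<Sum>j<k. s' 3 j * d ^ j) < d ^ k" by (auto simp: fpt_inv_def intro!: digit_sum_less)
      moreover have "(\<Sum>j<k. s' 3 j * d ^ j) = d ^ k" if "s' 7 0 = 0"
        using inv that by (simp add: fpt_inv_def)
      ultimately have "s' 7 0 \<noteq> 0" by force
      then show "val (Sub (Const 1) (R 7)) s' = 0" by simp
    qed
    moreover have "cost (Sub (Const 1) (R 7)) = 4" by simp
    ultimately obtain t s' where t: "exec (While (Sub (Const 1) (R 7)) (fpt_round d r l)) s t s'"
      "t \<le> d ^ k * (5 + T) + 5" "fpt_inv k (d ^ k) s'" by (metis (no_types, lifting) add.assoc one_plus_numeral semiring_norm(3))
    have "(\<exists>b. (\<forall>i<k. b i < d) \<and> (\<Sum>j<k. b j * d ^ j) < d ^ k \<and> pick (sim b k) = None) \<longleftrightarrow>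
      (\<exists>b. (\<forall>i<k. b i < d) \<and> pick (sim b k) = None)"
      by (auto intro: digit_sum_less)
    then have ans: "s' 9 0 = (if \<exists>S\<subseteq>{..<n}. card S \<le> k \<and>
      (\<forall>v. length v = d \<and> set v \<subseteq> {..<n} \<and> bad r l G v \<longrightarrow> set v \<inter> S \<noteq> {}) then 1 else 0)"
      using t(3) branching_iff_hitting_set[of k] unfolding fpt_inv_def by presburger
    have "T \<le> sz (fpt_round d r l) * (2 * max 1 n) ^ (2 * d)"
    proof -
      have "(n + 1) ^ depth (fpt_round d r l) \<le> (n + 1) ^ (2 * d)"
        using depth_fpt_round[of d r l] d_pos by (intro power_increasing) auto
      also have "\<dots> \<le> (2 * max 1 n) ^ (2 * d)" by (intro power_mono) auto
      finally show ?thesis by (simp add: T_def)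
    qed
    also have "\<dots> = (A - 20) * max 1 n ^ (2 * d)" by (simp add: A_def power_mult_distrib)
    finally have T: "20 + T \<le> A * max 1 n ^ (2 * d)"
    proof -
      assume "T \<le> (A - 20) * max 1 n ^ (2 * d)"
      moreover have "20 * 1 \<le> 20 * max 1 n ^ (2 * d)" by (intro mult_le_mono2 mn)
      moreover have "20 * max 1 n ^ (2 * d) + (A - 20) * max 1 n ^ (2 * d) = A * max 1 n ^ (2 * d)"
        unfolding add_mult_distrib[symmetric] by (simp add: A_def)
      ultimately show ?thesis by linarith
    qed
    have "1 + 5 + (t + 4) \<le> d ^ k * (5 + T) + 15 * 1" using t(2) by simp
    also have "\<dots> \<le> d ^ k * (5 + T) + 15 * d ^ k" using dk by simp
    also have "\<dots> = d ^ k * (20 + T)" by (simp add: algebra_simps)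
    also have "\<dots> \<le> d ^ k * (A * max 1 n ^ (2 * d))" using T by (rule mult_le_mono2)
    finally have time: "1 + 5 + (t + 4) \<le> A * d ^ k * max 1 n ^ (2 * d)" by (simp add: algebra_simps)
    have "val (Sub (R 0) (Cell 0 (Const 1))) s \<noteq> 0" using s0 True by simp
    from exec.If_true[OF this exec.Seq[OF t(1) exec.Store]]
    have "exec (fpt_prog d r l) s (1 + cost (Sub (R 0) (Cell 0 (Const 1))) + (t + (1 + cost (Const 0) + cost (R 9))))
      (s'(0 := (s' 0)(val (Const 0) s' := val (R 9) s')))"
      unfolding fpt_prog_def by blast
    then show ?thesis unfolding s_def[symmetric] A_def[symmetric] using time ans
      by (intro exI conjI) (assumption, simp_all)
  qed
qed

end

section \<open>Sparsification\<close>

text \<open>A partial tuple is encoded by a full tuple \<open>v\<close> and the set \<open>J\<close>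
  of positions that count; the other entries of \<open>v\<close> are ignored.\<close>

definition agree :: "nat list list \<Rightarrow> nat set \<Rightarrow> nat list \<Rightarrow> nat" where
  "agree L J v = length (filter (\<lambda>u. \<forall>j\<in>J. u ! j = v ! j) L)"

text \<open>\<open>m\<close> is the number of free positions. The pigeonhole argument uses that the
  value is \<open>1\<close> for \<open>m = 0\<close> and exceeds \<open>d * k\<close> times its
  predecessor otherwise.\<close>

definition thr :: "nat \<Rightarrow> nat \<Rightarrow> nat \<Rightarrow> nat" where
  "thr d k m = (d * k + 1) ^ m"

text \<open>The empty \<open>J\<close> limits the number of kept tuples altogether, the full
  \<open>J\<close> excludes duplicates.\<close>

definition keep :: "nat \<Rightarrow> nat \<Rightarrow> nat list list \<Rightarrow> nat list \<Rightarrow> bool" where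
  "keep d k L v \<longleftrightarrow> (\<forall>J\<in>Pow {..<d}. agree L J v < thr d k (d - card J))"

definition sparsify :: "(nat list \<Rightarrow> bool) \<Rightarrow> nat \<Rightarrow> nat \<Rightarrow> nat list list \<Rightarrow> nat list list" where
  "sparsify P d k xs = foldl (\<lambda>L v. if P v \<and> keep d k L v then L @ [v] else L) [] xs"

lemma sparsify_Nil [simp]: "sparsify P d k [] = []"
  and sparsify_snoc: "sparsify P d k (xs @ [v]) = (let L = sparsify P d k xs in
    if P v \<and> keep d k L v then L @ [v] else L)"
  by (simp_all add: sparsify_def Let_def)

lemma set_sparsify: "set (sparsify P d k xs) \<subseteq> {v \<in> set xs. P v}"
  by (induction xs rule: rev_induct) (auto simp: sparsify_snoc Let_def)

text \<open>The count grows only when a kept \<open>u\<close> agrees with \<open>v\<close> on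
  \<open>J\<close>; then it equals the count for \<open>u\<close>, which was below the limit when
  \<open>u\<close> was accepted.\<close>

lemma agree_sparsify_le:
  assumes "J \<subseteq> {..<d}"
  shows "agree (sparsify P d k xs) J v \<le> thr d k (d - card J)"
proof (induction xs rule: rev_induct)
  case (snoc u xs)
  define L where "L = sparsify P d k xs"
  show ?case
  proof (cases "P u \<and> keep d k L u \<and> (\<forall>j\<in>J. u ! j = v ! j)")
    case True
    then have "agree L J u = agree L J v" by (simp add: agree_def)
    moreover have "agree L J u < thr d k (d - card J)" using True assms by (simp add: keep_def)
    ultimately show ?thesis by (simp add: sparsify_snoc L_def[symmetric] agree_def)
  next
    case False
    then show ?thesis using snoc by (auto simp: sparsify_snoc L_def[symmetric] agree_def Let_def)
  qed
qed (simp add: agree_def)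

text \<open>A union bound that counts list entries with multiplicity.\<close>

lemma length_filter_le_sum:
  assumes "finite A" "\<And>x. x \<in> set xs \<Longrightarrow> P x \<Longrightarrow> \<exists>a\<in>A. Q a x"
  shows "length (filter P xs) \<le> (\<Sum>a\<in>A. length (filter (Q a) xs))"
  using assms(2)
proof (induction xs)
  case (Cons x xs)
  then have IH: "length (filter P xs) \<le> (\<Sum>a\<in>A. length (filter (Q a) xs))" by simp
  show ?case
  proof (cases "P x")
    case True
    then obtain a where a: "a \<in> A" "Q a x" using Cons.prems by auto
    have "Suc (\<Sum>a\<in>A. length (filter (Q a) xs)) \<le> (\<Sum>a\<in>A. length (filter (Q a) (x # xs)))"
      using assms(1) a by (intro Suc_leI sum_strict_mono_ex1) auto
    then show ?thesis using True IH by simp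
  next
    case False
    have "(\<Sum>a\<in>A. length (filter (Q a) xs)) \<le> (\<Sum>a\<in>A. length (filter (Q a) (x # xs)))"
      by (intro sum_mono) simp
    then show ?thesis using False IH by simp
  qed
qed simp

text \<open>If a set \<open>S\<close> with at most \<open>k\<close> elements hits every kept tuple but no entry of \<open>v\<close> at the
  positions in \<open>J\<close>, then each kept tuple agreeing with \<open>v\<close> on \<open>J\<close> has an element of \<open>S\<close> at one
  of the other positions; by the pigeonhole principle one of the at most \<open>d * k\<close> extensions
  exceeds its threshold.\<close>

lemma hitting_set_meets_saturated:
  assumes J: "J \<subseteq> {..<d}" and many: "agree L J v \<ge> thr d k (d - card J)"
    and L: "\<And>u. u \<in> set L \<Longrightarrow> length u = d \<and> set u \<inter> S \<noteq> {}"
    and S: "finite S" "card S \<le> k"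
    and le: "\<And>J v. J \<subseteq> {..<d} \<Longrightarrow> agree L J v \<le> thr d k (d - card J)"
    and v: "length v = d"
  shows "\<exists>j\<in>J. v ! j \<in> S"
proof (rule ccontr)
  assume miss: "\<not> ?thesis"
  define A where "A = ({..<d} - J) \<times> S"
  have finJ: "finite J" using J finite_subset by blast
  have cJ: "card J \<le> d" using J card_mono[of "{..<d}" J] by simp
  have finA: "finite A" using S by (simp add: A_def)
  \<comment> \<open>Updating \<open>v\<close> at the position \<open>fst a\<close> and adding that
    position to \<open>J\<close> encodes the partial tuple extended by the vertex
    \<open>snd a\<close>.\<close>
  have "agree L J v \<le> (\<Sum>a\<in>A. length (filter (\<lambda>u. \<forall>j\<in>insert (fst a) J. u ! j = (v[fst a := snd a]) ! j) L))"
    unfolding agree_def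
  proof (rule length_filter_le_sum[OF finA])
    fix u assume u: "u \<in> set L" "\<forall>j\<in>J. u ! j = v ! j"
    then obtain p where p: "p < d" "u ! p \<in> S" using L[OF u(1)] by (metis disjoint_iff in_set_conv_nth)
    then have "p \<notin> J" using miss u(2) by auto
    then show "\<exists>a\<in>A. \<forall>j\<in>insert (fst a) J. u ! j = (v[fst a := snd a]) ! j"
      using p u(2) v by (intro bexI[of _ "(p, u ! p)"]) (auto simp: A_def nth_list_update)
  qed
  also have "\<dots> \<le> (\<Sum>a\<in>A. thr d k (d - card J - 1))"
  proof (rule sum_mono)
    fix a assume a: "a \<in> A"
    then have "card (insert (fst a) J) = Suc (card J)" using finJ by (auto simp: A_def)
    then show "length (filter (\<lambda>u. \<forall>j\<in>insert (fst a) J. u ! j = (v[fst a := snd a]) ! j) L) \<le> thr d k (d - card J - 1)"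
      using le[of "insert (fst a) J" "v[fst a := snd a]"] a J by (auto simp: agree_def A_def)
  qed
  also have "\<dots> = (d - card J) * card S * thr d k (d - card J - 1)"
    using finJ J by (simp add: A_def card_cartesian_product card_Diff_subset)
  finally have *: "agree L J v \<le> (d - card J) * card S * thr d k (d - card J - 1)" .
  show False
  proof (cases "card J = d")
    \<comment> \<open>Without free positions the sum is empty, but the limit is
      \<open>1\<close>.\<close>
    case True
    then show False using * many by (simp add: thr_def)
  next
    case False
    then obtain m where m: "d - card J = Suc m" using cJ by (metis Suc_diff_Suc le_neq_implies_less)
    have "(d - card J) * card S * thr d k m \<le> d * k * thr d k m"
      using S(2) by (intro mult_le_mono) auto
    also have "\<dots> < thr d k (Suc m)" by (simp add: thr_def)
    finally show False using * many m by simp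
  qed
qed

text \<open>When \<open>v\<close> was examined it was either kept or rejected because of some
  saturated \<open>J\<close>. Counts only grow afterwards, so \<open>J\<close> is still saturated at
  the end and \<open>S\<close> meets \<open>v\<close> at a position in \<open>J\<close>.\<close>

lemma sparsify_hitting:
  assumes xs: "\<And>v. v \<in> set xs \<Longrightarrow> length v = d"
    and S: "finite S" "card S \<le> k"
    and hit: "\<And>u. u \<in> set (sparsify P d k xs) \<Longrightarrow> set u \<inter> S \<noteq> {}"
    and v: "v \<in> set xs" "P v"
  shows "set v \<inter> S \<noteq> {}"
proof -
  define L where "L = sparsify P d k xs"
  have "v \<in> set (sparsify P d k ys) \<or> (\<exists>J\<subseteq>{..<d}. agree (sparsify P d k ys) J v \<ge> thr d k (d - card J))"
    if "v \<in> set ys" for ys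
    using that
  proof (induction ys rule: rev_induct)
    case (snoc u ys)
    have mono: "agree (sparsify P d k ys) J v \<le> agree (sparsify P d k (ys @ [u])) J v" for J
      by (simp add: sparsify_snoc Let_def agree_def)
    have sub: "set (sparsify P d k ys) \<subseteq> set (sparsify P d k (ys @ [u]))"
      by (auto simp: sparsify_snoc Let_def)
    show ?case
    proof (cases "v \<in> set ys")
      case True
      then show ?thesis using snoc.IH mono sub by (meson le_trans subsetD)
    next
      case False
      then have uv: "u = v" using snoc.prems by simp
      show ?thesis
      proof (cases "keep d k (sparsify P d k ys) v")
        case True
        then show ?thesis using uv v(2) by (simp add: sparsify_snoc)
      next
        case False
        then obtain J where "J \<subseteq> {..<d}" "agree (sparsify P d k ys) J v \<ge> thr d k (d - card J)"
          by (auto simp: keep_def not_less)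
        then show ?thesis using mono le_trans by blast
      qed
    qed
  qed simp
  then have "v \<in> set L \<or> (\<exists>J\<subseteq>{..<d}. agree L J v \<ge> thr d k (d - card J))"
    using v(1) by (simp add: L_def)
  then show ?thesis
  proof
    assume "v \<in> set L"
    then show ?thesis using hit by (simp add: L_def)
  next
    assume "\<exists>J\<subseteq>{..<d}. agree L J v \<ge> thr d k (d - card J)"
    then obtain J where J: "J \<subseteq> {..<d}" "agree L J v \<ge> thr d k (d - card J)" by blast
    have "length u = d \<and> set u \<inter> S \<noteq> {}" if "u \<in> set L" for u
      using that hit set_sparsify[of P d k xs] xs by (auto simp: L_def)
    then have "\<exists>j\<in>J. v ! j \<in> S"
      using hitting_set_meets_saturated[OF J _ S _ xs[OF v(1)]] agree_sparsify_le
      unfolding L_def by blast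
    then obtain j where "j \<in> J" "v ! j \<in> S" by blast
    moreover from this have "j < length v" using J(1) xs[OF v(1)] by auto
    ultimately show ?thesis by (metis disjoint_iff nth_mem)
  qed
qed

lemma card_vertices_sparsify:
  assumes "\<And>v. v \<in> set xs \<Longrightarrow> length v = d"
  shows "card (\<Union>v\<in>set (sparsify P d k xs). set v) \<le> d * thr d k d"
proof -
  let ?L = "sparsify P d k xs"
  \<comment> \<open>Every tuple extends the empty partial tuple, whose limit therefore bounds the
    number of kept tuples; \<open>[]\<close> is a dummy.\<close>
  have "length ?L = agree ?L {} []" by (simp add: agree_def)
  also have "\<dots> \<le> thr d k d" using agree_sparsify_le[of "{}"] by simp
  finally have len: "card (set ?L) \<le> thr d k d" by (meson card_length le_trans)
  have "card (\<Union>v\<in>set ?L. set v) \<le> (\<Sum>v\<in>set ?L. card (set v))" by (rule card_UN_le) simp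
  also have "\<dots> \<le> (\<Sum>v\<in>set ?L. d)"
  proof (rule sum_mono)
    fix v assume "v \<in> set ?L"
    then have "length v = d" using assms set_sparsify[of P d k xs] by auto
    then show "card (set v) \<le> d" using card_length[of v] by simp
  qed
  also have "\<dots> \<le> d * thr d k d" using len by (simp add: mult.commute)
  finally show ?thesis .
qed

section \<open>Renaming the kept vertices\<close>

text \<open>Instances live on initial segments of the natural numbers, so a kept vertex is renamed
  to its position in \<open>xs\<close>.\<close>

definition relabel :: "nat graph \<Rightarrow> nat list \<Rightarrow> nat graph" where
  "relabel G xs = ({..<length xs},
     {{i, j} |i j. i < length xs \<and> j < length xs \<and> {xs ! i, xs ! j} \<in> edges G})"

lemma relabel_edge:
  "i < length xs \<Longrightarrow> j < length xs \<Longrightarrow> {i, j} \<in> edges (relabel G xs) \<longleftrightarrow> {xs ! i, xs ! j} \<in> edges G"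
  by (auto simp: relabel_def doubleton_eq_iff insert_commute)

lemma fin_graph_relabel: "fin_graph G \<Longrightarrow> fin_graph (relabel G xs)"
  unfolding fin_graph_def
proof (intro conjI subsetI)
  fix e assume G: "finite (verts G) \<and> edges G \<subseteq> nsets (verts G) 2" and "e \<in> edges (relabel G xs)"
  then obtain i j where "e = {i, j}" "i < length xs" "j < length xs" "{xs ! i, xs ! j} \<in> edges G"
    by (auto simp: relabel_def)
  moreover from this have "i \<noteq> j" using G fin_graph_loopfree[of G] by (auto simp: fin_graph_def)
  ultimately show "e \<in> nsets (verts (relabel G xs)) 2" by (auto simp: nsets_def relabel_def)
qed (simp add: relabel_def)

lemma iso_relabel:
  assumes "distinct xs" "set xs \<subseteq> verts G"
  shows "is_iso ((!) xs) (relabel G xs) (induced G (set xs))"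
proof -
  have "verts (relabel G xs) = {..<length xs}" by (simp add: relabel_def)
  moreover have "bij_betw ((!) xs) {..<length xs} (set xs)" by (rule bij_betw_nth[OF assms(1) refl refl])
  ultimately show ?thesis
    using assms(2) relabel_edge[of _ xs _ G]
    by (auto simp: is_iso_def verts_induced Int_absorb1) (auto simp: induced_def)
qed

lemma perfect_relabel:
  assumes "distinct xs" "set xs \<subseteq> verts G" "perfect G"
  shows "perfect (relabel G xs)"
  using iso_perfect[OF iso_inv[OF iso_relabel[OF assms(1,2)]] perfect_induced[OF assms(3)]] .

lemma bad_relabel:
  assumes G: "fin_graph G" and xs: "set xs \<subseteq> verts G" "distinct xs" and u: "set u \<subseteq> {..<length xs}"
  shows "bad r l (relabel G xs) u \<longleftrightarrow> bad r l G (map ((!) xs) u)"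
proof -
  have ui: "u ! i < length xs" if "i < length u" for i using u that nth_mem by blast
  have "obs (length u) (relabel G xs) u = obs (length u) G (map ((!) xs) u)"
    using ui relabel_edge[of _ xs _ G] xs(2)
    by (auto simp: obs_def idx_pairs_def nth_eq_iff_index_eq)
  moreover have "set (map ((!) xs) u) \<subseteq> verts G" using u xs(1) by (force simp: subset_iff)
  moreover have "set u \<subseteq> verts (relabel G xs)" using u by (simp add: relabel_def)
  ultimately show ?thesis
    using bad_iff_bad_obs[OF G, of "map ((!) xs) u" "length u"]
      bad_iff_bad_obs[OF fin_graph_relabel[OF G], of u xs "length u"] by simp
qed

lemma ex_map_if_set_subset_image: "set u \<subseteq> f ` A \<Longrightarrow> \<exists>w. u = map f w \<and> set w \<subseteq> A"
proof (induction u)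
  case (Cons x u)
  then obtain w a where "u = map f w" "set w \<subseteq> A" "x = f a" "a \<in> A" by auto
  then show ?case by (intro exI[of _ "a # w"]) simp
qed simp

text \<open>A hitting set of \<open>G\<close> restricts to the kept vertices, since bad tuples of
  the kernel are bad in \<open>G\<close>. Conversely every kept tuple is bad in the kernel, so a
  hitting set of the kernel hits all kept tuples and, by \<open>sparsify_hitting\<close>, all bad
  tuples.\<close>

lemma relabel_hitting_set_iff:
  fixes n d k :: nat
  assumes G: "fin_graph G" "verts G = {..<n}"
    and L: "L = sparsify (bad r l G) d k (tups n d)"
    and xs: "distinct xs" "set xs = (\<Union>v\<in>set L. set v)"
  shows "(\<exists>S\<subseteq>verts G. card S \<le> k \<and>
      (\<forall>v. length v = d \<and> set v \<subseteq> verts G \<and> bad r l G v \<longrightarrow> set v \<inter> S \<noteq> {})) \<longleftrightarrow>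
    (\<exists>S\<subseteq>verts (relabel G xs). card S \<le> k \<and>
      (\<forall>v. length v = d \<and> set v \<subseteq> verts (relabel G xs) \<and> bad r l (relabel G xs) v \<longrightarrow> set v \<inter> S \<noteq> {}))"
proof -
  have Lsub: "length v = d \<and> set v \<subseteq> {..<n} \<and> bad r l G v" if "v \<in> set L" for v
    using that set_sparsify[of "bad r l G" d k "tups n d"] by (auto simp: L set_tups)
  have xsV: "set xs \<subseteq> verts G" using Lsub G(2) xs(2) by blast
  have vH: "verts (relabel G xs) = {..<length xs}" by (simp add: relabel_def)
  note bad = bad_relabel[OF G(1) xsV xs(1)]
  show ?thesis
  proof
    assume "\<exists>S\<subseteq>verts G. card S \<le> k \<and>
      (\<forall>v. length v = d \<and> set v \<subseteq> verts G \<and> bad r l G v \<longrightarrow> set v \<inter> S \<noteq> {})"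
    then obtain S where S: "S \<subseteq> verts G" "card S \<le> k"
      "\<And>v. length v = d \<Longrightarrow> set v \<subseteq> verts G \<Longrightarrow> bad r l G v \<Longrightarrow> set v \<inter> S \<noteq> {}" by blast
    define S' where "S' = {i. i < length xs \<and> xs ! i \<in> S}"
    have "finite S" using S(1) G(2) finite_subset by auto
    moreover have "inj_on ((!) xs) S'" using xs(1) by (auto simp: S'_def inj_on_def nth_eq_iff_index_eq)
    ultimately have "card S' \<le> card S" by (rule card_inj_on_le[rotated 2]) (auto simp: S'_def)
    moreover have "set v \<inter> S' \<noteq> {}"
      if v: "length v = d" "set v \<subseteq> {..<length xs}" "bad r l (relabel G xs) v" for v
    proof -
      have "set (map ((!) xs) v) \<subseteq> verts G" using v(2) xsV by (force simp: subset_iff)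
      then have "set (map ((!) xs) v) \<inter> S \<noteq> {}" using v bad[of v] by (intro S(3)) auto
      then show ?thesis using v(2) by (auto simp: S'_def)
    qed
    ultimately show "\<exists>S\<subseteq>verts (relabel G xs). card S \<le> k \<and>
      (\<forall>v. length v = d \<and> set v \<subseteq> verts (relabel G xs) \<and> bad r l (relabel G xs) v \<longrightarrow> set v \<inter> S \<noteq> {})"
      using S(2) unfolding vH by (intro exI[of _ S']) (auto simp: S'_def)
  next
    assume "\<exists>S\<subseteq>verts (relabel G xs). card S \<le> k \<and>
      (\<forall>v. length v = d \<and> set v \<subseteq> verts (relabel G xs) \<and> bad r l (relabel G xs) v \<longrightarrow> set v \<inter> S \<noteq> {})"
    then obtain S where S: "S \<subseteq> {..<length xs}" "card S \<le> k"
      "\<And>v. length v = d \<Longrightarrow> set v \<subseteq> {..<length xs} \<Longrightarrow> bad r l (relabel G xs) v \<Longrightarrow> set v \<inter> S \<noteq> {}"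
      unfolding vH by blast
    have finS: "finite S" using S(1) finite_subset by blast
    let ?S = "(!) xs ` S"
    have "?S \<subseteq> verts G" using S(1) xsV by (auto simp: subset_iff)
    moreover have card: "card ?S \<le> k" using card_image_le[OF finS] S(2) le_trans by blast
    moreover have "set u \<inter> ?S \<noteq> {}" if "u \<in> set L" for u
    proof -
      have u: "length u = d" "bad r l G u" "set u \<subseteq> (!) xs ` {..<length xs}"
        using Lsub[OF that] that xs(2) by (auto simp: set_conv_nth[of xs])
      then obtain w where w: "u = map ((!) xs) w" "set w \<subseteq> {..<length xs}"
        using ex_map_if_set_subset_image by metis
      then show ?thesis using S(3)[of w] u bad[of w] by auto
    qed
    then have "set v \<inter> ?S \<noteq> {}" if "length v = d" "set v \<subseteq> {..<n}" "bad r l G v" for v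
      using sparsify_hitting[of "tups n d" d ?S k "bad r l G" v] card finS that unfolding L
      by (simp add: set_tups)
    ultimately show "\<exists>S\<subseteq>verts G. card S \<le> k \<and>
      (\<forall>v. length v = d \<and> set v \<subseteq> verts G \<and> bad r l G v \<longrightarrow> set v \<inter> S \<noteq> {})"
      using G(2) by (intro exI[of _ ?S]) simp
  qed
qed

section \<open>The kernelization\<close>

text \<open>Arrays used by the kernelization: cells \<open>0\<close> and \<open>1\<close> of \<open>2\<close> hold the number \<open>q\<close> of kept
  tuples and \<open>q * d\<close>, \<open>3\<close> their entries, \<open>4\<close> the thresholds, \<open>9\<close> marks the vertices of the
  kept tuples, \<open>13\<close> and \<open>14\<close> list these vertices and their row offsets (\<open>12\<close> is their
  number), \<open>15\<close> is the new matrix and \<open>18\<close> its size.\<close>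

definition scaled :: "nat \<Rightarrow> expr \<Rightarrow> expr" where
  "scaled m e = (Add e ^^ m) (Const 0)"

lemma val_scaled [simp]: "val (scaled m e) s = m * val e s"
  by (induction m) (simp_all add: scaled_def)

text \<open>Multiplication by \<open>d * k + 1\<close> is done by adding \<open>d\<close> times the
  previous limit in each of \<open>k\<close> rounds; the factor \<open>d\<close> is a constant of
  the program.\<close>

fun thresholds :: "nat \<Rightarrow> nat \<Rightarrow> prog" where
  "thresholds d 0 = Store 4 (Const 0) (Const 1)"
| "thresholds d (Suc m) = Seq (thresholds d m) (Seq (Store 4 (Const (Suc m)) (Cell 4 (Const m)))
     (For 5 (Cell 0 (Const 1)) (Store 4 (Const (Suc m))
       (Add (Cell 4 (Const (Suc m))) (scaled d (Cell 4 (Const m)))))))"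

lemma writes_thresholds: "writes (thresholds d m) \<subseteq> {4, 5}"
  by (induction m) auto

lemma wp_thresholds:
  assumes k: "k \<le> M" "s 0 1 = k"
  shows "wp M (thresholds d m) (\<lambda>s'. \<forall>i\<le>m. s' 4 i = thr d k i) s"
proof (induction m)
  case 0
  show ?case by (auto intro: wp_Store simp: thr_def)
next
  case (Suc m)
  show ?case unfolding thresholds.simps
  proof (rule wp_Seq, rule wp_frame[OF Suc], intro wp_Seq wp_Store)
    fix s1 assume thr: "\<forall>i\<le>m. s1 4 i = thr d k i"
      and fr: "\<And>a. a \<notin> writes (thresholds d m) \<Longrightarrow> s1 a = s a"
    have "0 \<notin> writes (thresholds d m)" using writes_thresholds[of d m] by auto
    then have s0: "s1 0 1 = k" using k(2) fr by simp
    let ?s = "s1(4 := (s1 4)(val (Const (Suc m)) s1 := val (Cell 4 (Const m)) s1))"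
    show "wp M (For 5 (Cell 0 (Const 1)) (Store 4 (Const (Suc m))
       (Add (Cell 4 (Const (Suc m))) (scaled d (Cell 4 (Const m)))))) (\<lambda>s'. \<forall>i\<le>Suc m. s' 4 i = thr d k i) ?s"
    proof (rule wp_For[where N = k and I = "\<lambda>i s'. (\<forall>j\<le>m. s' 4 j = thr d k j) \<and>
        s' 4 (Suc m) = thr d k m * (d * i + 1)"], goal_cases)
      case (5 i s')
      then show ?case by (intro wp_Store) (auto simp: algebra_simps)
    next
      case (6 s')
      then show ?case by (auto simp: le_Suc_eq thr_def algebra_simps)
    qed (use k(1) s0 thr in auto)
  qed
qed

text \<open>Array \<open>6\<close> counts the kept tuples that agree with the current one on
  \<open>J\<close>, array \<open>8\<close> is the offset of the kept tuple being compared, and array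
  \<open>5\<close> holds a verdict that any failing check clears.\<close>

definition check :: "nat \<Rightarrow> nat list \<Rightarrow> prog" where
  "check d J = Seq (Store 6 (Const 0) (Const 0)) (Seq (Store 8 (Const 0) (Const 0)) (Seq
     (For 7 (R 2) (Seq
       (tree (map (\<lambda>j. Add (Sub (R (reg j)) (Cell 3 (Add (R 8) (Const j))))
                           (Sub (Cell 3 (Add (R 8) (Const j))) (R (reg j)))) J)
         (\<lambda>bs. if True \<in> set bs then Skip else Store 6 (Const 0) (Add (R 6) (Const 1))))
       (Store 8 (Const 0) (Add (R 8) (Const d)))))
     (If (Sub (Cell 4 (Const (d - length J))) (R 6)) Skip (Store 5 (Const 0) (Const 0)))))"

definition checks :: "nat \<Rightarrow> nat list list \<Rightarrow> prog" where
  "checks d Js = seqs (map (check d) Js)"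

definition append_tuple :: "nat \<Rightarrow> prog" where
  "append_tuple d = Seq (stores 3 (\<lambda>j. Add (Cell 2 (Const 1)) (Const j)) (\<lambda>j. R (reg j)) d)
     (Seq (Store 2 (Const 1) (Add (Cell 2 (Const 1)) (Const d))) (Store 2 (Const 0) (Add (R 2) (Const 1))))"

definition keep_step :: "nat \<Rightarrow> nat \<Rightarrow> nat \<Rightarrow> prog" where
  "keep_step d r l = tree (obs_exprs d) (\<lambda>bs. if bad_obs d r l bs
     then Seq (Store 5 (Const 0) (Const 1)) (Seq (checks d (subseqs [0..<d])) (If (R 5) (append_tuple d) Skip))
     else Skip)"

definition mark :: "nat \<Rightarrow> prog" where
  "mark d = Seq (Store 8 (Const 0) (Const 0)) (For 7 (R 2) (Seq
     (stores 9 (\<lambda>j. Cell 3 (Add (R 8) (Const j))) (\<lambda>j. Const 1) d)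
     (Store 8 (Const 0) (Add (R 8) (Const d)))))"

definition compact :: prog where
  "compact = Seq (Store 12 (Const 0) (Const 0)) (Seq (Store 11 (Const 0) (Const 0))
     (For 10 (R 0) (Seq
       (If (Cell 9 (R 10))
         (Seq (Store 13 (R 12) (R 10)) (Seq (Store 14 (R 12) (R 11)) (Store 12 (Const 0) (Add (R 12) (Const 1)))))
         Skip)
       (Store 11 (Const 0) (Add (R 11) (R 0))))))"

text \<open>The matrix goes to a separate array because array \<open>1\<close> is still being read.
  The running index in array \<open>18\<close> avoids computing a product.\<close>

definition new_matrix :: prog where
  "new_matrix = Seq (Store 18 (Const 0) (Const 0)) (For 16 (R 12) (For 17 (R 12) (Seq
     (Store 15 (R 18) (Cell 1 (Add (Cell 14 (R 16)) (Cell 13 (R 17)))))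
     (Store 18 (Const 0) (Add (R 18) (Const 1))))))"

text \<open>Entries of the old matrix beyond the new one remain, but \<open>represents\<close> does
  not look at them.\<close>

definition copy_back :: prog where
  "copy_back = Seq (For 19 (R 18) (Store 1 (R 19) (Cell 15 (R 19)))) (Store 0 (Const 0) (R 12))"

definition kernel_prog :: "nat \<Rightarrow> nat \<Rightarrow> nat \<Rightarrow> prog" where
  "kernel_prog d r l = Seq (thresholds d d) (Seq (nest d (keep_step d r l))
     (Seq (mark d) (Seq compact (Seq new_matrix copy_back))))"

section \<open>Correctness of the kernelization program\<close>

lemma writes_check: "writes (check d J) \<subseteq> {5, 6, 7, 8}"
proof -
  have "writes (tree qs (\<lambda>bs. if True \<in> set bs then Skip else Store 6 (Const 0) (Add (R 6) (Const 1)))) \<subseteq> {6}" for qs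
    by (rule writes_tree) simp
  then show ?thesis by (auto simp: check_def dest: subsetD)
qed

lemma writes_checks: "writes (checks d Js) \<subseteq> {5, 6, 7, 8}"
  using writes_check by (fastforce simp: checks_def writes_seqs)

lemma writes_keep_step: "writes (keep_step d r l) \<subseteq> {2, 3, 5, 6, 7, 8}"
proof -
  have "writes (stores 3 (\<lambda>j. Add (Cell 2 (Const 1)) (Const j)) (\<lambda>j. R (reg j)) d) \<subseteq> {2, 3, 5, 6, 7, 8}"
    using writes_stores by blast
  moreover have "writes (checks d (subseqs [0..<d])) \<subseteq> {2, 3, 5, 6, 7, 8}" using writes_checks by blast
  ultimately show ?thesis unfolding keep_step_def by (intro writes_tree) (simp add: append_tuple_def)
qed

lemma writes_mark: "writes (mark d) \<subseteq> {7, 8, 9}"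
  using writes_stores[of 9 "\<lambda>j. Cell 3 (Add (R 8) (Const j))" "\<lambda>j. Const 1" d]
  by (auto simp: mark_def)

definition stored :: "nat \<Rightarrow> nat list list \<Rightarrow> state \<Rightarrow> bool" where
  "stored d L s \<longleftrightarrow> s 2 0 = length L \<and> s 2 1 = length L * d \<and>
     (\<forall>p<length L. \<forall>j<d. s 3 (p * d + j) = L ! p ! j)"

lemma wp_check:
  assumes M: "length L \<le> M" and L: "stored d L s" and v: "holds_tuple n 0 v s" "length v = d"
    and J: "set J \<subseteq> {..<d}" and thr: "\<forall>i\<le>d. s 4 i = thr d k i"
  shows "wp M (check d J) (\<lambda>s'. s' 5 0 =
    (if agree L (set J) v < thr d k (d - length J) then s 5 0 else 0)) s"
  unfolding check_def
proof (intro wp_Seq wp_Store)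
  let ?s = "(s(6 := (s 6)(val (Const 0) s := val (Const 0) s)))
    (8 := ((s(6 := (s 6)(val (Const 0) s := val (Const 0) s))) 8)
      (val (Const 0) (s(6 := (s 6)(val (Const 0) s := val (Const 0) s))) :=
       val (Const 0) (s(6 := (s 6)(val (Const 0) s := val (Const 0) s)))))"
  let ?F = "\<lambda>bs. if True \<in> set bs then Skip else Store 6 (Const 0) (Add (R 6) (Const 1))"
  let ?qs = "map (\<lambda>j. Add (Sub (R (reg j)) (Cell 3 (Add (R 8) (Const j))))
                           (Sub (Cell 3 (Add (R 8) (Const j))) (R (reg j)))) J"
  have wt: "writes (tree ?qs ?F) \<subseteq> {6}" by (rule writes_tree) simp
  show "wp M (For 7 (R 2) (Seq (tree ?qs ?F) (Store 8 (Const 0) (Add (R 8) (Const d)))))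
    (wp M (If (Sub (Cell 4 (Const (d - length J))) (R 6)) Skip (Store 5 (Const 0) (Const 0)))
      (\<lambda>s'. s' 5 0 = (if agree L (set J) v < thr d k (d - length J) then s 5 0 else 0))) ?s"
  proof (rule wp_For[where N = "length L" and
        I = "\<lambda>i s'. s' 6 0 = agree (take i L) (set J) v \<and> s' 8 0 = i * d", OF M], goal_cases)
    case 1
    show ?case using wt by auto
  next
    case 2
    show ?case by (simp add: agree_def)
  next
    case (3 i s')
    have "s' 2 = ?s 2" by (rule 3(4)) (use wt in auto)
    then show ?case using L by (simp add: stored_def)
  next
    case (4 i s')
    have s': "s' x = s x" if "x \<notin> {6, 7, 8}" for x using that wt 4(4)[of x] by auto
    have reg: "s' (reg j) 0 = v ! j" if "j < d" for j
      using v that s'[of "reg j"] by (simp add: holds_tuple_def reg_def)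
    have ent: "s' 3 (s' 8 0 + j) = L ! i ! j" if "j < d" for j
      using 4(1,2) L s'[of 3] that by (simp add: stored_def)
    have "True \<in> set (map (\<lambda>q. val q s' \<noteq> 0) ?qs) \<longleftrightarrow> \<not> (\<forall>j\<in>set J. L ! i ! j = v ! j)"
    proof -
      have "val (Add (Sub (R (reg j)) (Cell 3 (Add (R 8) (Const j))))
          (Sub (Cell 3 (Add (R 8) (Const j))) (R (reg j)))) s' \<noteq> 0 \<longleftrightarrow> L ! i ! j \<noteq> v ! j" if "j \<in> set J" for j
      proof -
        have j: "j < d" using that J by auto
        show ?thesis using ent[OF j] reg[OF j] by auto
      qed
      then show ?thesis by (force simp del: val.simps)
    qed
    then have "?F (map (\<lambda>q. val q s' \<noteq> 0) ?qs) =
      (if \<forall>j\<in>set J. L ! i ! j = v ! j then Store 6 (Const 0) (Add (R 6) (Const 1)) else Skip)"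
      by presburger
    moreover have tk: "agree (take (Suc i) L) (set J) v = agree (take i L) (set J) v +
      (if \<forall>j\<in>set J. L ! i ! j = v ! j then 1 else 0)"
      using 4(1) by (simp add: agree_def take_Suc_conv_app_nth)
    ultimately have "wp M (?F (map (\<lambda>q. val q s' \<noteq> 0) ?qs))
      (\<lambda>s''. s'' 6 0 = agree (take (Suc i) L) (set J) v) s'"
      using 4(2) by (auto intro!: wp_Store wp_Skip)
    then have "wp M (tree ?qs ?F) (\<lambda>s''. s'' 6 0 = agree (take (Suc i) L) (set J) v) s'" by (rule wp_tree)
    then show ?case
    proof (intro wp_Seq, elim wp_frame, intro wp_Store)
      fix s'' assume "s'' 6 0 = agree (take (Suc i) L) (set J) v"
        and fr: "\<And>a. a \<notin> writes (tree ?qs ?F) \<Longrightarrow> s'' a = s' a"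
      moreover have "s'' 8 = s' 8" using wt by (intro fr) auto
      ultimately show "((s''(8 := (s'' 8)(val (Const 0) s'' := val (Add (R 8) (Const d)) s'')))
        (7 := ((s''(8 := (s'' 8)(val (Const 0) s'' := val (Add (R 8) (Const d)) s''))) 7)(0 := Suc i))) 6 0 =
        agree (take (Suc i) L) (set J) v \<and>
        ((s''(8 := (s'' 8)(val (Const 0) s'' := val (Add (R 8) (Const d)) s'')))
        (7 := ((s''(8 := (s'' 8)(val (Const 0) s'' := val (Add (R 8) (Const d)) s''))) 7)(0 := Suc i))) 8 0 = Suc i * d"
        using 4(2) by simp
    qed
  next
    case (5 s')
    have s': "s' x = s x" if "x \<notin> {6, 7, 8}" for x using that wt 5(3)[of x] by auto
    show ?case using 5(1) s'[of 4] s'[of 5] thr by (intro wp_If wp_Skip wp_Store) auto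
  qed
qed

lemma wp_checks:
  assumes M: "length L \<le> M" and L: "stored d L s" and v: "holds_tuple n 0 v s" "length v = d"
    and J: "\<And>J. J \<in> set Js \<Longrightarrow> set J \<subseteq> {..<d}" and thr: "\<forall>i\<le>d. s 4 i = thr d k i"
  shows "wp M (checks d Js) (\<lambda>s'. s' 5 0 =
    (if \<forall>J\<in>set Js. agree L (set J) v < thr d k (d - length J) then s 5 0 else 0)) s"
  using L v(1) J thr unfolding checks_def
proof (induction Js arbitrary: s)
  case Nil
  show ?case by (auto intro: wp_Skip)
next
  case (Cons J Js)
  show ?case
  proof (simp only: list.map seqs.simps, rule wp_Seq,
      rule wp_frame[OF wp_check[OF M Cons.prems(1,2) v(2) Cons.prems(3) Cons.prems(4)]])
    fix s1 assume s1: "s1 5 0 = (if agree L (set J) v < thr d k (d - length J) then s 5 0 else 0)"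
      and fr: "\<And>a. a \<notin> writes (check d J) \<Longrightarrow> s1 a = s a"
    have eq: "s1 x = s x" if "x \<notin> {5, 6, 7, 8}" for x using that writes_check[of d J] by (intro fr) auto
    have "stored d L s1" using Cons.prems(1) eq[of 2] eq[of 3] by (simp add: stored_def)
    moreover have "holds_tuple n 0 v s1" using Cons.prems(2) eq by (simp add: holds_tuple_def reg_def)
    moreover have "\<forall>i\<le>d. s1 4 i = thr d k i" using Cons.prems(4) eq[of 4] by simp
    ultimately have "wp M (seqs (map (check d) Js)) (\<lambda>s'. s' 5 0 =
      (if \<forall>J\<in>set Js. agree L (set J) v < thr d k (d - length J) then s1 5 0 else 0)) s1"
      using Cons.prems(3) by (intro Cons.IH) auto
    then show "wp M (seqs (map (check d) Js)) (\<lambda>s'. s' 5 0 =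
      (if \<forall>J\<in>set (J # Js). agree L (set J) v < thr d k (d - length J) then s 5 0 else 0)) s1"
      by (rule wp_mono) (use s1 in auto)
  qed simp
qed

lemma wp_append_tuple:
  assumes L: "stored d L s" and v: "holds_tuple n 0 v s" "length v = d"
  shows "wp M (append_tuple d) (stored d (L @ [v])) s"
  unfolding append_tuple_def
proof (intro wp_Seq wp_stores wp_Store, goal_cases)
  case (4 s')
  have eq: "s' 2 = s 2" by (rule 4) simp
  have new: "s' 3 (length L * d + j) = v ! j" if "j < d" for j
    using 4(1)[OF that] L v that by (simp add: stored_def holds_tuple_def)
  have old: "s' 3 (p * d + j) = L ! p ! j" if "p < length L" "j < d" for p j
  proof -
    \<comment> \<open>The new tuple fills the block from \<open>length L * d\<close> on, above all
      old entries.\<close>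
    have "Suc p * d \<le> length L * d" using that by (intro mult_le_mono1) simp
    then have "p * d + j < length L * d" using that by simp
    then have "s' 3 (p * d + j) = s 3 (p * d + j)" using L by (intro 4(2)) (auto simp: stored_def)
    then show ?thesis using L that by (simp add: stored_def)
  qed
  show ?case using new old eq L by (auto simp: stored_def nth_append less_Suc_eq)
qed (auto simp: reg_def)

text \<open>Each subset of the positions appears as a distinct list, so its length is its
  cardinality.\<close>

lemma keep_iff_checks:
  "keep d k L v \<longleftrightarrow> (\<forall>J\<in>set (subseqs [0..<d]). agree L (set J) v < thr d k (d - length J))"
proof -
  have "length J = card (set J)" if "J \<in> set (subseqs [0..<d])" for J
    using subseqs_distinctD[OF that] by (simp add: distinct_card)
  moreover have "Pow {..<d} = set ` set (subseqs [0..<d])"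
    using subseqs_powset[of "[0..<d]"] by (simp add: lessThan_atLeast0)
  ultimately show ?thesis by (simp add: keep_def)
qed

lemma length_sparsify_le_thr: "length (sparsify P d k xs) \<le> thr d k d"
  using agree_sparsify_le[of "{}" d P k xs] by (simp add: agree_def)

context tuple_graph
begin

lemma wp_keep_tuples:
  assumes n: "n \<le> M" and M: "thr d k d \<le> M" and rep: "represents s (G, k)"
    and thr: "\<forall>i\<le>d. s 4 i = thr d k i" and empty: "s 2 0 = 0" "s 2 1 = 0"
  shows "wp M (nest d (keep_step d r l)) (stored d (sparsify (bad r l G) d k (tups n d))) s"
proof -
  define I where "I xs s' \<longleftrightarrow> s' 0 = s 0 \<and> s' 1 = s 1 \<and> s' 4 = s 4 \<and>
    stored d (sparsify (bad r l G) d k xs) s'" for xs and s' :: state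
  have "wp M (nest d (keep_step d r l)) (I (tups n d)) s"
  proof (rule wp_nest[OF n], goal_cases)
    case (1 j)
    then show ?case by (auto simp: reg_def dest!: subsetD[OF writes_keep_step])
  next
    case 2
    show ?case by (auto dest!: subsetD[OF writes_keep_step])
  next
    case (3 xs s' s'')
    have eq: "s'' a = s' a" if "a < 20" for a using that by (intro 3(1)) (auto simp: reg_def)
    show ?case using 3(2) eq[of 0] eq[of 1] eq[of 2] eq[of 3] eq[of 4] by (simp add: I_def stored_def)
  next
    case (4 xs v s')
    let ?L = "sparsify (bad r l G) d k xs"
    have s': "s' 0 = s 0" "s' 1 = s 1" "s' 4 = s 4" "stored d ?L s'" using 4(3) by (auto simp: I_def)
    have rep': "represents s' (G, k)" using rep s' by (intro represents_cong[OF _ _ rep])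
    have bad: "bad_obs d r l (map (\<lambda>q. val q s' \<noteq> 0) (obs_exprs d)) \<longleftrightarrow> bad r l G v"
      using obs_exprs_eq_obs[OF rep' 4(4,1,2)] bad_iff_bad_obs[OF fin _ 4(1)] 4(2) verts by simp
    have lenM: "length ?L \<le> M" using length_sparsify_le_thr M le_trans by blast
    show ?case unfolding keep_step_def
    proof (rule wp_tree, unfold bad, cases "bad r l G v")
      case False
      then show "wp M (if bad r l G v then Seq (Store 5 (Const 0) (Const 1)) (Seq (checks d (subseqs [0..<d]))
          (If (R 5) (append_tuple d) Skip)) else Skip) (I (xs @ [v])) s'"
        using 4(3) by (auto intro!: wp_Skip simp: I_def sparsify_snoc)
    next
      case True
      let ?s = "s'(5 := (s' 5)(val (Const 0) s' := val (Const 1) s'))"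
      have "wp M (checks d (subseqs [0..<d])) (\<lambda>s''. s'' 5 0 =
         (if \<forall>J\<in>set (subseqs [0..<d]). agree ?L (set J) v < thr d k (d - length J) then ?s 5 0 else 0)) ?s"
      proof (rule wp_checks[OF lenM, where n = n])
        show "stored d ?L ?s" using s'(4) by (simp add: stored_def)
        show "holds_tuple n 0 v ?s" using 4(4) by (simp add: holds_tuple_def reg_def)
        show "set J \<subseteq> {..<d}" if "J \<in> set (subseqs [0..<d])" for J
          using that subseqs_powset[of "[0..<d]"] by (auto simp: lessThan_atLeast0)
      qed (use thr s' 4(1) in auto)
      then have c: "wp M (checks d (subseqs [0..<d])) (\<lambda>s''. s'' 5 0 = (if keep d k ?L v then 1 else 0)) ?s"
        by (rule wp_mono) (simp add: keep_iff_checks)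
      show "wp M (if bad r l G v then Seq (Store 5 (Const 0) (Const 1)) (Seq (checks d (subseqs [0..<d]))
          (If (R 5) (append_tuple d) Skip)) else Skip) (I (xs @ [v])) s'"
        unfolding if_P[OF True]
      proof (intro wp_Seq wp_Store, rule wp_frame[OF c])
        fix s2 assume ok: "s2 5 0 = (if keep d k ?L v then 1 else 0)"
          and fr: "\<And>a. a \<notin> writes (checks d (subseqs [0..<d])) \<Longrightarrow> s2 a = ?s a"
        have eq: "s2 a = s' a" if "a \<notin> {5, 6, 7, 8}" for a
          using that fr[of a] writes_checks[of d "subseqs [0..<d]"] by auto
        have st: "stored d ?L s2" using s'(4) eq[of 2] eq[of 3] by (simp add: stored_def)
        have ht: "holds_tuple n 0 v s2" using 4(4) eq by (simp add: holds_tuple_def reg_def)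
        show "wp M (If (R 5) (append_tuple d) Skip) (I (xs @ [v])) s2"
        proof (rule wp_If)
          assume "val (R 5) s2 \<noteq> 0"
          then have keep: "keep d k ?L v" using ok by (auto split: if_splits)
          have wa: "writes (append_tuple d) \<subseteq> {2, 3}"
            using writes_stores[of 3] by (simp add: append_tuple_def) blast
          have wn: "a \<notin> writes (append_tuple d)" if "a \<in> {0, 1, 4}" for a using that wa by auto
          show "wp M (append_tuple d) (I (xs @ [v])) s2"
          proof (rule wp_frame[OF wp_append_tuple[OF st ht 4(1)]])
            fix s3 assume "stored d (?L @ [v]) s3"
              and fr3: "\<And>a. a \<notin> writes (append_tuple d) \<Longrightarrow> s3 a = s2 a"
            moreover have "s3 a = s' a" if "a \<in> {0, 1, 4}" for a
              using that fr3[OF wn[OF that]] eq[of a] by auto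
            ultimately show "I (xs @ [v]) s3" using True keep s' by (simp add: I_def sparsify_snoc)
          qed
        next
          assume "val (R 5) s2 = 0"
          then have "\<not> keep d k ?L v" using ok by (auto split: if_splits)
          then show "wp M Skip (I (xs @ [v])) s2"
            using st s' eq by (intro wp_Skip) (simp add: I_def sparsify_snoc)
        qed
      qed
    qed
  next
    case 5
    show ?case using empty by (simp add: I_def stored_def)
  next
    case 6
    show ?case using rep by (simp add: represents_def card_verts Let_def)
  qed
  then show ?thesis by (rule wp_mono) (simp add: I_def)
qed

end

lemma wp_mark:
  assumes M: "length L \<le> M" and L: "stored d L s" and len: "\<And>v. v \<in> set L \<Longrightarrow> length v = d"
    and zero: "\<And>x. s 9 x = 0"
  shows "wp M (mark d) (\<lambda>s'. \<forall>x. s' 9 x \<noteq> 0 \<longleftrightarrow> x \<in> (\<Union>v\<in>set L. set v)) s"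
  unfolding mark_def
proof (intro wp_Seq wp_Store)
  let ?p = "stores 9 (\<lambda>j. Cell 3 (Add (R 8) (Const j))) (\<lambda>j. Const 1) d"
  have ws: "a \<notin> writes ?p" if "a \<noteq> 9" for a using that writes_stores by blast
  show "wp M (For 7 (R 2) (Seq ?p (Store 8 (Const 0) (Add (R 8) (Const d)))))
    (\<lambda>s'. \<forall>x. s' 9 x \<noteq> 0 \<longleftrightarrow> x \<in> (\<Union>v\<in>set L. set v))
    (s(8 := (s 8)(val (Const 0) s := val (Const 0) s)))"
  proof (rule wp_For[where N = "length L" and
        I = "\<lambda>i s'. s' 8 0 = i * d \<and> (\<forall>x. s' 9 x \<noteq> 0 \<longleftrightarrow> x \<in> (\<Union>v\<in>set (take i L). set v))", OF M], goal_cases)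
    case 1
    show ?case using ws by auto
  next
    case 2
    show ?case using zero by simp
  next
    case (3 i s')
    have "s' 2 = s 2" using 3(4)[of 2] ws[of 2] by auto
    then show ?case using L by (simp add: stored_def)
  next
    case (4 i s')
    have s3: "s' 3 = s 3" using 4(4)[of 3] ws[of 3] by auto
    have ix: "val (Cell 3 (Add (R 8) (Const j))) s' = L ! i ! j" if "j < d" for j
      using 4(1,2) L s3 that by (simp add: stored_def)
    have "L ! i \<in> set L" using 4(1) by simp
    then have setL: "set (L ! i) = (\<lambda>j. L ! i ! j) ` {..<d}" using len[of "L ! i"] by (auto simp: set_conv_nth)
    show ?case
    proof (intro wp_Seq wp_stores wp_Store, goal_cases)
      case (4 s2)
      have "(\<lambda>j. val (Cell 3 (Add (R 8) (Const j))) s') ` {..<d} = set (L ! i)"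
        unfolding setL using ix by (intro image_cong) auto
      note idx = this
      have "s2 9 x \<noteq> 0 \<longleftrightarrow> x \<in> set (L ! i) \<or> s' 9 x \<noteq> 0" for x
      proof (cases "x \<in> set (L ! i)")
        case True
        then obtain j where "j < d" "x = val (Cell 3 (Add (R 8) (Const j))) s'" unfolding idx[symmetric] by auto
        then show ?thesis using 4(1)[of j] True by (simp del: val.simps(2))
      next
        case False
        then show ?thesis using 4(2)[of x] unfolding idx by simp
      qed
      then show ?case
        using 4(3)[of 8] \<open>i < length L\<close> \<open>s' 8 0 = i * d \<and> _\<close> by (auto simp: take_Suc_conv_app_nth)
    qed auto
  next
    case (5 s')
    then show ?case by simp
  qed
qed

lemma wp_compact:
  assumes M: "n \<le> M" and s: "s 0 0 = n" and X: "\<And>x. s 9 x \<noteq> 0 \<longleftrightarrow> x \<in> X"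
    and xs: "xs = filter (\<lambda>x. x \<in> X) [0..<n]"
  shows "wp M compact (\<lambda>s'. s' 12 0 = length xs \<and>
    (\<forall>i<length xs. s' 13 i = xs ! i \<and> s' 14 i = xs ! i * n)) s"
  unfolding compact_def
proof (intro wp_Seq wp_Store, rule wp_For[where N = n and I = "\<lambda>x s'. s' 11 0 = x * n \<and>
    (let ys = filter (\<lambda>x. x \<in> X) [0..<x] in s' 12 0 = length ys \<and>
      (\<forall>i<length ys. s' 13 i = ys ! i \<and> s' 14 i = ys ! i * n))", OF M], goal_cases)
  case (4 x s')
  have eq: "s' 0 = s 0" "s' 9 = s 9" using 4(4)[of 0] 4(4)[of 9] by auto
  show ?case
  proof (rule wp_Seq, intro wp_If wp_Seq wp_Store wp_Skip, goal_cases)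
    case 1
    then have "x \<in> X" using X[of x] eq 4(3) by simp
    then show ?case using 4(2,3) eq s by (auto simp: Let_def nth_append less_Suc_eq)
  next
    case 2
    then have "x \<notin> X" using X[of x] eq 4(3) by simp
    then show ?case using 4(2,3) eq s by (auto simp: Let_def)
  qed
qed (use s xs in \<open>auto simp: Let_def\<close>)

lemma wp_new_matrix:
  assumes M: "m \<le> M" and s: "s 12 0 = m"
  shows "wp M new_matrix (\<lambda>s'. s' 18 0 = m * m \<and>
    (\<forall>q<m * m. s' 15 q = s 1 (s 14 (q div m) + s 13 (q mod m)))) s"
  unfolding new_matrix_def
proof (intro wp_Seq wp_Store)
  define F where "F q = s 1 (s 14 (q div m) + s 13 (q mod m))" for q
  define J where "J c s' \<longleftrightarrow> s' 18 0 = c \<and> (\<forall>q<c. s' 15 q = F q)" for c and s' :: state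
  show "wp M (For 16 (R 12) (For 17 (R 12) (Seq
     (Store 15 (R 18) (Cell 1 (Add (Cell 14 (R 16)) (Cell 13 (R 17)))))
     (Store 18 (Const 0) (Add (R 18) (Const 1))))))
     (\<lambda>s'. s' 18 0 = m * m \<and> (\<forall>q<m * m. s' 15 q = s 1 (s 14 (q div m) + s 13 (q mod m))))
     (s(18 := (s 18)(val (Const 0) s := val (Const 0) s)))"
  proof (rule wp_For[where N = m and I = "\<lambda>i. J (i * m)", OF M], goal_cases)
    case (4 i s1)
    have s1: "s1 x = s x" if "x \<in> {1, 12, 13, 14}" for x using that 4(4)[of x] by auto
    show ?case
    proof (rule wp_For[where N = m and I = "\<lambda>j. J (i * m + j)", OF M], goal_cases)
      case (4 j s2)
      have s2: "s2 x = s x" if "x \<in> {1, 12, 13, 14}" for x using that 4(4)[of x] s1[of x] by auto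
      have s16: "s2 16 0 = i" using 4(4)[of 16] \<open>s1 16 0 = i\<close> by simp
      have "F (i * m + j) = s 1 (s 14 i + s 13 j)" using \<open>j < m\<close> by (simp add: F_def)
      then show ?case
        using 4(2,3) s2[of 1] s2[of 13] s2[of 14] s16
        by (intro wp_Seq wp_Store) (auto simp: J_def less_Suc_eq)
    next
      case (5 s2)
      then show ?case by (simp add: J_def add.commute)
    qed (use \<open>J (i * m) s1\<close> s1[of 12] s in \<open>auto simp: J_def\<close>)
  next
    case (5 s')
    then show ?case by (simp add: J_def F_def)
  qed (use s in \<open>auto simp: J_def\<close>)
qed

lemma wp_copy_back:
  assumes M: "q \<le> M" and s: "s 18 0 = q"
  shows "wp M copy_back (\<lambda>s'. s' 0 = (s 0)(0 := s 12 0) \<and> (\<forall>i<q. s' 1 i = s 15 i)) s"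
  unfolding copy_back_def
proof (intro wp_Seq, rule wp_For[where N = q and I = "\<lambda>j s'. \<forall>i<j. s' 1 i = s 15 i", OF M], goal_cases)
  case (4 i s')
  have "s' 15 = s 15" using 4(4)[of 15] by simp
  then show ?case using 4(2,3) by (intro wp_Store) (auto simp: less_Suc_eq)
next
  case (5 s')
  have "s' 0 = s 0" "s' 12 = s 12" using 5(3) by auto
  then show ?case using 5(1) by (intro wp_Store) auto
qed (use s in auto)

context tuple_graph
begin

text \<open>\<open>M\<close> has to bound the rounds of every loop: \<open>n\<close> for the loops
  over vertices, \<open>k\<close> for the thresholds, \<open>thr d k d\<close> for passes through
  the kept tuples and \<open>n * n\<close> for copying the matrix.\<close>

lemma exec_kernel_prog:
  assumes x: "(G, k) \<in> instances C" and L: "L = sparsify (bad r l G) d k (tups n d)"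
    and xs: "xs = filter (\<lambda>x. x \<in> (\<Union>v\<in>set L. set v)) [0..<n]"
    and M: "n \<le> M" "k \<le> M" "n * n \<le> M" "thr d k d \<le> M"
  shows "wp M (kernel_prog d r l) (\<lambda>s. represents s (relabel G xs, k)) (input_state (G, k))"
proof -
  define s where "s = input_state (G, k)"
  have rep: "represents s (G, k)" unfolding s_def using x by (rule represents_input_state)
  then have s0: "s 0 0 = n" "s 0 1 = k" by (auto simp: represents_def card_verts Let_def)
  have zero: "s a i = 0" if "a > 1" for a i using that by (simp add: s_def input_state_def Let_def)
  have lenL: "length v = d" if "v \<in> set L" for v
    using that set_sparsify[of "bad r l G" d k "tups n d"] by (auto simp: L set_tups)
  have LM: "length L \<le> M" using length_sparsify_le_thr M(4) le_trans unfolding L by blast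
  have xsn: "length xs \<le> n" unfolding xs using length_filter_le[of _ "[0..<n]"] by simp
  then have mM: "length xs \<le> M" "length xs * length xs \<le> M"
    using M(1,3) mult_le_mono[OF xsn xsn] by linarith+
  show ?thesis unfolding s_def[symmetric] kernel_prog_def
  proof (rule wp_Seq, rule wp_frame[OF wp_thresholds[where s = s and d = d and m = d, OF M(2) s0(2)]])
    fix s1 assume t1: "\<forall>i\<le>d. s1 4 i = thr d k i"
      and fr: "\<And>a. a \<notin> writes (thresholds d d) \<Longrightarrow> s1 a = s a"
    have s1: "s1 a = s a" if "a \<notin> {4, 5}" for a using that by (intro fr) (auto dest!: subsetD[OF writes_thresholds])
    have rep1: "represents s1 (G, k)" by (rule represents_cong[OF _ _ rep]) (simp_all add: s1)
    show "wp M (Seq (nest d (keep_step d r l)) (Seq (mark d) (Seq compact (Seq new_matrix copy_back))))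
      (\<lambda>s. represents s (relabel G xs, k)) s1"
    proof (rule wp_Seq, rule wp_frame[OF wp_keep_tuples[where s = s1, OF M(1,4) rep1 t1]])
      fix s2 assume st: "stored d (sparsify (bad r l G) d k (tups n d)) s2"
        and fr: "\<And>a. a \<notin> writes (nest d (keep_step d r l)) \<Longrightarrow> s2 a = s1 a"
      have s2: "s2 a = s a" if "a \<in> {0, 1, 9}" for a
      proof -
        have "a \<notin> writes (nest d (keep_step d r l))"
          using that by (auto simp: writes_nest reg_def dest!: subsetD[OF writes_keep_step])
        then show ?thesis using that s1[of a] fr[of a] by auto
      qed
      show "wp M (Seq (mark d) (Seq compact (Seq new_matrix copy_back))) (\<lambda>s. represents s (relabel G xs, k)) s2"
      proof (rule wp_Seq, rule wp_frame[OF wp_mark[OF LM st[folded L]]])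
        fix s3 assume mk: "\<forall>x. s3 9 x \<noteq> 0 \<longleftrightarrow> x \<in> (\<Union>v\<in>set L. set v)"
          and fr: "\<And>a. a \<notin> writes (mark d) \<Longrightarrow> s3 a = s2 a"
        have s3: "s3 a = s a" if "a \<in> {0, 1}" for a
        proof -
          have "a \<notin> writes (mark d)" using that by (auto dest!: subsetD[OF writes_mark])
          then show ?thesis using that s2[of a] fr[of a] by auto
        qed
        show "wp M (Seq compact (Seq new_matrix copy_back)) (\<lambda>s. represents s (relabel G xs, k)) s3"
        proof (rule wp_Seq, rule wp_frame[OF wp_compact[where s = s3, OF M(1) _ mk[rule_format] xs]])
          show "s3 0 0 = n" using s3[of 0] s0 by simp
          fix s4 assume c: "s4 12 0 = length xs \<and> (\<forall>i<length xs. s4 13 i = xs ! i \<and> s4 14 i = xs ! i * n)"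
            and fr: "\<And>a. a \<notin> writes compact \<Longrightarrow> s4 a = s3 a"
          have s4: "s4 a = s a" if "a \<in> {0, 1}" for a
            using that s3[of a] fr[of a] by (auto simp: compact_def)
          let ?m = "length xs"
          show "wp M (Seq new_matrix copy_back) (\<lambda>s. represents s (relabel G xs, k)) s4"
          proof (rule wp_Seq, rule wp_frame[OF wp_new_matrix[where s = s4, OF mM(1) c[THEN conjunct1]]])
            fix s5 assume nm: "s5 18 0 = ?m * ?m \<and>
              (\<forall>q<?m * ?m. s5 15 q = s4 1 (s4 14 (q div ?m) + s4 13 (q mod ?m)))"
              and fr: "\<And>a. a \<notin> writes new_matrix \<Longrightarrow> s5 a = s4 a"
            have s5: "s5 a = s4 a" if "a \<in> {0, 12}" for a using that by (intro fr) (auto simp: new_matrix_def)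
            show "wp M copy_back (\<lambda>s. represents s (relabel G xs, k)) s5"
            proof (rule wp_mono[OF wp_copy_back[where s = s5, OF mM(2) nm[THEN conjunct1]]])
              fix s6 :: state assume s6: "s6 0 = (s5 0)(0 := s5 12 0) \<and> (\<forall>i<?m * ?m. s6 1 i = s5 15 i)"
              have "s6 1 (i * ?m + j) = (if {i, j} \<in> edges (relabel G xs) then 1 else 0)"
                if ij: "i < ?m" "j < ?m" for i j
              proof -
                have "Suc i * ?m \<le> ?m * ?m" using ij by (intro mult_le_mono1) simp
                then have q: "i * ?m + j < ?m * ?m" using ij by simp
                have "xs ! i < n" "xs ! j < n" using ij nth_mem[of _ xs] by (auto simp: xs)
                then have "s 1 (xs ! i * n + xs ! j) = (if {xs ! i, xs ! j} \<in> edges G then 1 else 0)"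
                  using rep by (simp add: represents_def card_verts Let_def)
                moreover have "(i * ?m + j) div ?m = i" "(i * ?m + j) mod ?m = j"
                  using ij div_mult_self3[of ?m i j] by (cases "?m = 0"; simp)+
                then have "s6 1 (i * ?m + j) = s 1 (xs ! i * n + xs ! j)"
                  using s6 nm q c ij s4[of 1] by simp
                ultimately show ?thesis using relabel_edge[OF ij, of G] by simp
              qed
              moreover have card_relabel: "card (verts (relabel G xs)) = ?m" by (simp add: relabel_def)
              moreover have "s6 0 0 = ?m" "s6 0 1 = k" using s6 s5 s4[of 0] c s0 by auto
              ultimately show "represents s6 (relabel G xs, k)"
                using card_relabel by (simp add: represents_def Let_def)
            qed
          qed
        qed
      qed (use lenL s2[of 9] zero in auto)
    qed (use s1[of 2] zero in auto)
  qed
qed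

end

section \<open>Resource bounds\<close>

text \<open>The positive parameter absorbs the summand \<open>1\<close> of the base.\<close>

lemma thr_le: "k > 0 \<Longrightarrow> k \<le> N \<Longrightarrow> thr d k d \<le> (d + 1) ^ d * N ^ d"
proof -
  assume k: "k > 0" "k \<le> N"
  then have "d * k \<le> d * N" "1 \<le> N" by simp_all
  then have "d * k + 1 \<le> (d + 1) * N" unfolding add_mult_distrib by linarith
  then show ?thesis unfolding thr_def power_mult_distrib[symmetric] by (rule power_mono) simp
qed

lemma vertex_partization_has_algorithm:
  assumes bound: "\<And>H. H \<in> forbidden_set r l \<Longrightarrow> card (verts H) \<le> d" and d: "d > 0"
    and A: "20 + sz (fpt_round d r l) * 2 ^ (2 * d) \<le> A"
  shows "has_algorithm (instances perfect) (vertex_partization r l)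
    (\<lambda>n k. A * d ^ k * max 1 n ^ (2 * d))"
  unfolding has_algorithm_def
proof (intro exI[of _ "fpt_prog d r l"] ballI)
  fix x assume "x \<in> instances perfect"
  then obtain G k where x: "x = (G, k)" "(G, k) \<in> instances perfect" by (cases x) auto
  define n where "n = card (verts G)"
  have G: "fin_graph G" "perfect G" "verts G = {..<n}" using x(2) by (auto simp: instances_def n_def)
  interpret tuple_graph G n r l d using G d by unfold_locales
  from vertex_partization_iff_hitting_set[OF G(1,2) bound] exec_fpt_prog[OF x(2)]
  obtain t s where t: "exec (fpt_prog d r l) (input_state x) t s"
    "t \<le> (20 + sz (fpt_round d r l) * 2 ^ (2 * d)) * d ^ k * max 1 n ^ (2 * d)"
    "s 0 0 = (if x \<in> vertex_partization r l then 1 else 0)"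
    unfolding x(1) G(3) by auto
  have "t \<le> A * d ^ k * max 1 n ^ (2 * d)"
    using t(2) by (rule le_trans) (intro mult_le_mono1 A)
  then show "\<exists>t s. exec (fpt_prog d r l) (input_state x) t s \<and>
      t \<le> A * d ^ snd x * max 1 (card (verts (fst x))) ^ (2 * d) \<and>
      s 0 0 = (if x \<in> vertex_partization r l then 1 else 0)"
    using t by (intro exI[of _ t] exI[of _ s]) (simp add: x n_def)
qed

text \<open>The kernel has at most \<open>d * thr d k d\<close> vertices, which is of order
  \<open>k ^ d\<close>, and its adjacency matrix squares this. The time is polynomial because the
  loop depth \<open>D\<close> is a constant.\<close>

lemma vertex_partization_has_kernel:
  assumes bound: "\<And>H. H \<in> forbidden_set r l \<Longrightarrow> card (verts H) \<le> d" and d: "d > 0"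
    and A: "(d * (d + 1) ^ d)\<^sup>2 + 1 \<le> A"
  shows "has_kernel (instances perfect) (vertex_partization r l) (\<lambda>k. A * k ^ (2 * d))"
proof -
  define p where "p = kernel_prog d r l"
  define D where "D = depth p"
  \<comment> \<open>With \<open>N\<close> the instance size, \<open>3\<close> pays for
    \<open>n\<close>, \<open>n * n + k\<close> and \<open>1\<close>, each at most
    \<open>N ^ Suc d\<close>; the other summand pays for the threshold.\<close>
  define B where "B = 3 + (d + 1) ^ d"
  have "\<exists>t s. exec p (input_state x) t s \<and> t \<le> (sz p * B ^ D) * inst_size x ^ (d * D + D) \<and>
     (\<exists>y\<in>instances perfect. represents s y \<and> (y \<in> vertex_partization r l \<longleftrightarrow> x \<in> vertex_partization r l) \<and>
       inst_size y \<le> A * snd x ^ (2 * d))" if inst: "x \<in> instances perfect" for x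
  proof -
    obtain G k where x: "x = (G, k)" by (cases x) auto
    define n where "n = card (verts G)"
    have G: "(G, k) \<in> instances perfect" "fin_graph G" "perfect G" "verts G = {..<n}" "k > 0"
      using inst x by (auto simp: instances_def n_def)
    interpret tuple_graph G n r l d using G d by unfold_locales
    define L where "L = sparsify (bad r l G) d k (tups n d)"
    define xs where "xs = filter (\<lambda>x. x \<in> (\<Union>v\<in>set L. set v)) [0..<n]"
    define M where "M = n + k + n * n + thr d k d"
    define N where "N = n * n + k"
    define H where "H = relabel G xs"
    have "set v \<subseteq> {..<n}" if "v \<in> set L" for v
      using that set_sparsify[of "bad r l G" d k "tups n d"] by (auto simp: L_def set_tups)
    then have xs: "distinct xs" "set xs = (\<Union>v\<in>set L. set v)" by (auto simp: xs_def)
    have xsV: "set xs \<subseteq> verts G" by (auto simp: xs_def G(4))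
    obtain t s where t: "exec p (input_state x) t s" "t \<le> sz p * (M + 1) ^ D" "represents s (H, k)"
      using exec_kernel_prog[OF G(1) L_def xs_def, of M] unfolding wp_def p_def D_def x H_def
      by (auto simp: M_def)
    have N1: "1 \<le> N" using G(5) by (simp add: N_def)
    have "n \<le> n * n" by simp
    moreover have "N \<le> N * N ^ d" "1 \<le> N * N ^ d" using N1 by simp_all
    moreover have "thr d k d \<le> (d + 1) ^ d * (N * N ^ d)"
    proof -
      have "thr d k d \<le> (d + 1) ^ d * N ^ d" using G(5) by (rule thr_le) (simp add: N_def)
      also have "\<dots> \<le> (d + 1) ^ d * (N * N ^ d)" using N1 by (intro mult_le_mono2) simp
      finally show ?thesis .
    qed
    ultimately have "M + 1 \<le> 3 * (N * N ^ d) + (d + 1) ^ d * (N * N ^ d)"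
      unfolding M_def using N_def by linarith
    then have MB: "M + 1 \<le> B * N ^ Suc d" by (simp add: B_def add_mult_distrib)
    have "(M + 1) ^ D \<le> (B * N ^ Suc d) ^ D" using MB by (rule power_mono) simp
    also have "\<dots> = B ^ D * N ^ (d * D + D)" by (simp add: power_mult_distrib power_mult[symmetric] power_add mult.commute)
    finally have "sz p * (M + 1) ^ D \<le> sz p * (B ^ D * N ^ (d * D + D))" by (rule mult_le_mono2)
    with t(2) have "t \<le> sz p * (B ^ D * N ^ (d * D + D))" by (rule le_trans)
    moreover have "inst_size x = N" by (simp add: inst_size_def x N_def n_def)
    ultimately have time: "t \<le> (sz p * B ^ D) * inst_size x ^ (d * D + D)"
      by (simp only: mult.assoc)
    have finH: "fin_graph H" unfolding H_def by (rule fin_graph_relabel[OF G(2)])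
    have perfH: "perfect H" unfolding H_def by (rule perfect_relabel[OF xs(1) xsV G(3)])
    have vH: "verts H = {..<length xs}" by (simp add: H_def relabel_def)
    have y: "(H, k) \<in> instances perfect" using finH perfH G(5) by (simp add: instances_def vH)
    have equiv: "(H, k) \<in> vertex_partization r l \<longleftrightarrow> x \<in> vertex_partization r l"
      by (simp only: x vertex_partization_iff_hitting_set[where d = d, OF finH perfH bound]
          vertex_partization_iff_hitting_set[where d = d, OF G(2,3) bound]
          relabel_hitting_set_iff[OF G(2,4) L_def xs, folded H_def])
    have "length xs = card (set xs)" using xs(1) by (simp add: distinct_card)
    also have "\<dots> \<le> d * thr d k d" unfolding xs(2) L_def
      by (rule card_vertices_sparsify) (simp add: set_tups)
    also have "\<dots> \<le> d * ((d + 1) ^ d * k ^ d)" using thr_le[of k k d] G(5) by (intro mult_le_mono2) simp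
    finally have "length xs * length xs \<le> (d * ((d + 1) ^ d * k ^ d)) * (d * ((d + 1) ^ d * k ^ d))"
      by (intro mult_le_mono)
    also have "\<dots> = (d * (d + 1) ^ d)\<^sup>2 * (k ^ d * k ^ d)"
      by (simp add: power2_eq_square mult_ac)
    also have "k ^ d * k ^ d = k ^ (2 * d)" by (simp add: mult_2 power_add)
    finally have "length xs * length xs \<le> (d * (d + 1) ^ d)\<^sup>2 * k ^ (2 * d)" .
    moreover have "k \<le> k ^ (2 * d)" using d by (intro self_le_power) (use G(5) in auto)
    ultimately have "length xs * length xs + k \<le> ((d * (d + 1) ^ d)\<^sup>2 + 1) * k ^ (2 * d)"
      unfolding add_mult_distrib by linarith
    also have "\<dots> \<le> A * k ^ (2 * d)" using A by (rule mult_le_mono1)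
    finally have "inst_size (H, k) \<le> A * snd x ^ (2 * d)" by (simp add: inst_size_def vH x)
    then show ?thesis using t(1,3) time y equiv by blast
  qed
  then show ?thesis unfolding has_kernel_def by blast
qed

(* The factor A depends on the fixed constants r and l only, and c is the constant hidden in the
   exponents O(d). "max 1 n" instead of n only concerns the graph without vertices. *)
theorem mainTheorem7:
  fixes f :: "nat \<Rightarrow> nat \<Rightarrow> nat"
  assumes "\<And>r l H. H \<in> forbidden_set r l \<Longrightarrow> card (verts H) \<le> f r l"
  shows "\<exists>c. \<forall>r l. \<exists>A. let d = f r l in
     has_kernel (instances perfect) (vertex_partization r l) (\<lambda>k. A * k ^ (c * d)) \<and>
     has_algorithm (instances perfect) (vertex_partization r l)
       (\<lambda>n k. A * d ^ k * max 1 n ^ (c * d))"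
proof (rule exI[of _ 2], intro allI)
  fix r l
  define d where "d = f r l"
  have bound: "\<And>H. H \<in> forbidden_set r l \<Longrightarrow> card (verts H) \<le> d"
    using assms by (simp add: d_def)
  have d: "d > 0" using bound by (rule forbidden_set_bound_pos)
  \<comment> \<open>The common exponent \<open>2 * d\<close> has two origins: the matrix of a kernel
    with order of \<open>k ^ d\<close> vertices, and the estimate \<open>d + 1 \<le> 2 * d\<close>
    for the loop depth of one round.\<close>
  define A where "A = (d * (d + 1) ^ d)\<^sup>2 + 1 + (20 + sz (fpt_round d r l) * 2 ^ (2 * d))"
  have "has_kernel (instances perfect) (vertex_partization r l) (\<lambda>k. A * k ^ (2 * d))"
    by (rule vertex_partization_has_kernel[OF bound d]) (simp_all add: A_def)
  moreover have "has_algorithm (instances perfect) (vertex_partization r l)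
       (\<lambda>n k. A * d ^ k * max 1 n ^ (2 * d))"
    by (rule vertex_partization_has_algorithm[OF bound d]) (simp_all add: A_def)
  ultimately show "\<exists>A. let d = f r l in
     has_kernel (instances perfect) (vertex_partization r l) (\<lambda>k. A * k ^ (2 * d)) \<and>
     has_algorithm (instances perfect) (vertex_partization r l)
       (\<lambda>n k. A * d ^ k * max 1 n ^ (2 * d))"
    unfolding Let_def d_def[symmetric] by blast
qed

end
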